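(* Let $(G,V)$ be an orthogonal representation of a compact Lie group $G$ on a Euclidean space $V$, let $N$ be a principal orbit, and suppose there is a $G$-invariant, $k$-dimensional distribution $\mathcal D$ on $N$ which is autoparallel in $N$, invariant under the second fundamental form of $N$, and satisfies property $(\mathrm P_{\mathrm{Euc}})$, that is: for each $p\in N$ and each $v\in\nu_p(N)$, if $u\in T_pN$ satisfies $A_vu=\lambda u$ for some $\lambda\neq 0$ and $u$ is orthogonal to $\mathcal D_p$, then $u\in T_p(G_qp)$, where $q=p+\frac1\lambda v$. Then $\mathrm{copol}(G,V)\leq k$ (and hence also $\mathrm{covar}(G,V)\leq k$).
   Context: $A_v$ is the Weingarten (shape) operator of $N$ in the normal direction $v$, $\nu_p(N)$ the normal space, and $G_q$ the isotropy group of $q$. A distribution $\mathcal D$ on $N$ is autoparallel in $N$ if $\nabla^N_XY\in\mathcal D$ for all sections $X,Y$ of $\mathcal D$, where $\nabla^N$ is the Levi-Civita connection of $N$; it is invariant under the second fundamental form $\alpha$ of $N$ if $\alpha(\mathcal D,\mathcal E)=0$, where $\mathcal E$ is the orthogonal complement of $\mathcal D$ in $TN$ (equivalently $\mathcal D_p$ is $A_v$-invariant for all $v\in\nu_pN$). Copolarity. A point is called $G$-regular if it lies on a principal orbit. For a nonnegative integer $k$, a $k$-section of $(G,V)$ is a connected, complete submanifold $\Sigma$ of $V$ such that: (C1) $\Sigma$ is totally geodesic in $V$; (C2) $\Sigma$ intersects all $G$-orbits; (C3) for every $G$-regular point $p\in\Sigma$, $T_p\Sigma$ contains the normal space $\nu_p(Gp)$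 as a subspace of codimension $k$; (C4) for every $G$-regular point $p\in\Sigma$, if $gp\in\Sigma$ for some $g\in G$, then $g\Sigma=\Sigma$. Through a given $G$-regular point, the set of all $k$-sections ($k=0,1,2,\dots$) has a unique minimal element with respect to inclusion; if this is a $k_0$-section then $\mathrm{copol}(G,V)=k_0$ (independent of the regular point). Variational co-completeness. For a principal orbit $N$, $p\in N$, $v\in\nu_p(N)$, $\gamma_v(t)=p+tv$, an $N$-Jacobi field along $\gamma_v$ is a Jacobi field $J$ with $J(0)\in T_pN$ and $J'(0)+A_vJ(0)\in\nu_p(N)$. A subspace $U_p\subset T_pV=T_pN\oplus\nu_pN$ has property (P) if: for each $v\in\nu_p(N)$, if an $N$-Jacobi field $J$ along $\gamma_v$ vanishes at some $t_0>0$ and $(J(0),J'(0)+A_vJ(0))$ is orthogonal to $U_p$, then $J$ is the restriction along $\gamma_v$ of a Killing field induced by $G$. One writes $\mathrm{covar}(G,V)\leq k$ if for every principal orbit $N$ there is (at some, equivalently every, $p\in N$) a subspace $U_p$ with property (P) and $\dim U_p\leq k$. *)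

theory Defs
  imports "HOL-Analysis.Analysis" "HOL-Algebra.Group_Action"
begin

section \<open>Smooth maps\<close>

text \<open>Iterated differentiability; the intended use is on open sets of Euclidean spaces.\<close>

primrec Ck_on ::
    "nat \<Rightarrow> 'a::euclidean_space set \<Rightarrow> ('a \<Rightarrow> 'b::real_normed_vector) \<Rightarrow> bool" where
  "Ck_on 0 S f \<longleftrightarrow> continuous_on S f"
| "Ck_on (Suc n) S f \<longleftrightarrow>
     (\<exists>f'. (\<forall>x\<in>S. (f has_derivative f' x) (at x)) \<and> (\<forall>v. Ck_on n S (\<lambda>x. f' x v)))"

text \<open>On an arbitrary set, smooth means locally extendable to a smooth map on an open set of
  the ambient space.  On open sets, open subsets of linear subspaces and embedded submanifolds
  this is the usual notion.\<close>

definition smooth_on ::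
    "'a::euclidean_space set \<Rightarrow> ('a \<Rightarrow> 'b::real_normed_vector) \<Rightarrow> bool" where
  "smooth_on S f \<longleftrightarrow>
     (\<forall>x\<in>S. \<exists>W F. open W \<and> x \<in> W \<and> (\<forall>n. Ck_on n W F) \<and> (\<forall>y\<in>S \<inter> W. F y = f y))"

section \<open>Lie groups and orthogonal representations\<close>

text \<open>A smooth manifold is a topological space \<open>X\<close> with an atlas \<open>A\<close> of pairs
  (domain, coordinate map).  The coordinates lie in a linear subspace \<open>E\<close> of a Euclidean space,
  because the types of class \<open>euclidean_space\<close> have positive dimension, and finite groups
  (dimension 0, \<open>E = {0}\<close>) must not be excluded.\<close>

definition smooth_manifold ::
    "'g topology \<Rightarrow> 'e::euclidean_space set \<Rightarrow> ('g set \<times> ('g \<Rightarrow> 'e)) set \<Rightarrow> bool" where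
  "smooth_manifold X E A \<longleftrightarrow>
     Hausdorff_space X \<and> second_countable X \<and> subspace E \<and>
     (\<Union>(U, \<phi>)\<in>A. U) = topspace X \<and>
     (\<forall>(U, \<phi>)\<in>A. openin X U \<and> openin (top_of_set E) (\<phi> ` U) \<and>
        homeomorphic_map (subtopology X U) (top_of_set (\<phi> ` U)) \<phi>) \<and>
     (\<forall>(U, \<phi>)\<in>A. \<forall>(W, \<psi>)\<in>A. smooth_on (\<phi> ` (U \<inter> W)) (\<psi> \<circ> inv_into U \<phi>))"

definition smooth_map ::
    "'g topology \<Rightarrow> ('g set \<times> ('g \<Rightarrow> 'e::euclidean_space)) set \<Rightarrow>
     'h topology \<Rightarrow> ('h set \<times> ('h \<Rightarrow> 'f::euclidean_space)) set \<Rightarrow> ('g \<Rightarrow> 'h) \<Rightarrow> bool" where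
  "smooth_map X A Y B f \<longleftrightarrow>
     continuous_map X Y f \<and>
     (\<forall>(U, \<phi>)\<in>A. \<forall>(W, \<psi>)\<in>B. smooth_on (\<phi> ` {x \<in> U. f x \<in> W}) (\<psi> \<circ> f \<circ> inv_into U \<phi>))"

definition prod_atlas ::
    "('g set \<times> ('g \<Rightarrow> 'e)) set \<Rightarrow> ('h set \<times> ('h \<Rightarrow> 'f)) set \<Rightarrow>
     (('g \<times> 'h) set \<times> ('g \<times> 'h \<Rightarrow> 'e \<times> 'f)) set" where
  "prod_atlas A B = {(U \<times> W, map_prod \<phi> \<psi>) | U \<phi> W \<psi>. (U, \<phi>) \<in> A \<and> (W, \<psi>) \<in> B}"

definition lie_group ::
    "('g, 'm) monoid_scheme \<Rightarrow> 'g topology \<Rightarrow> 'e::euclidean_space set \<Rightarrow>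
     ('g set \<times> ('g \<Rightarrow> 'e)) set \<Rightarrow> bool" where
  "lie_group G X E A \<longleftrightarrow>
     group G \<and> topspace X = carrier G \<and> smooth_manifold X E A \<and>
     smooth_map (prod_topology X X) (prod_atlas A A) X A (\<lambda>(g, h). g \<otimes>\<^bsub>G\<^esub> h) \<and>
     smooth_map X A X A (\<lambda>g. inv\<^bsub>G\<^esub> g)"

text \<open>For Lie groups, continuity of a representation is equivalent to its smoothness.\<close>

definition orthogonal_representation ::
    "('g, 'm) monoid_scheme \<Rightarrow> 'g topology \<Rightarrow> ('g \<Rightarrow> 'v::euclidean_space \<Rightarrow> 'v) \<Rightarrow> bool" where
  "orthogonal_representation G X \<rho> \<longleftrightarrow>
     group_action G UNIV \<rho> \<and>
     (\<forall>g\<in>carrier G. orthogonal_transformation (\<rho> g)) \<and>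
     (\<forall>p. continuous_map X euclidean (\<lambda>g. \<rho> g p))"

text \<open>\<open>p\<close> is regular if its isotropy group is, up to conjugation, contained in every other
  isotropy group, i.e. if its orbit has maximal orbit type.\<close>

definition regular_point ::
    "('g, 'm) monoid_scheme \<Rightarrow> ('g \<Rightarrow> 'v \<Rightarrow> 'v) \<Rightarrow> 'v \<Rightarrow> bool" where
  "regular_point G \<rho> p \<longleftrightarrow>
     (\<forall>q. \<exists>h\<in>carrier G.
        (\<lambda>g. inv\<^bsub>G\<^esub> h \<otimes>\<^bsub>G\<^esub> g \<otimes>\<^bsub>G\<^esub> h) ` stabilizer G \<rho> p \<subseteq> stabilizer G \<rho> q)"

definition principal_orbit ::
    "('g, 'm) monoid_scheme \<Rightarrow> ('g \<Rightarrow> 'v \<Rightarrow> 'v) \<Rightarrow> 'v set \<Rightarrow> bool" where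
  "principal_orbit G \<rho> N \<longleftrightarrow> (\<exists>p. regular_point G \<rho> p \<and> N = orbit G \<rho> p)"

definition isotropy_orbit ::
    "('g, 'm) monoid_scheme \<Rightarrow> ('g \<Rightarrow> 'v \<Rightarrow> 'v) \<Rightarrow> 'v \<Rightarrow> 'v \<Rightarrow> 'v set" where
  "isotropy_orbit G \<rho> q p = {\<rho> g p | g. g \<in> stabilizer G \<rho> q}"

text \<open>The Killing fields of \<open>V\<close> induced by \<open>G\<close>: the infinitesimal generators of the
  one-parameter groups of isometries of \<open>V\<close> that consist of transformations \<open>\<rho> g\<close>.\<close>

definition induced_Killing_field ::
    "('g, 'm) monoid_scheme \<Rightarrow> ('g \<Rightarrow> 'v \<Rightarrow> 'v) \<Rightarrow> ('v::euclidean_space \<Rightarrow> 'v) \<Rightarrow> bool" where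
  "induced_Killing_field G \<rho> K \<longleftrightarrow>
     (\<exists>\<theta> :: real \<Rightarrow> 'v \<Rightarrow> 'v.
        (\<forall>t. \<theta> t \<in> \<rho> ` carrier G) \<and> \<theta> 0 = id \<and> (\<forall>s t. \<theta> (s + t) = \<theta> s \<circ> \<theta> t) \<and>
        (\<forall>q. ((\<lambda>t. \<theta> t q) has_vector_derivative K q) (at 0)))"

section \<open>Submanifolds of Euclidean space\<close>

text \<open>Embedded submanifolds of dimension \<open>d\<close>, via straightening diffeomorphisms.\<close>

definition submanifold :: "nat \<Rightarrow> 'v::euclidean_space set \<Rightarrow> bool" where
  "submanifold d N \<longleftrightarrow>
     (\<forall>p\<in>N. \<exists>W W' \<Phi> \<Psi> E.
        open W \<and> p \<in> W \<and> open W' \<and> homeomorphism W W' \<Phi> \<Psi> \<and>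
        smooth_on W (\<Phi> :: 'v \<Rightarrow> 'v) \<and> smooth_on W' \<Psi> \<and>
        subspace E \<and> dim E = d \<and> \<Phi> ` (W \<inter> N) = W' \<inter> E)"

definition curve_in :: "'v::euclidean_space set \<Rightarrow> 'v \<Rightarrow> 'v \<Rightarrow> (real \<Rightarrow> 'v) \<Rightarrow> bool" where
  "curve_in N p u c \<longleftrightarrow>
     (\<exists>e>0. smooth_on {-e<..<e} c \<and> c ` {-e<..<e} \<subseteq> N) \<and>
     c 0 = p \<and> (c has_vector_derivative u) (at 0)"

definition tangent_space :: "'v::euclidean_space set \<Rightarrow> 'v \<Rightarrow> 'v set" where
  "tangent_space N p = {u. \<exists>c. curve_in N p u c}"

definition normal_space :: "'v::euclidean_space set \<Rightarrow> 'v \<Rightarrow> 'v set" where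
  "normal_space N p = (tangent_space N p)\<^sup>\<bottom>"

definition orth_proj :: "'v::euclidean_space set \<Rightarrow> 'v \<Rightarrow> 'v" where
  "orth_proj T w = (THE t. t \<in> T \<and> w - t \<in> T\<^sup>\<bottom>)"

text \<open>The derivative of a vector-valued map \<open>Y\<close> defined along \<open>N\<close> in the direction of
  \<open>u \<in> tangent_space N p\<close>; only the values of \<open>Y\<close> on \<open>N\<close> matter.\<close>

definition deriv_along ::
    "'v::euclidean_space set \<Rightarrow> ('v \<Rightarrow> 'v) \<Rightarrow> 'v \<Rightarrow> 'v \<Rightarrow> 'v" where
  "deriv_along N Y p u =
     (THE w. \<forall>c. curve_in N p u c \<longrightarrow> ((\<lambda>t. Y (c t)) has_vector_derivative w) (at 0))"

definition tangent_field :: "'v::euclidean_space set \<Rightarrow> ('v \<Rightarrow> 'v) \<Rightarrow> bool" where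
  "tangent_field N Y \<longleftrightarrow> smooth_on N Y \<and> (\<forall>q\<in>N. Y q \<in> tangent_space N q)"

text \<open>The Levi-Civita connection of the induced metric is the tangential part of the flat
  connection of the ambient space, and the second fundamental form is the normal part.\<close>

definition levi_civita ::
    "'v::euclidean_space set \<Rightarrow> ('v \<Rightarrow> 'v) \<Rightarrow> ('v \<Rightarrow> 'v) \<Rightarrow> 'v \<Rightarrow> 'v" where
  "levi_civita N Y Z p = orth_proj (tangent_space N p) (deriv_along N Z p (Y p))"

definition second_form :: "'v::euclidean_space set \<Rightarrow> 'v \<Rightarrow> 'v \<Rightarrow> 'v \<Rightarrow> 'v" where
  "second_form N p x y =
     (THE a. \<forall>Y. tangent_field N Y \<and> Y p = y \<longrightarrow>
        a = orth_proj (normal_space N p) (deriv_along N Y p x))"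

definition shape_operator :: "'v::euclidean_space set \<Rightarrow> 'v \<Rightarrow> 'v \<Rightarrow> 'v \<Rightarrow> 'v" where
  "shape_operator N p v x =
     (THE a. a \<in> tangent_space N p \<and>
        (\<forall>y\<in>tangent_space N p. a \<bullet> y = second_form N p x y \<bullet> v))"

definition totally_geodesic :: "'v::euclidean_space set \<Rightarrow> bool" where
  "totally_geodesic N \<longleftrightarrow>
     (\<forall>p\<in>N. \<forall>x\<in>tangent_space N p. \<forall>y\<in>tangent_space N p. second_form N p x y = 0)"

text \<open>A curve in \<open>N\<close> is a geodesic of \<open>N\<close> iff its acceleration is normal to \<open>N\<close>.
  Completeness is that of the Riemannian manifold \<open>N\<close> with the induced metric.\<close>

definition geodesic_line :: "'v::euclidean_space set \<Rightarrow> (real \<Rightarrow> 'v) \<Rightarrow> bool" where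
  "geodesic_line N c \<longleftrightarrow>
     smooth_on UNIV c \<and> range c \<subseteq> N \<and>
     (\<forall>t. vector_derivative (\<lambda>s. vector_derivative c (at s)) (at t) \<in> normal_space N (c t))"

definition geodesically_complete :: "'v::euclidean_space set \<Rightarrow> bool" where
  "geodesically_complete N \<longleftrightarrow>
     (\<forall>p\<in>N. \<forall>u\<in>tangent_space N p. \<exists>c. geodesic_line N c \<and> curve_in N p u c)"

section \<open>Distributions\<close>

definition distribution_on ::
    "'v::euclidean_space set \<Rightarrow> nat \<Rightarrow> ('v \<Rightarrow> 'v set) \<Rightarrow> bool" where
  "distribution_on N k D \<longleftrightarrow>
     (\<forall>p\<in>N. subspace (D p) \<and> D p \<subseteq> tangent_space N p \<and> dim (D p) = k) \<and>
     (\<forall>p\<in>N. \<exists>W Y. open W \<and> p \<in> W \<and>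
        (\<forall>i<k. smooth_on (N \<inter> W) (Y i)) \<and>
        (\<forall>q\<in>N \<inter> W. D q = span ((\<lambda>i::nat. Y i q) ` {..<k})))"

definition section_of ::
    "'v::euclidean_space set \<Rightarrow> ('v \<Rightarrow> 'v set) \<Rightarrow> ('v \<Rightarrow> 'v) \<Rightarrow> bool" where
  "section_of N D Y \<longleftrightarrow> smooth_on N Y \<and> (\<forall>q\<in>N. Y q \<in> D q)"

definition invariant_distribution ::
    "('g, 'm) monoid_scheme \<Rightarrow> ('g \<Rightarrow> 'v \<Rightarrow> 'v) \<Rightarrow> 'v set \<Rightarrow> ('v \<Rightarrow> 'v set) \<Rightarrow> bool" where
  "invariant_distribution G \<rho> N D \<longleftrightarrow> (\<forall>g\<in>carrier G. \<forall>p\<in>N. D (\<rho> g p) = \<rho> g ` D p)"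

definition autoparallel_on :: "'v::euclidean_space set \<Rightarrow> ('v \<Rightarrow> 'v set) \<Rightarrow> bool" where
  "autoparallel_on N D \<longleftrightarrow>
     (\<forall>Y Z. section_of N D Y \<and> section_of N D Z \<longrightarrow> (\<forall>p\<in>N. levi_civita N Y Z p \<in> D p))"

definition second_form_invariant :: "'v::euclidean_space set \<Rightarrow> ('v \<Rightarrow> 'v set) \<Rightarrow> bool" where
  "second_form_invariant N D \<longleftrightarrow>
     (\<forall>p\<in>N. \<forall>x\<in>D p. \<forall>y\<in>tangent_space N p \<inter> (D p)\<^sup>\<bottom>. second_form N p x y = 0)"

definition property_P_Euc ::
    "('g, 'm) monoid_scheme \<Rightarrow> ('g \<Rightarrow> 'v::euclidean_space \<Rightarrow> 'v) \<Rightarrow> 'v set \<Rightarrow>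
     ('v \<Rightarrow> 'v set) \<Rightarrow> bool" where
  "property_P_Euc G \<rho> N D \<longleftrightarrow>
     (\<forall>p\<in>N. \<forall>v\<in>normal_space N p. \<forall>u\<in>tangent_space N p. \<forall>l::real.
        l \<noteq> 0 \<and> shape_operator N p v u = l *\<^sub>R u \<and> u \<in> (D p)\<^sup>\<bottom> \<longrightarrow>
        u \<in> tangent_space (isotropy_orbit G \<rho> (p + (1 / l) *\<^sub>R v) p) p)"

section \<open>Copolarity\<close>

definition k_section ::
    "('g, 'm) monoid_scheme \<Rightarrow> ('g \<Rightarrow> 'v::euclidean_space \<Rightarrow> 'v) \<Rightarrow> nat \<Rightarrow> 'v set \<Rightarrow> bool" where
  "k_section G \<rho> k S \<longleftrightarrow>
     connected S \<and> (\<exists>d. submanifold d S) \<and> geodesically_complete S \<and>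
     totally_geodesic S \<and>
     (\<forall>q. orbit G \<rho> q \<inter> S \<noteq> {}) \<and>
     (\<forall>p\<in>S. regular_point G \<rho> p \<longrightarrow>
        normal_space (orbit G \<rho> p) p \<subseteq> tangent_space S p \<and>
        dim (tangent_space S p) = dim (normal_space (orbit G \<rho> p) p) + k) \<and>
     (\<forall>p\<in>S. regular_point G \<rho> p \<longrightarrow> (\<forall>g\<in>carrier G. \<rho> g p \<in> S \<longrightarrow> \<rho> g ` S = S))"

definition sections_through ::
    "('g, 'm) monoid_scheme \<Rightarrow> ('g \<Rightarrow> 'v::euclidean_space \<Rightarrow> 'v) \<Rightarrow> 'v \<Rightarrow> 'v set set" where
  "sections_through G \<rho> p = {S. p \<in> S \<and> (\<exists>k. k_section G \<rho> k S)}"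

definition minimal_section ::
    "('g, 'm) monoid_scheme \<Rightarrow> ('g \<Rightarrow> 'v::euclidean_space \<Rightarrow> 'v) \<Rightarrow> 'v \<Rightarrow> 'v set" where
  "minimal_section G \<rho> p =
     (THE S. S \<in> sections_through G \<rho> p \<and> (\<forall>S'\<in>sections_through G \<rho> p. S' \<subseteq> S \<longrightarrow> S' = S))"

text \<open>Well defined: the minimal section through a regular point is unique, and its \<open>k\<close> does
  not depend on the regular point.\<close>

definition copol ::
    "('g, 'm) monoid_scheme \<Rightarrow> ('g \<Rightarrow> 'v::euclidean_space \<Rightarrow> 'v) \<Rightarrow> nat" where
  "copol G \<rho> =
     (THE k. \<forall>p. regular_point G \<rho> p \<longrightarrow> k_section G \<rho> k (minimal_section G \<rho> p))"

section \<open>Variational co-completeness\<close>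

text \<open>Jacobi fields along any geodesic of the flat space \<open>V\<close> are the solutions of \<open>J'' = 0\<close>,
  as the curvature term of the Jacobi equation vanishes.  \<open>J'\<close> is the derivative of \<open>J\<close>.\<close>

definition Jacobi_field :: "(real \<Rightarrow> 'v::euclidean_space) \<Rightarrow> (real \<Rightarrow> 'v) \<Rightarrow> bool" where
  "Jacobi_field J J' \<longleftrightarrow>
     (\<forall>t. (J has_vector_derivative J' t) (at t)) \<and> (\<forall>t. (J' has_vector_derivative 0) (at t))"

definition N_Jacobi_field ::
    "'v::euclidean_space set \<Rightarrow> 'v \<Rightarrow> 'v \<Rightarrow> (real \<Rightarrow> 'v) \<Rightarrow> (real \<Rightarrow> 'v) \<Rightarrow> bool" where
  "N_Jacobi_field N p v J J' \<longleftrightarrow>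
     Jacobi_field J J' \<and> J 0 \<in> tangent_space N p \<and>
     J' 0 + shape_operator N p v (J 0) \<in> normal_space N p"

text \<open>The pair \<open>(J(0), J'(0) + A\<^sub>v J(0))\<close> of the direct sum of tangent and normal space is
  identified with the sum of its two components.\<close>

definition property_P ::
    "('g, 'm) monoid_scheme \<Rightarrow> ('g \<Rightarrow> 'v::euclidean_space \<Rightarrow> 'v) \<Rightarrow> 'v set \<Rightarrow> 'v \<Rightarrow>
     'v set \<Rightarrow> bool" where
  "property_P G \<rho> N p U \<longleftrightarrow>
     (\<forall>v\<in>normal_space N p. \<forall>J J'.
        N_Jacobi_field N p v J J' \<and> (\<exists>t0>0. J t0 = 0) \<and>
        J 0 + (J' 0 + shape_operator N p v (J 0)) \<in> U\<^sup>\<bottom> \<longrightarrow>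
        (\<exists>K. induced_Killing_field G \<rho> K \<and> (\<forall>t. J t = K (p + t *\<^sub>R v))))"

definition covar_le ::
    "('g, 'm) monoid_scheme \<Rightarrow> ('g \<Rightarrow> 'v::euclidean_space \<Rightarrow> 'v) \<Rightarrow> nat \<Rightarrow> bool" where
  "covar_le G \<rho> k \<longleftrightarrow>
     (\<forall>N. principal_orbit G \<rho> N \<longrightarrow>
        (\<forall>p\<in>N. \<exists>U. subspace U \<and> dim U \<le> k \<and> property_P G \<rho> N p U))"

end

theory Submission
  imports Defs
begin

text \<open>
  Let \<open>H\<close> be the compact group of orthogonal transformations given by the representation and
  \<open>lie\<close> its Lie algebra of skew endomorphisms; the tangent spaces of the orbits are \<open>lie \<star> p\<close>.  For
  a regular \<open>p \<in> N\<close> put \<open>E = T\<^sub>pN \<inter> (D p)\<^sup>\<bottom>\<close> and \<open>\<Sigma> = E\<^sup>\<bottom>\<close>, the sum of \<open>D p\<close> and the normal space.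
  Autoparallelity and invariance under the second fundamental form say that the \<open>X \<in> lie\<close> with
  \<open>X \<star> p \<in> D p\<close> preserve \<open>\<Sigma>\<close>, so by compactness every point of \<open>\<Sigma>\<close> can be moved within \<open>\<Sigma>\<close> into the
  normal space at \<open>p\<close>.  For \<open>q\<close> in that space, property \<open>(P\<^sub>E\<^sub>u\<^sub>c)\<close>, applied to an eigenbasis of a shape
  operator on \<open>E\<close>, yields \<open>E \<subseteq> lie \<star> q\<close> whenever the orbit of \<open>q\<close> has maximal dimension.
  Hence \<open>\<Sigma>\<close> contains the normal spaces at all its points on such orbits.

  \<open>\<Sigma>\<close> itself may violate (C4) if the group is disconnected.  But the smallest linear subspace through
  \<open>p\<close> that contains the normal spaces at its regular points is a section: it is equivariant in \<open>p\<close>,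
  and dimension counting makes it independent of the regular point chosen in it.  It lies in every
  section through \<open>p\<close>, because sections are linear, so it is the minimal one; it also lies in \<open>\<Sigma>\<close>.

  For the second claim, the initial value of a vanishing Jacobi field orthogonal to \<open>\<Sigma>\<close> is normal to
  the orbit of the focal point \<open>r\<close>; the normal spaces at nearby points on the ray from \<open>r\<close> converge to
  the part of the normal space at \<open>r\<close> orthogonal to the orbit of the slice representation, which
  therefore lies in \<open>\<Sigma>\<close>.  So the initial value is tangent to an orbit of the isotropy group of \<open>r\<close>.
\<close>

text \<open>Every hypothesis becomes a linear condition on \<open>lie\<close> at the single point
  \<open>p\<close>: the shape operator in direction \<open>v\<close> sends
  \<open>X \<star> p\<close> to minus the tangential part of \<open>X \<star> v\<close>, and a
  section of \<open>D\<close> along \<open>exp (t *\<^sub>R X) \<star> p\<close> is compared with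
  the orthogonal complement of \<open>D\<close>, which the group carries along. This needs the
  tangent spaces of orbits to be exactly \<open>lie \<star> p\<close>, hence a form of the closed
  subgroup theorem.

  The inclusion \<open>E \<subseteq> lie \<star> q\<close> rests on a linear map \<open>a\<close> of
  \<open>E\<close> into itself with \<open>Y \<star> p = u\<close> and
  \<open>Y \<star> q = a u\<close> for some \<open>Y\<close> in \<open>lie\<close>. It is injective
  because the isotropy algebra at a point of maximal orbit dimension kills the normal space there,
  and because normality is symmetric: if \<open>q\<close> is normal at \<open>p\<close>, then
  \<open>p\<close> is normal at \<open>q\<close>.

  The property of \<Sigma> is proved for maximal orbit dimension instead of regularity, since the
  points of a ray near a focal point are controlled through dimensions of tangent spaces. The
  minimal section is defined with regular points, the ones that occur in (C3).\<close>

section \<open>The Banach algebra of endomorphisms\<close>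

text \<open>A copy of the type \<open>'v \<Rightarrow>\<^sub>L 'v\<close>, because an arity for \<open>\<Rightarrow>\<^sub>L\<close> cannot require equal
  arguments; as an instance of the Banach algebra classes it has \<^const>\<open>exp\<close>.\<close>

typedef (overloaded) 'v endo = "UNIV :: ('v::euclidean_space \<Rightarrow>\<^sub>L 'v) set"
  morphisms blin_of endo_of by simp

setup_lifting type_definition_endo

instantiation endo :: (euclidean_space) real_normed_vector
begin

lift_definition zero_endo :: "'a endo" is 0 .
lift_definition plus_endo :: "'a endo \<Rightarrow> 'a endo \<Rightarrow> 'a endo" is "(+)" .
lift_definition minus_endo :: "'a endo \<Rightarrow> 'a endo \<Rightarrow> 'a endo" is "(-)" .
lift_definition uminus_endo :: "'a endo \<Rightarrow> 'a endo" is uminus .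
lift_definition scaleR_endo :: "real \<Rightarrow> 'a endo \<Rightarrow> 'a endo" is scaleR .
lift_definition norm_endo :: "'a endo \<Rightarrow> real" is norm .
lift_definition sgn_endo :: "'a endo \<Rightarrow> 'a endo" is sgn .
lift_definition dist_endo :: "'a endo \<Rightarrow> 'a endo \<Rightarrow> real" is dist .

definition uniformity_endo :: "('a endo \<times> 'a endo) filter" where
  "uniformity_endo = (INF e\<in>{0 <..}. principal {(x, y). dist x y < e})"

definition open_endo :: "'a endo set \<Rightarrow> bool" where
  "open_endo S = (\<forall>x\<in>S. \<forall>\<^sub>F (x', y) in uniformity. x' = x \<longrightarrow> y \<in> S)"

instance
proof
  fix x y z :: "'a endo" and a b :: real and U :: "'a endo set"
  show "dist x y = norm (x - y)"
    by transfer (simp add: dist_norm)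
  show "norm (x + y) \<le> norm x + norm y"
    by transfer (rule norm_triangle_ineq)
  show "open U = (\<forall>x\<in>U. \<forall>\<^sub>F (x', y) in uniformity. x' = x \<longrightarrow> y \<in> U)"
    by (rule open_endo_def)
  show "uniformity = (INF e\<in>{0 <..}. principal {(x :: 'a endo, y). dist x y < e})"
    by (rule uniformity_endo_def)
  show "x + y + z = x + (y + z)" "x + y = y + x" "0 + x = x" "- x + x = 0" "x - y = x + - y"
    "norm x = 0 \<longleftrightarrow> x = 0" "norm (a *\<^sub>R x) = \<bar>a\<bar> * norm x"
    "a *\<^sub>R (x + y) = a *\<^sub>R x + a *\<^sub>R y" "(a + b) *\<^sub>R x = a *\<^sub>R x + b *\<^sub>R x"
    "a *\<^sub>R b *\<^sub>R x = (a * b) *\<^sub>R x" "1 *\<^sub>R x = x"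
    by (transfer; simp add: scaleR_add_left scaleR_add_right)+
  show "sgn x = inverse (norm x) *\<^sub>R x"
    by transfer (simp add: sgn_div_norm)
qed

end

instantiation endo :: (euclidean_space) real_normed_algebra_1
begin

lift_definition one_endo :: "'a endo" is id_blinfun .
lift_definition times_endo :: "'a endo \<Rightarrow> 'a endo \<Rightarrow> 'a endo" is "(o\<^sub>L)" .

instance
proof
  fix x y z :: "'a endo"
  show "norm (x * y) \<le> norm x * norm y"
    by transfer (rule norm_blinfun_compose)
  show "norm (1 :: 'a endo) = 1"
    by transfer (rule norm_blinfun_id)
  show "(0 :: 'a endo) \<noteq> 1"
    by transfer (metis norm_blinfun_id norm_zero zero_neq_one)
qed (transfer, auto intro!: blinfun_eqI simp: blinfun.bilinear_simps)+

end

lemma dist_blin_of: "dist (blin_of x) (blin_of y) = dist x y"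
  by transfer simp

text \<open>Source of convergent subsequences of normalized difference quotients, and also of the
  completeness behind \<open>exp\<close>.\<close>

instance endo :: (euclidean_space) heine_borel
proof
  fix f :: "nat \<Rightarrow> 'a endo"
  assume "bounded (range f)"
  then have "bounded (range (blin_of \<circ> f))"
    unfolding bounded_def by (auto simp: dist_blin_of) (metis UNIV_I blin_of_cases dist_blin_of)
  then obtain l r where r: "strict_mono r" "((blin_of \<circ> f) \<circ> r) \<longlonglongrightarrow> l"
    using bounded_imp_convergent_subsequence by blast
  then have "(f \<circ> r) \<longlonglongrightarrow> endo_of l"
    by (simp add: tendsto_iff o_def flip: dist_blin_of) (simp add: endo_of_inverse)
  with r show "\<exists>l r. strict_mono r \<and> (f \<circ> r) \<longlonglongrightarrow> l"
    by blast
qed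

instance endo :: (euclidean_space) banach ..

lift_definition app :: "'v::euclidean_space endo \<Rightarrow> 'v \<Rightarrow> 'v" (infixr "\<star>" 75)
  is blinfun_apply .

lemma bounded_bilinear_app: "bounded_bilinear (\<star>)"
proof
  show "\<exists>K. \<forall>(a::'a endo) b. norm (a \<star> b) \<le> norm a * norm b * K"
    by (rule exI[of _ 1], transfer) (simp add: norm_blinfun)
qed (transfer; simp add: blinfun.bilinear_simps)+

interpretation app: bounded_bilinear "(\<star>) :: 'v::euclidean_space endo \<Rightarrow> 'v \<Rightarrow> 'v"
  by (rule bounded_bilinear_app)

lemma endo_eqI: "(\<And>v. X \<star> v = Y \<star> v) \<Longrightarrow> X = Y"
  by transfer (rule blinfun_eqI)

lemma app_times [simp]: "(X * Y) \<star> v = X \<star> Y \<star> v"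
  by transfer simp

lemma app_one [simp]: "1 \<star> v = v"
  by transfer simp

lemma norm_endo_le: "(\<And>v. norm (X \<star> v) \<le> c * norm v) \<Longrightarrow> 0 \<le> c \<Longrightarrow> norm X \<le> c"
  by transfer (rule norm_blinfun_bound)

text \<open>Meaningful for linear maps only: \<open>Blinfun\<close> is unspecified on functions that
  are not bounded linear.\<close>

lift_definition endo :: "('v::euclidean_space \<Rightarrow> 'v) \<Rightarrow> 'v endo" is Blinfun .

lemma app_endo: "linear f \<Longrightarrow> endo f \<star> v = f v"
  by transfer (simp add: bounded_linear_Blinfun_apply linear_conv_bounded_linear)

lemma linear_app [simp]: "linear ((\<star>) X)"
  by (simp add: app.bounded_linear_right bounded_linear.linear)

section \<open>The Lie algebra of a compact group of orthogonal maps\<close>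

declare app.zero_left [simp] app.zero_right [simp]

lemma has_vector_derivative_quotient:
  assumes "(f has_vector_derivative d) (at x)"
  shows "((\<lambda>h. (f (x + h) - f x) /\<^sub>R h) \<longlongrightarrow> d) (at 0)"
proof -
  have "((\<lambda>h. norm (f (x + h) - f x - h *\<^sub>R d) / norm h) \<longlongrightarrow> 0) (at 0)"
    using assms by (simp add: has_vector_derivative_def has_derivative_at)
  moreover have "\<forall>\<^sub>F h in at 0. norm (f (x + h) - f x - h *\<^sub>R d) / norm h
      = norm ((f (x + h) - f x) /\<^sub>R h - d)"
    unfolding eventually_at_filter
  proof (rule always_eventually, intro allI impI)
    fix h :: real
    assume "h \<noteq> 0"
    then have "(f (x + h) - f x) /\<^sub>R h - d = (f (x + h) - f x - h *\<^sub>R d) /\<^sub>R h"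
      by (simp add: scaleR_diff_right)
    then show "norm (f (x + h) - f x - h *\<^sub>R d) / norm h = norm ((f (x + h) - f x) /\<^sub>R h - d)"
      by (simp add: divide_inverse mult.commute)
  qed
  ultimately have "((\<lambda>h. norm ((f (x + h) - f x) /\<^sub>R h - d)) \<longlongrightarrow> 0) (at 0)"
    using tendsto_cong by force
  then show ?thesis
    using LIM_zero_iff tendsto_norm_zero_iff by blast
qed

lemma has_vector_derivative_sequentially:
  assumes "(f has_vector_derivative d) (at x)" "s \<longlonglongrightarrow> 0" "\<And>n. s n \<noteq> 0"
  shows "(\<lambda>n. (f (x + s n) - f x) /\<^sub>R s n) \<longlonglongrightarrow> d"
proof -
  have "filterlim s (at 0) sequentially"
    using assms(2,3) by (simp add: filterlim_at)
  then show ?thesis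
    by (rule filterlim_compose[OF has_vector_derivative_quotient[OF assms(1)]])
qed

lemma exp_quotient_tendsto:
  fixes X :: "'a::{real_normed_algebra_1,banach}"
  assumes "s \<longlonglongrightarrow> 0" "\<And>n. s n \<noteq> 0"
  shows "(\<lambda>n. (exp (s n *\<^sub>R X) - 1) /\<^sub>R s n) \<longlonglongrightarrow> X"
  using has_vector_derivative_sequentially[OF exp_scaleR_has_vector_derivative_left[of X 0] assms]
  by simp

lemma isCont_exp_scaleR:
  fixes X :: "'a::{real_normed_algebra_1,banach}"
  shows "isCont (\<lambda>t. exp (t *\<^sub>R X)) t"
  using has_vector_derivative_continuous[OF exp_scaleR_has_vector_derivative_left] .

lemma exp_scaleR_power:
  fixes X :: "'a::{real_normed_algebra_1,banach}"
  shows "exp (t *\<^sub>R X) ^ m = exp ((real m * t) *\<^sub>R X)"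
proof (induction m)
  case (Suc m)
  have "exp ((real (Suc m) * t) *\<^sub>R X) = exp (t *\<^sub>R X + (real m * t) *\<^sub>R X)"
    by (simp add: algebra_simps)
  also have "\<dots> = exp (t *\<^sub>R X) * exp ((real m * t) *\<^sub>R X)"
    by (rule exp_add_commuting) simp
  finally show ?case
    by (simp add: Suc)
qed simp

text \<open>The product rule for difference quotients at 1, as an exact identity.\<close>

lemma scaleR_mult_diff_one:
  fixes a b :: "'a::real_algebra_1"
  shows "(a - 1) /\<^sub>R s * b + (b - 1) /\<^sub>R s = (a * b - 1) /\<^sub>R s"
proof -
  have "(a - 1) /\<^sub>R s * b + (b - 1) /\<^sub>R s = ((a - 1) * b + (b - 1)) /\<^sub>R s"
    by (simp only: mult_scaleR_left scaleR_add_right)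
  also have "(a - 1) * b + (b - 1) = a * b - 1"
    by (simp add: algebra_simps)
  finally show ?thesis .
qed

text \<open>Telescoping. In the application \<open>a\<close> is a group element, hence a
  contraction, whereas \<open>b\<close> is the exponential of an endomorphism not yet known to be
  skew; its growth is absorbed by \<open>B ^ m\<close>.\<close>

lemma norm_power_diff_le:
  fixes a b :: "'a::real_normed_algebra_1"
  assumes "norm a \<le> 1" "norm b \<le> B" "1 \<le> B"
  shows "norm (a ^ m - b ^ m) \<le> m * norm (a - b) * B ^ m"
proof (induction m)
  case (Suc m)
  have "a ^ Suc m - b ^ Suc m = a ^ m * (a - b) + (a ^ m - b ^ m) * b"
    by (simp add: algebra_simps flip: power_Suc2)
  then have "norm (a ^ Suc m - b ^ Suc m) \<le> norm (a ^ m * (a - b)) + norm ((a ^ m - b ^ m) * b)"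
    by (simp add: norm_triangle_ineq)
  also have "norm (a ^ m * (a - b)) \<le> 1 * norm (a - b)"
    by (meson norm_mult_ineq order_trans mult_right_mono norm_ge_zero norm_power_ineq power_le_one assms(1))
  also have "1 * norm (a - b) \<le> norm (a - b) * B ^ Suc m"
    using one_le_power[OF assms(3), of "Suc m"] by (simp add: mult_le_cancel_left1)
  also have "norm ((a ^ m - b ^ m) * b) \<le> m * norm (a - b) * B ^ m * B"
    using assms(3) by (intro order_trans[OF norm_mult_ineq] mult_mono Suc assms(2)) auto
  finally show ?case
    by (simp add: algebra_simps)
qed simp

locale orthogonal_group =
  fixes H :: "'v::euclidean_space endo set"
  assumes compact: "compact H"
    and one_mem: "1 \<in> H"
    and mult_mem: "g \<in> H \<Longrightarrow> h \<in> H \<Longrightarrow> g * h \<in> H"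
    and inverse_mem: "g \<in> H \<Longrightarrow> \<exists>h\<in>H. g * h = 1 \<and> h * g = 1"
    and inner_app: "g \<in> H \<Longrightarrow> (g \<star> x) \<bullet> (g \<star> y) = x \<bullet> y"
begin

definition lie :: "'v endo set" where
  "lie = {X. \<forall>t. exp (t *\<^sub>R X) \<in> H}"

lemma norm_app: "g \<in> H \<Longrightarrow> norm (g \<star> x) = norm x"
  by (simp add: norm_eq_sqrt_inner inner_app)

lemma norm_le_1: "g \<in> H \<Longrightarrow> norm g \<le> 1"
  by (rule norm_endo_le) (simp_all add: norm_app)

lemma inverse_app: "g \<in> H \<Longrightarrow> \<exists>h\<in>H. (\<forall>x. g \<star> h \<star> x = x \<and> h \<star> g \<star> x = x)"
  using inverse_mem by (metis app_one app_times)

lemma power_mem: "g \<in> H \<Longrightarrow> g ^ n \<in> H"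
  by (induction n) (auto simp: one_mem mult_mem)

lemma exp_minus_scaleR: "exp (- t *\<^sub>R X) * exp (t *\<^sub>R X) = (1 :: 'v endo)"
    "exp (t *\<^sub>R X) * exp (- t *\<^sub>R X) = (1 :: 'v endo)"
  using exp_minus_inverse[of "t *\<^sub>R X"] exp_minus_inverse[of "- t *\<^sub>R X"] by simp_all

lemma inverse_mem_eq:
  assumes "g \<in> H" "h * g = 1"
  shows "h \<in> H"
proof -
  obtain h' where "h' \<in> H" "g * h' = 1"
    using inverse_mem assms(1) by blast
  then have "h = h'"
    by (metis assms(2) mult.assoc mult_1 mult_1_right)
  with \<open>h' \<in> H\<close> show ?thesis
    by simp
qed

text \<open>The core of the closed subgroup theorem: \<open>h n\<close> agrees with
  \<open>exp (s n *\<^sub>R X)\<close> up to \<open>o(s n)\<close>, so its power with exponent about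
  \<open>t / s n\<close> converges to \<open>exp (t *\<^sub>R X)\<close>, and \<open>H\<close> is
  closed.\<close>

lemma lie_tendsto:
  assumes h: "\<And>n. h n \<in> H" and s: "\<And>n. 0 < s n" "s \<longlonglongrightarrow> 0"
    and lim: "(\<lambda>n. (h n - 1) /\<^sub>R s n) \<longlonglongrightarrow> X"
  shows "X \<in> lie"
proof -
  have pos: "exp (t *\<^sub>R X) \<in> H" if "t > 0" for t
  proof -
    define m where "m n = nat \<lfloor>t / s n\<rfloor>" for n
    have m: "real (m n) * s n \<le> t" "t - s n \<le> real (m n) * s n" for n
    proof -
      have "0 \<le> t / s n"
        using s(1)[of n] that by simp
      then have "real (m n) \<le> t / s n" "t / s n - 1 \<le> real (m n)"
        unfolding m_def by linarith+
      with s(1)[of n] show "real (m n) * s n \<le> t" "t - s n \<le> real (m n) * s n"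
        by (simp_all add: field_simps)
    qed
    have ms: "(\<lambda>n. real (m n) * s n) \<longlonglongrightarrow> t"
    proof (rule tendsto_sandwich)
      show "(\<lambda>n. t - s n) \<longlonglongrightarrow> t"
        using tendsto_diff[OF tendsto_const s(2), of t] by simp
    qed (auto simp: m)
    define C where "C = exp (t * norm X)"
    define d where "d n = norm ((h n - 1) /\<^sub>R s n - (exp (s n *\<^sub>R X) - 1) /\<^sub>R s n)" for n
    \<comment> \<open>Each of the at most \<open>t / s n\<close> factors contributes an error
      \<open>s n * d n\<close>, so the total error is a bounded multiple of \<open>d n\<close>,
      which tends to 0.\<close>
    have bound: "norm (h n ^ m n - exp (s n *\<^sub>R X) ^ m n) \<le> t * (d n * C)" for n
    proof -
      have "norm (exp (s n *\<^sub>R X)) \<le> exp (s n * norm X)"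
        using norm_exp[of "s n *\<^sub>R X"] s(1)[of n] by simp
      then have "norm (h n ^ m n - exp (s n *\<^sub>R X) ^ m n)
          \<le> m n * norm (h n - exp (s n *\<^sub>R X)) * exp (s n * norm X) ^ m n"
        using s(1)[of n] by (intro norm_power_diff_le norm_le_1 h) auto
      also have "norm (h n - exp (s n *\<^sub>R X)) = s n * d n"
        unfolding d_def using s(1)[of n] by (simp flip: scaleR_diff_right)
      also have "exp (s n * norm X) ^ m n = exp (m n * s n * norm X)"
        by (simp add: exp_of_nat_mult mult.assoc)
      also have "m n * (s n * d n) * exp (m n * s n * norm X) \<le> m n * (s n * d n) * C"
        unfolding C_def d_def using m(1)[of n] s(1)[of n]
        by (intro mult_left_mono) (auto intro: mult_right_mono)
      also have "\<dots> = (m n * s n) * (d n * C)"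
        by simp
      also have "\<dots> \<le> t * (d n * C)"
        using m(1)[of n] by (intro mult_right_mono) (auto simp: C_def d_def)
      finally show ?thesis .
    qed
    have s0: "s n \<noteq> 0" for n
      using s(1)[of n] by simp
    have "d \<longlonglongrightarrow> norm (X - X)"
      unfolding d_def by (intro tendsto_intros lim exp_quotient_tendsto s s0)
    then have "(\<lambda>n. t * (d n * C)) \<longlonglongrightarrow> 0"
      using tendsto_mult_right_zero[OF tendsto_mult_left_zero] by simp
    then have "(\<lambda>n. h n ^ m n - exp (s n *\<^sub>R X) ^ m n) \<longlonglongrightarrow> 0"
      by (rule Lim_null_comparison[OF always_eventually[OF allI[OF bound]]])
    moreover have "(\<lambda>n. exp (s n *\<^sub>R X) ^ m n) \<longlonglongrightarrow> exp (t *\<^sub>R X)"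
    proof -
      have "exp (s n *\<^sub>R X) ^ m n = exp ((m n * s n) *\<^sub>R X)" for n
        by (rule exp_scaleR_power)
      then show ?thesis
        by (simp only:) (rule isCont_tendsto_compose[OF isCont_exp_scaleR ms])
    qed
    ultimately have "(\<lambda>n. h n ^ m n) \<longlonglongrightarrow> exp (t *\<^sub>R X)"
      by (rule Lim_transform[rotated])
    then show ?thesis
      by (rule closed_sequentially[OF compact_imp_closed[OF compact] power_mem[OF h]])
  qed
  have "exp (t *\<^sub>R X) \<in> H" for t
  proof (cases "t > 0")
    case False
    show ?thesis
    proof (cases "t = 0")
      case False
      with \<open>\<not> t > 0\<close> have "exp (- t *\<^sub>R X) \<in> H"
        by (intro pos) simp
      then show ?thesis
        by (rule inverse_mem_eq) (rule exp_minus_scaleR)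
    qed (simp add: one_mem)
  qed (rule pos)
  then show ?thesis
    by (simp add: lie_def)
qed

lemma exp_mem: "X \<in> lie \<Longrightarrow> exp (t *\<^sub>R X) \<in> H"
  by (simp add: lie_def)

lemma lie_scaleR: "X \<in> lie \<Longrightarrow> a *\<^sub>R X \<in> lie"
  by (simp add: lie_def)

lemma inverse_Suc_tendsto: "(\<lambda>n. 1 / real (Suc n)) \<longlonglongrightarrow> 0"
  using LIMSEQ_inverse_real_of_nat by (simp add: divide_inverse)

lemma exp_inverse_Suc_tendsto:
  fixes X :: "'v endo"
  shows "(\<lambda>n. exp ((1 / real (Suc n)) *\<^sub>R X)) \<longlonglongrightarrow> 1"
    "(\<lambda>n. (exp ((1 / real (Suc n)) *\<^sub>R X) - 1) /\<^sub>R (1 / real (Suc n))) \<longlonglongrightarrow> X"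
proof -
  have "(\<lambda>n. exp ((1 / real (Suc n)) *\<^sub>R X)) \<longlonglongrightarrow> exp (0 *\<^sub>R X)"
    by (rule isCont_tendsto_compose[OF isCont_exp_scaleR inverse_Suc_tendsto])
  then show "(\<lambda>n. exp ((1 / real (Suc n)) *\<^sub>R X)) \<longlonglongrightarrow> 1"
    by simp
qed (rule exp_quotient_tendsto[OF inverse_Suc_tendsto], simp)

lemma lie_tendsto_Suc:
  assumes "\<And>n. h n \<in> H" "(\<lambda>n. (h n - 1) /\<^sub>R (1 / real (Suc n))) \<longlonglongrightarrow> X"
  shows "X \<in> lie"
  by (rule lie_tendsto[OF assms(1) _ inverse_Suc_tendsto assms(2)]) simp

text \<open>\<open>lie_tendsto\<close> accepts any curve in \<open>H\<close> with the right
  first-order behaviour, so the product of the two one-parameter groups suffices although it is not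
  one itself.\<close>

lemma lie_add:
  assumes "X \<in> lie" "Y \<in> lie"
  shows "X + Y \<in> lie"
proof (rule lie_tendsto_Suc)
  let ?s = "\<lambda>n. 1 / real (Suc n)"
  have "(\<lambda>n. (exp (?s n *\<^sub>R X) - 1) /\<^sub>R ?s n * exp (?s n *\<^sub>R Y) + (exp (?s n *\<^sub>R Y) - 1) /\<^sub>R ?s n)
      \<longlonglongrightarrow> X * 1 + Y"
    by (intro tendsto_intros exp_inverse_Suc_tendsto)
  moreover have "(exp (?s n *\<^sub>R X) - 1) /\<^sub>R ?s n * exp (?s n *\<^sub>R Y) + (exp (?s n *\<^sub>R Y) - 1) /\<^sub>R ?s n
      = (exp (?s n *\<^sub>R X) * exp (?s n *\<^sub>R Y) - 1) /\<^sub>R ?s n" for n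
    by (rule scaleR_mult_diff_one)
  ultimately show "(\<lambda>n. (exp (?s n *\<^sub>R X) * exp (?s n *\<^sub>R Y) - 1) /\<^sub>R ?s n) \<longlonglongrightarrow> X + Y"
    by (simp only: mult_1_right)
qed (intro mult_mem exp_mem assms)

lemma subspace_lie: "subspace lie"
  unfolding subspace_def using lie_add lie_scaleR by (auto simp: lie_def one_mem)

lemma lie_conj:
  assumes "X \<in> lie" "g \<in> H" "h \<in> H" "g * h = 1"
  shows "g * X * h \<in> lie"
proof (rule lie_tendsto_Suc)
  let ?s = "\<lambda>n. 1 / real (Suc n)"
  have "(\<lambda>n. g * ((exp (?s n *\<^sub>R X) - 1) /\<^sub>R ?s n) * h) \<longlonglongrightarrow> g * X * h"
    by (intro tendsto_intros exp_inverse_Suc_tendsto)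
  moreover have "g * ((exp (?s n *\<^sub>R X) - 1) /\<^sub>R ?s n) * h
      = (g * exp (?s n *\<^sub>R X) * h - 1) /\<^sub>R ?s n" for n
    by (simp only: mult_scaleR_left mult_scaleR_right left_diff_distrib right_diff_distrib
        mult_1_right assms(4))
  ultimately show "(\<lambda>n. (g * exp (?s n *\<^sub>R X) * h - 1) /\<^sub>R ?s n) \<longlonglongrightarrow> g * X * h"
    by (simp only:)
qed (intro mult_mem exp_mem assms)

lemma exp_app_has_vector_derivative:
  "((\<lambda>t. exp (t *\<^sub>R X) \<star> (x :: 'v)) has_vector_derivative exp (t *\<^sub>R X) \<star> X \<star> x) (at t)"
  using bounded_linear.has_vector_derivative[OF app.bounded_linear_left
      exp_scaleR_has_vector_derivative_right[of X t UNIV]] by simp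

lemma inner_exp_has_real_derivative:
  "((\<lambda>t. (exp (t *\<^sub>R X) \<star> (x :: 'v)) \<bullet> y) has_real_derivative (X \<star> x) \<bullet> y) (at 0)"
  using bounded_linear.has_vector_derivative[OF bounded_linear_inner_left
      exp_app_has_vector_derivative[of X x 0], of y]
  by (simp add: has_real_derivative_iff_has_vector_derivative)

lemma lie_skew:
  assumes "X \<in> lie"
  shows "(X \<star> x) \<bullet> y = - (x \<bullet> (X \<star> y))"
proof -
  have "((\<lambda>t. (exp (t *\<^sub>R X) \<star> x) \<bullet> (exp (t *\<^sub>R X) \<star> y)) has_vector_derivative
      x \<bullet> (X \<star> y) + (X \<star> x) \<bullet> y) (at 0)"
    using bounded_bilinear.has_vector_derivative[OF bounded_bilinear_inner
        exp_app_has_vector_derivative[of X x 0] exp_app_has_vector_derivative[of X y 0]]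
    by simp
  moreover have "((\<lambda>t. (exp (t *\<^sub>R X) \<star> x) \<bullet> (exp (t *\<^sub>R X) \<star> y)) has_vector_derivative 0) (at 0)"
    by (simp add: inner_app[OF exp_mem[OF assms]])
  ultimately show ?thesis
    using vector_derivative_unique_at by fastforce
qed

section \<open>Isotropy groups and velocities of curves in orbits\<close>

definition stab :: "'v \<Rightarrow> 'v endo set" where
  "stab q = {h \<in> H. h \<star> q = q}"

text \<open>Makes the theory applicable to isotropy groups, in particular the description of tangent
  spaces to the isotropy orbits in \<open>property_P_Euc\<close>.\<close>

lemma orthogonal_group_stab: "orthogonal_group (stab q)"
proof
  have "closed {h :: 'v endo. h \<star> q = q}"
    by (intro closed_Collect_eq continuous_intros app.continuous_on)
  moreover have "stab q = H \<inter> {h. h \<star> q = q}"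
    by (auto simp: stab_def)
  ultimately show "compact (stab q)"
    using compact_Int_closed[OF compact] by simp
  fix g assume g: "g \<in> stab q"
  then obtain h where "h \<in> H" "g * h = 1" "h * g = 1"
    using inverse_mem by (auto simp: stab_def)
  moreover from this have "h \<star> q = q"
    using g by (metis (mono_tags, lifting) app_one app_times mem_Collect_eq stab_def)
  ultimately show "\<exists>h\<in>stab q. g * h = 1 \<and> h * g = 1"
    by (auto simp: stab_def)
qed (auto simp: stab_def one_mem mult_mem inner_app)

lemma exp_app_eq_self: "X \<star> q = (0 :: 'v) \<Longrightarrow> exp (t *\<^sub>R X) \<star> q = q"
proof -
  assume "X \<star> q = 0"
  then have "((\<lambda>t. exp (t *\<^sub>R X) \<star> q) has_vector_derivative 0) (at t within UNIV)" for t
    using exp_app_has_vector_derivative[of X q t] by simp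
  then obtain c where "\<And>t. exp (t *\<^sub>R X) \<star> q = c"
    using has_vector_derivative_zero_constant[of UNIV "\<lambda>t. exp (t *\<^sub>R X) \<star> q"] by auto
  from this[of t] this[of 0] show ?thesis
    by simp
qed

lemma lie_stab: "orthogonal_group.lie (stab q) = {X \<in> lie. X \<star> q = 0}"
proof (intro equalityI subsetI)
  fix X assume "X \<in> orthogonal_group.lie (stab q)"
  then have *: "\<And>t. exp (t *\<^sub>R X) \<in> stab q"
    by (simp add: orthogonal_group.lie_def[OF orthogonal_group_stab])
  then have "((\<lambda>t. q) has_vector_derivative X \<star> q) (at 0)"
    using exp_app_has_vector_derivative[of X q 0] by (simp add: stab_def)
  then have "X \<star> q = 0"
    by (rule vector_derivative_unique_at) simp
  with * show "X \<in> {X \<in> lie. X \<star> q = 0}"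
    by (simp add: stab_def lie_def)
next
  fix X assume "X \<in> {X \<in> lie. X \<star> q = 0}"
  then show "X \<in> orthogonal_group.lie (stab q)"
    unfolding orthogonal_group.lie_def[OF orthogonal_group_stab]
    by (simp add: stab_def lie_def exp_app_eq_self)
qed

lemma obtain_minimal_representative:
  assumes "g \<in> H"
  obtains h where "h \<in> H" "h \<star> p = g \<star> p" "\<And>k. k \<in> stab p \<Longrightarrow> norm (h - 1) \<le> norm (h * k - 1)"
proof -
  interpret S: orthogonal_group "stab p"
    by (rule orthogonal_group_stab)
  have "continuous_on (stab p) (\<lambda>k. norm (g * k - 1))"
    by (intro continuous_intros)
  then obtain k where k: "k \<in> stab p" "\<And>k'. k' \<in> stab p \<Longrightarrow> norm (g * k - 1) \<le> norm (g * k' - 1)"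
    using continuous_attains_inf[OF S.compact] S.one_mem by blast
  show thesis
  proof (rule that[of "g * k"])
    show "norm (g * k - 1) \<le> norm (g * k * k' - 1)" if "k' \<in> stab p" for k'
      using k(2)[OF S.mult_mem[OF k(1) that]] by (simp add: mult.assoc)
  qed (use k assms in \<open>auto simp: stab_def mult_mem\<close>)
qed

text \<open>The representatives of a curve in the orbit are chosen as close to the identity as possible,
  so that their limiting direction is not tangent to the isotropy group.\<close>

lemma orbit_curve_derivative:
  assumes e: "0 < e" and cH: "\<And>t. 0 < t \<Longrightarrow> t < e \<Longrightarrow> c t \<in> (\<lambda>h. h \<star> p) ` H"
    and c0: "c 0 = p" and deriv: "(c has_vector_derivative u) (at 0)"
  shows "\<exists>X\<in>lie. X \<star> p = u"
proof (cases "u = 0")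
  case True
  then show ?thesis
    using subspace_0[OF subspace_lie] by (intro bexI[of _ 0]) simp_all
next
  case False
  \<comment> \<open>The 2 keeps every parameter strictly below \<open>e\<close>, also for
    \<open>n = 0\<close>.\<close>
  define t where "t n = e / (2 + real n)" for n
  have t: "0 < t n" "t n < e" "t n \<noteq> 0" for n
    using e by (auto simp: t_def field_simps add_pos_nonneg)
  have t0: "t \<longlonglongrightarrow> 0"
    unfolding t_def by (rule real_tendsto_divide_at_top[OF tendsto_const
        filterlim_tendsto_add_at_top[OF tendsto_const filterlim_real_sequentially]])
  have "\<forall>n. \<exists>h\<in>H. h \<star> p = c (t n) \<and> (\<forall>k\<in>stab p. norm (h - 1) \<le> norm (h * k - 1))"
  proof
    fix n
    obtain g where "g \<in> H" "c (t n) = g \<star> p"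
      using cH[OF t(1,2)] by blast
    then show "\<exists>h\<in>H. h \<star> p = c (t n) \<and> (\<forall>k\<in>stab p. norm (h - 1) \<le> norm (h * k - 1))"
      using obtain_minimal_representative[of g p] by metis
  qed
  then obtain g where g: "\<And>n. g n \<in> H" "\<And>n. g n \<star> p = c (t n)"
    and gmin: "\<And>n k. k \<in> stab p \<Longrightarrow> norm (g n - 1) \<le> norm (g n * k - 1)"
    by metis
  have quot: "(\<lambda>n. (c (t n) - p) /\<^sub>R t n) \<longlonglongrightarrow> u"
    using has_vector_derivative_sequentially[OF deriv t0 t(3)] by (simp add: c0)
  have ct: "(\<lambda>n. c (t n)) \<longlonglongrightarrow> p"
    using isCont_tendsto_compose[OF has_vector_derivative_continuous[OF deriv] t0] by (simp add: c0)
  \<comment> \<open>Otherwise a subsequence of the representatives stays away from 1 and converges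
    to some \<open>h\<close> fixing \<open>p\<close>. Correcting by the inverse of \<open>h\<close>,
    which lies in \<open>stab p\<close>, moves them arbitrarily close to 1, against
    minimality.\<close>
  have g1: "g \<longlonglongrightarrow> 1"
  proof (rule ccontr)
    assume "\<not> g \<longlonglongrightarrow> 1"
    then obtain d where d: "0 < d" "\<exists>\<^sub>F n in sequentially. d \<le> norm (g n - 1)"
      unfolding tendsto_iff frequently_def by (auto simp: dist_norm not_le)
    then have "infinite {n. d \<le> norm (g n - 1)}"
      by (simp add: frequently_cofinite flip: cofinite_eq_sequentially)
    then obtain r :: "nat \<Rightarrow> nat" where r: "strict_mono r" "\<And>n. d \<le> norm (g (r n) - 1)"
      using infinite_enumerate by blast
    have "\<forall>n. (g \<circ> r) n \<in> H"
      using g by simp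
    then obtain h r' where h: "h \<in> H" "strict_mono r'" "((g \<circ> r) \<circ> r') \<longlonglongrightarrow> h"
      using compact[unfolded compact_def] by blast
    have "(\<lambda>n. ((g \<circ> r) \<circ> r') n \<star> p) \<longlonglongrightarrow> h \<star> p"
      by (rule app.tendsto[OF h(3) tendsto_const])
    moreover have "(\<lambda>n. ((g \<circ> r) \<circ> r') n \<star> p) \<longlonglongrightarrow> p"
      using LIMSEQ_subseq_LIMSEQ[OF ct strict_mono_o[OF r(1) h(2)]] by (simp add: g o_def)
    ultimately have "h \<star> p = p"
      using LIMSEQ_unique by blast
    moreover obtain h' where h': "h' \<in> H" "h * h' = 1" "h' * h = 1"
      using inverse_mem h(1) by blast
    ultimately have "h' \<in> stab p"
      by (metis (mono_tags, lifting) app_one app_times mem_Collect_eq stab_def)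
    then have "d \<le> norm (((g \<circ> r) \<circ> r') n * h' - 1)" for n
      using gmin[of h' "r (r' n)"] r(2)[of "r' n"] by simp
    moreover have "(\<lambda>n. norm (((g \<circ> r) \<circ> r') n * h' - 1)) \<longlonglongrightarrow> norm (h * h' - 1)"
      by (intro tendsto_intros h(3))
    ultimately have "d \<le> norm (h * h' - 1)"
      by (intro tendsto_lowerbound[where F = sequentially]) auto
    with \<open>0 < d\<close> h'(2) show False
      by simp
  qed
  \<comment> \<open>Since \<open>u\<close> is nonzero, the curve points eventually differ from
    \<open>p\<close>; hence the representatives differ from 1 and their deviation can be
    normalized.\<close>
  have "\<forall>\<^sub>F n in sequentially. (c (t n) - p) /\<^sub>R t n \<noteq> 0"
    using quot False by (rule tendsto_imp_eventually_ne)
  then obtain n0 where "\<And>n. n0 \<le> n \<Longrightarrow> c (t n) \<noteq> p"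
    by (auto simp: eventually_sequentially)
  then have "c (t (n + n0)) \<noteq> p" for n
    by simp
  then have ne: "g (n + n0) \<noteq> 1" for n
    using g(2)[of "n + n0"] by (metis app_one)
  define s where "s n = norm (g (n + n0) - 1)" for n
  have s_pos: "0 < s n" for n
    using ne by (simp add: s_def)
  have s0: "s \<longlonglongrightarrow> 0"
    unfolding s_def using tendsto_norm[OF tendsto_diff[OF LIMSEQ_ignore_initial_segment[OF g1] tendsto_const], of n0 1]
    by simp
  define Q where "Q n = (g (n + n0) - 1) /\<^sub>R s n" for n
  have normQ: "norm (Q n) = 1" for n
    using ne[of n] by (simp add: Q_def s_def)
  then have "bounded (range Q)"
    by (auto simp: bounded_iff intro!: exI[of _ 1])
  then obtain X r where r: "strict_mono r" and X: "(Q \<circ> r) \<longlonglongrightarrow> X"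
    using bounded_imp_convergent_subsequence by blast
  have sr0: "(\<lambda>n. s (r n)) \<longlonglongrightarrow> 0"
    using LIMSEQ_subseq_LIMSEQ[OF s0 r] by (simp add: o_def)
  have X': "(\<lambda>n. (g (r n + n0) - 1) /\<^sub>R s (r n)) \<longlonglongrightarrow> X"
    using X by (simp add: o_def Q_def)
  have XL: "X \<in> lie"
    by (rule lie_tendsto[OF g(1) s_pos sr0 X'])
  \<comment> \<open>If \<open>X\<close> killed \<open>p\<close>, multiplying a representative on the
    right by \<open>k n\<close> would preserve the point represented and bring the distance to 1
    down to \<open>o(s (r n))\<close>, below the minimal distance \<open>s (r n)\<close>.\<close>
  have Xp: "X \<star> p \<noteq> 0"
  proof
    assume "X \<star> p = 0"
    define k where "k n = exp (s (r n) *\<^sub>R (- X))" for n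
    have "k n \<in> stab p" for n
      using exp_mem[OF XL, of "- s (r n)"] exp_app_eq_self[OF \<open>X \<star> p = 0\<close>, of "- s (r n)"]
      by (simp add: k_def stab_def)
    then have "s (r n) \<le> norm (g (r n + n0) * k n - 1)" for n
      unfolding s_def by (rule gmin)
    then have "1 \<le> norm (g (r n + n0) * k n - 1) / s (r n)" for n
      using s_pos[of "r n"] by (simp add: le_divide_eq)
    moreover have "norm (g (r n + n0) * k n - 1) / s (r n)
        = norm ((g (r n + n0) * k n - 1) /\<^sub>R s (r n))" for n
      using s_pos[of "r n"] by (simp add: divide_inverse mult.commute)
    ultimately have "1 \<le> norm ((g (r n + n0) * k n - 1) /\<^sub>R s (r n))" for n
      by (simp only:)
    then have ge1: "1 \<le> norm ((g (r n + n0) - 1) /\<^sub>R s (r n) * k n + (k n - 1) /\<^sub>R s (r n))" for n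
      by (simp only: scaleR_mult_diff_one)
    have "k \<longlonglongrightarrow> exp (0 *\<^sub>R (- X))"
      unfolding k_def by (rule isCont_tendsto_compose[OF isCont_exp_scaleR sr0])
    moreover have "(\<lambda>n. (k n - 1) /\<^sub>R s (r n)) \<longlonglongrightarrow> - X"
      unfolding k_def by (rule exp_quotient_tendsto[OF sr0]) (metis s_pos less_irrefl)
    ultimately have "(\<lambda>n. norm ((g (r n + n0) - 1) /\<^sub>R s (r n) * k n + (k n - 1) /\<^sub>R s (r n)))
        \<longlonglongrightarrow> norm (X * exp (0 *\<^sub>R (- X)) + - X)"
      by (intro tendsto_intros X')
    then have "1 \<le> norm (X * exp (0 *\<^sub>R (- X)) + - X)"
      by (rule tendsto_lowerbound) (use ge1 in auto)
    then show False
      by simp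
  qed
  define q where "q n = (c (t (r n + n0)) - p)" for n
  have lim_s: "(\<lambda>n. q n /\<^sub>R s (r n)) \<longlonglongrightarrow> X \<star> p"
    using app.tendsto[OF X' tendsto_const, of p]
    by (simp add: app.scaleR_left app.diff_left g q_def)
  have lim_t: "(\<lambda>n. q n /\<^sub>R t (r n + n0)) \<longlonglongrightarrow> u"
    using LIMSEQ_subseq_LIMSEQ[OF LIMSEQ_ignore_initial_segment[OF quot, of n0] r]
    by (simp add: o_def q_def)
  define a where "a = norm u / norm (X \<star> p)"
  \<comment> \<open>Both quotients are nonnegative multiples of \<open>q n\<close>, so they differ
    by the ratio of their norms, which tends to \<open>a\<close>.\<close>
  have eq: "q n /\<^sub>R t (r n + n0)
      = (norm (q n /\<^sub>R t (r n + n0)) / norm (q n /\<^sub>R s (r n))) *\<^sub>R (q n /\<^sub>R s (r n))" for n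
    using s_pos[of "r n"] t(1)[of "r n + n0"] by (cases "q n = 0") (auto simp: field_simps)
  have "(\<lambda>n. q n /\<^sub>R t (r n + n0)) \<longlonglongrightarrow> a *\<^sub>R (X \<star> p)"
    unfolding a_def by (subst eq) (intro tendsto_intros lim_s lim_t, simp add: Xp)
  then have "u = (a *\<^sub>R X) \<star> p"
    using LIMSEQ_unique[OF lim_t] by (simp add: app.scaleR_left)
  then show ?thesis
    using lie_scaleR[OF XL] by blast
qed

end

section \<open>Calculus of smooth maps\<close>

lemma Ck_on_Suc_imp: "Ck_on (Suc n) S f \<Longrightarrow> Ck_on n S f"
proof (induction n arbitrary: f)
  case 0
  then obtain f' where "\<And>x. x \<in> S \<Longrightarrow> (f has_derivative f' x) (at x)"
    by auto
  then show ?case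
    by (auto intro!: continuous_at_imp_continuous_on has_derivative_continuous)
next
  case (Suc n)
  from Suc.prems obtain f' where f': "\<And>x. x \<in> S \<Longrightarrow> (f has_derivative f' x) (at x)"
      "\<And>v. Ck_on (Suc n) S (\<lambda>x. f' x v)"
    using Ck_on.simps(2)[of "Suc n" S f] by blast
  then have "\<And>v. Ck_on n S (\<lambda>x. f' x v)"
    using Suc.IH by blast
  with f'(1) show ?case
    unfolding Ck_on.simps by blast
qed

lemma Ck_on_subset: "Ck_on n S f \<Longrightarrow> T \<subseteq> S \<Longrightarrow> Ck_on n T f"
proof (induction n arbitrary: f)
  case 0
  then show ?case
    by (auto intro: continuous_on_subset)
next
  case (Suc n)
  from Suc.prems(1) obtain f' where "\<And>x. x \<in> S \<Longrightarrow> (f has_derivative f' x) (at x)"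
      "\<And>v. Ck_on n S (\<lambda>x. f' x v)"
    by auto
  with Suc.prems(2) Suc.IH show ?case
    unfolding Ck_on.simps by (intro exI[of _ f']) blast
qed

lemma Ck_on_cong: "open S \<Longrightarrow> Ck_on n S f \<Longrightarrow> (\<And>x. x \<in> S \<Longrightarrow> f x = g x) \<Longrightarrow> Ck_on n S g"
proof (cases n)
  case (Suc m)
  assume S: "open S" "Ck_on n S f" and eq: "\<And>x. x \<in> S \<Longrightarrow> f x = g x"
  from S(2) obtain f' where "\<And>x. x \<in> S \<Longrightarrow> (f has_derivative f' x) (at x)"
      "\<And>v. Ck_on m S (\<lambda>x. f' x v)"
    unfolding Suc by auto
  with S(1) eq show ?thesis
    unfolding Suc Ck_on.simps by (intro exI[of _ f']) (blast intro: has_derivative_transform_within_open)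
qed (auto cong: continuous_on_cong)

lemma Ck_on_local:
  assumes "open S" "\<And>x. x \<in> S \<Longrightarrow> \<exists>V. open V \<and> x \<in> V \<and> Ck_on n (S \<inter> V) f"
  shows "Ck_on n S f"
  using assms(2)
proof (induction n arbitrary: f)
  case 0
  then have "\<forall>x\<in>S. \<exists>V. open V \<and> x \<in> V \<and> continuous_on (S \<inter> V) f"
    by simp
  then show ?case
    by (simp add: continuous_on_eq_continuous_at[OF assms(1)])
      (metis IntI continuous_on_eq_continuous_at open_Int assms(1))
next
  case (Suc n)
  have V: "\<exists>V f'. open V \<and> x \<in> V \<and> (\<forall>y\<in>S \<inter> V. (f has_derivative f' y) (at y)) \<and>
      (\<forall>v. Ck_on n (S \<inter> V) (\<lambda>y. f' y v))" if "x \<in> S" for x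
    using Suc.prems[OF that] by auto
  \<comment> \<open>The derivatives given on the various neighbourhoods are separate choices;
    \<open>frechet_derivative\<close> is one function that agrees with all of them.\<close>
  define F where "F x = frechet_derivative f (at x)" for x
  have "(f has_derivative F x) (at x)" if "x \<in> S" for x
    using V[OF that] that unfolding F_def
    by (metis IntI frechet_derivative_at)
  moreover have "Ck_on n S (\<lambda>x. F x v)" for v
  proof (rule Suc.IH)
    fix x assume "x \<in> S"
    with V obtain V f' where *: "open V" "x \<in> V"
      "\<And>y. y \<in> S \<inter> V \<Longrightarrow> (f has_derivative f' y) (at y)" "Ck_on n (S \<inter> V) (\<lambda>y. f' y v)"
      by meson
    have eq: "f' y v = F y v" if "y \<in> S \<inter> V" for y
      unfolding F_def using frechet_derivative_at[OF *(3)[OF that]] by simp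
    have "Ck_on n (S \<inter> V) (\<lambda>x. F x v)"
      by (rule Ck_on_cong[OF open_Int[OF assms(1) *(1)] *(4) eq])
    with *(1,2) show "\<exists>V. open V \<and> x \<in> V \<and> Ck_on n (S \<inter> V) (\<lambda>x. F x v)"
      by blast
  qed
  ultimately show ?case
    unfolding Ck_on.simps by blast
qed

lemma Ck_on_const: "Ck_on n S (\<lambda>_. c)"
  by (induction n arbitrary: c) (auto intro!: exI[of _ "\<lambda>_ _. 0"])

lemma Ck_on_linear: "bounded_linear f \<Longrightarrow> Ck_on n S f"
  by (cases n) (auto intro: bounded_linear.continuous_on linear_continuous_on
      bounded_linear_imp_has_derivative Ck_on_const intro!: exI[of _ "\<lambda>_. f"])

lemma Ck_on_add: "Ck_on n S f \<Longrightarrow> Ck_on n S g \<Longrightarrow> Ck_on n S (\<lambda>x. f x + g x)"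
proof (induction n arbitrary: f g)
  case (Suc n)
  obtain f' where f': "\<And>x. x \<in> S \<Longrightarrow> (f has_derivative f' x) (at x)"
      "\<And>v. Ck_on n S (\<lambda>x. f' x v)"
    using Suc.prems(1) by auto
  obtain g' where g': "\<And>x. x \<in> S \<Longrightarrow> (g has_derivative g' x) (at x)"
      "\<And>v. Ck_on n S (\<lambda>x. g' x v)"
    using Suc.prems(2) by auto
  from f' g' show ?case
    unfolding Ck_on.simps by (intro exI[of _ "\<lambda>x v. f' x v + g' x v"])
      (auto intro: has_derivative_add Suc.IH)
qed (auto intro: continuous_on_add)

lemma Ck_on_sum: "(\<And>i. i \<in> I \<Longrightarrow> Ck_on n S (f i)) \<Longrightarrow> Ck_on n S (\<lambda>x. \<Sum>i\<in>I. f i x)"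
  by (induction I rule: infinite_finite_induct) (auto intro: Ck_on_const Ck_on_add)

lemma Ck_on_bilinear:
  assumes "bounded_bilinear pr"
  shows "Ck_on n S f \<Longrightarrow> Ck_on n S g \<Longrightarrow> Ck_on n S (\<lambda>x. pr (f x) (g x))"
proof (induction n arbitrary: f g)
  case 0
  then show ?case
    using bounded_bilinear.continuous_on[OF assms] by auto
next
  case (Suc n)
  obtain f' where f': "\<And>x. x \<in> S \<Longrightarrow> (f has_derivative f' x) (at x)"
      "\<And>v. Ck_on n S (\<lambda>x. f' x v)"
    using Suc.prems(1) by auto
  obtain g' where g': "\<And>x. x \<in> S \<Longrightarrow> (g has_derivative g' x) (at x)"
      "\<And>v. Ck_on n S (\<lambda>x. g' x v)"
    using Suc.prems(2) by auto
  have "Ck_on n S f" "Ck_on n S g"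
    using Suc.prems Ck_on_Suc_imp by blast+
  with f' g' show ?case
    unfolding Ck_on.simps by (intro exI[of _ "\<lambda>x v. pr (f x) (g' x v) + pr (f' x v) (g x)"])
      (auto intro!: bounded_bilinear.FDERIV[OF assms] Suc.IH Ck_on_add)
qed

lemma Ck_on_scaleR: "Ck_on n S f \<Longrightarrow> Ck_on n S g \<Longrightarrow> Ck_on n S (\<lambda>x. f x *\<^sub>R g x)"
  by (rule Ck_on_bilinear[OF bounded_bilinear_scaleR])

lemma Ck_on_inner: "Ck_on n S f \<Longrightarrow> Ck_on n S g \<Longrightarrow> Ck_on n S (\<lambda>x. f x \<bullet> g x)"
  by (rule Ck_on_bilinear[OF bounded_bilinear_inner])

lemma Ck_on_mult: "Ck_on n S f \<Longrightarrow> Ck_on n S g \<Longrightarrow> Ck_on n S (\<lambda>x. f x * g x :: real)"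
  by (rule Ck_on_bilinear[OF bounded_bilinear_mult])

lemma Ck_on_diff: "Ck_on n S f \<Longrightarrow> Ck_on n S g \<Longrightarrow> Ck_on n S (\<lambda>x. f x - g x)"
  using Ck_on_add[of n S f "\<lambda>x. (- 1) *\<^sub>R g x"] Ck_on_scaleR[OF Ck_on_const, of n S g "- 1"] by simp

lemma Ck_on_inverse:
  fixes f :: "'a::euclidean_space \<Rightarrow> real"
  assumes nz: "\<And>x. x \<in> S \<Longrightarrow> f x \<noteq> 0"
  shows "Ck_on n S f \<Longrightarrow> Ck_on n S (\<lambda>x. inverse (f x))"
proof (induction n)
  case 0
  then show ?case
    using nz by (auto intro: continuous_on_inverse)
next
  case (Suc n)
  from Suc.prems obtain f' where f': "\<And>x. x \<in> S \<Longrightarrow> (f has_derivative f' x) (at x)"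
      "\<And>v. Ck_on n S (\<lambda>x. f' x v)"
    by auto
  have inv: "Ck_on n S (\<lambda>x. inverse (f x))"
    using Suc Ck_on_Suc_imp by blast
  have "((\<lambda>x. inverse (f x)) has_derivative (\<lambda>v. - 1 * (inverse (f x) * f' x v * inverse (f x)))) (at x)"
    if "x \<in> S" for x
    using Deriv.has_derivative_inverse[OF nz[OF that] f'(1)[OF that]] by simp
  moreover have "Ck_on n S (\<lambda>x. - 1 * (inverse (f x) * f' x v * inverse (f x)))" for v
    by (intro Ck_on_mult Ck_on_const inv f')
  ultimately show ?case
    unfolding Ck_on.simps by (intro exI[of _ "\<lambda>x v. - 1 * (inverse (f x) * f' x v * inverse (f x))"]) blast
qed

lemma Ck_on_compose:
  fixes f :: "'a::euclidean_space \<Rightarrow> 'b::euclidean_space" and g :: "'b \<Rightarrow> 'c::real_normed_vector"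
  shows "Ck_on n S f \<Longrightarrow> Ck_on n T g \<Longrightarrow> f ` S \<subseteq> T \<Longrightarrow> Ck_on n S (\<lambda>x. g (f x))"
proof (induction n arbitrary: g)
  case 0
  then show ?case
    by (auto intro: continuous_on_compose2)
next
  case (Suc n)
  obtain f' where f': "\<And>x. x \<in> S \<Longrightarrow> (f has_derivative f' x) (at x)"
      "\<And>v. Ck_on n S (\<lambda>x. f' x v)"
    using Suc.prems(1) by auto
  obtain g' where g': "\<And>x. x \<in> T \<Longrightarrow> (g has_derivative g' x) (at x)"
      "\<And>v. Ck_on n T (\<lambda>x. g' x v)"
    using Suc.prems(2) by auto
  have fn: "Ck_on n S f"
    using Suc.prems Ck_on_Suc_imp by blast
  \<comment> \<open>\<open>Ck_on\<close> controls the derivative of \<open>g\<close> in fixed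
    directions only, while \<open>f' x v\<close> moves with \<open>x\<close>. Expanding it in the
    basis leaves the fixed directions \<open>b\<close>.\<close>
  define h where "h x v = (\<Sum>b\<in>Basis. (f' x v \<bullet> b) *\<^sub>R g' (f x) b)" for x v
  have "((\<lambda>x. g (f x)) has_derivative h x) (at x)" if "x \<in> S" for x
  proof -
    have gx: "(g has_derivative g' (f x)) (at (f x))"
      using g' that Suc.prems(3) by blast
    then have "linear (g' (f x))"
      using has_derivative_linear by blast
    then have eq: "g' (f x) w = (\<Sum>b\<in>Basis. (w \<bullet> b) *\<^sub>R g' (f x) b)" for w
      by (subst euclidean_representation[of w, symmetric]) (simp add: linear_sum linear_scale)
    have "h x = (\<lambda>v. g' (f x) (f' x v))"
      unfolding h_def by (rule ext) (rule eq[symmetric])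
    then show ?thesis
      using has_derivative_compose[OF f'(1)[OF that] gx] by simp
  qed
  moreover have "Ck_on n S (\<lambda>x. h x v)" for v
    unfolding h_def using Suc.prems(3)
    by (intro Ck_on_sum Ck_on_scaleR Ck_on_inner Ck_on_const f' Suc.IH[OF fn] g')
  ultimately show ?case
    unfolding Ck_on.simps by (intro exI[of _ h]) blast
qed

lemma smooth_on_open_iff: "open S \<Longrightarrow> smooth_on S f \<longleftrightarrow> (\<forall>n. Ck_on n S f)"
proof
  assume S: "open S" and f: "smooth_on S f"
  show "\<forall>n. Ck_on n S f"
  proof (intro allI Ck_on_local[OF S])
    fix n x assume "x \<in> S"
    then obtain W F where W: "open W" "x \<in> W" "\<And>n. Ck_on n W F" "\<And>y. y \<in> S \<inter> W \<Longrightarrow> F y = f y"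
      using f unfolding smooth_on_def by metis
    have "Ck_on n (S \<inter> W) f"
      by (rule Ck_on_cong[OF open_Int[OF S W(1)] Ck_on_subset[OF W(3)] W(4)]) auto
    with W(1,2) show "\<exists>V. open V \<and> x \<in> V \<and> Ck_on n (S \<inter> V) f"
      by blast
  qed
qed (auto simp: smooth_on_def)

lemma Ck_on_imp_smooth_on: "(\<And>n. Ck_on n UNIV f) \<Longrightarrow> smooth_on S f"
  unfolding smooth_on_def by blast

lemma smooth_on_linear: "linear f \<Longrightarrow> smooth_on S f" for f :: "'a::euclidean_space \<Rightarrow> 'b::real_normed_vector"
  by (intro Ck_on_imp_smooth_on Ck_on_linear) (simp add: linear_conv_bounded_linear)

lemma smooth_on_const: "smooth_on S (\<lambda>_. c)"
  by (intro Ck_on_imp_smooth_on Ck_on_const)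

lemma smooth_on_imp_differentiable:
  assumes "open S" "smooth_on S f" "x \<in> S"
  shows "\<exists>f'. (f has_derivative f') (at x)"
proof -
  have "Ck_on (Suc 0) S f"
    using assms smooth_on_open_iff by blast
  with assms(3) show ?thesis
    by auto
qed

section \<open>Gram-Schmidt and the smoothness of orthogonal projections\<close>

text \<open>Gram-Schmidt without normalization; a vector that depends on its predecessors contributes 0,
  since \<open>inverse 0 = 0\<close>.\<close>

primrec frame_proj :: "(nat \<Rightarrow> 'v::euclidean_space) \<Rightarrow> nat \<Rightarrow> 'v \<Rightarrow> 'v" where
  "frame_proj F 0 w = 0"
| "frame_proj F (Suc k) w = frame_proj F k w +
     ((w \<bullet> (F k - frame_proj F k (F k))) *
       inverse ((F k - frame_proj F k (F k)) \<bullet> (F k - frame_proj F k (F k)))) *\<^sub>R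
     (F k - frame_proj F k (F k))"

lemma frame_proj_span: "frame_proj F k w \<in> span (F ` {..<k})"
proof (induction k arbitrary: w)
  case (Suc k)
  have "span (F ` {..<k}) \<subseteq> span (F ` {..<Suc k})"
    by (intro span_mono) auto
  with Suc have "frame_proj F k v \<in> span (F ` {..<Suc k})" for v
    by blast
  moreover have "F k \<in> span (F ` {..<Suc k})"
    by (intro span_base) auto
  ultimately show ?case
    by (auto intro!: span_add span_scale span_diff)
qed (simp add: span_zero)

lemma frame_proj_orthogonal: "i < k \<Longrightarrow> (w - frame_proj F k w) \<bullet> F i = 0"
proof (induction k arbitrary: w i)
  case (Suc k)
  define e where "e = F k - frame_proj F k (F k)"
  have orth: "(v - frame_proj F k v) \<bullet> z = 0" if "z \<in> span (F ` {..<k})" for v z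
  proof -
    have "F ` {..<k} \<subseteq> {z. (v - frame_proj F k v) \<bullet> z = 0}"
      using Suc.IH by auto
    then have "span (F ` {..<k}) \<subseteq> {z. (v - frame_proj F k v) \<bullet> z = 0}"
      by (rule span_minimal) (rule subspace_hyperplane)
    with that show ?thesis
      by blast
  qed
  have eq: "w - frame_proj F (Suc k) w = (w - frame_proj F k w) - ((w \<bullet> e) * inverse (e \<bullet> e)) *\<^sub>R e"
    by (simp add: e_def)
  show ?case
  proof (cases "i = k")
    case True
    have Fk: "F k = e + frame_proj F k (F k)"
      by (simp add: e_def)
    have 1: "(w - frame_proj F k w) \<bullet> frame_proj F k (F k) = 0" "e \<bullet> frame_proj F k (F k) = 0"
      "e \<bullet> frame_proj F k w = 0"
      unfolding e_def by (intro orth frame_proj_span)+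
    have "(w - frame_proj F k w) \<bullet> F k = (w - frame_proj F k w) \<bullet> e"
      by (subst Fk) (simp only: inner_add_right 1 add_0_right)
    also have "\<dots> = w \<bullet> e"
      using 1(3) by (simp add: inner_diff_right inner_commute)
    finally have 2: "(w - frame_proj F k w) \<bullet> F k = w \<bullet> e" .
    have 3: "e \<bullet> F k = e \<bullet> e"
      by (subst Fk) (simp only: inner_add_right 1 add_0_right)
    show ?thesis
      unfolding True eq inner_diff_left[of "w - frame_proj F k w"] inner_scaleR_left 2 3
      by (cases "e = 0") simp_all
  next
    case False
    then have "F i \<in> span (F ` {..<k})"
      using Suc.prems by (intro span_base) auto
    then have "(w - frame_proj F k w) \<bullet> F i = 0" "e \<bullet> F i = 0"
      unfolding e_def by (intro orth; assumption)+
    then show ?thesis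
      unfolding eq by (simp add: inner_diff_left)
  qed
qed simp

text \<open>Discarding a dependent vector would leave only \<open>k - 1\<close> generators of a
  \<open>k\<close>-dimensional space.\<close>

lemma independent_step:
  fixes F :: "nat \<Rightarrow> 'v::euclidean_space"
  assumes "dim (span (F ` {..<k})) = k" "i < k"
  shows "F i \<notin> span (F ` {..<i})"
proof
  assume "F i \<in> span (F ` {..<i})"
  moreover have "span (F ` {..<i}) \<subseteq> span (F ` ({..<k} - {i}))"
    using assms(2) by (intro span_mono) auto
  ultimately have "F ` {..<k} \<subseteq> span (F ` ({..<k} - {i}))"
    by (auto intro: span_base)
  then have "dim (F ` {..<k}) \<le> dim (F ` ({..<k} - {i}))"
    by (metis dim_le_card' dim_mono dim_span)
  also have "\<dots> \<le> card (F ` ({..<k} - {i}))"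
    by (intro dim_le_card') auto
  also have "\<dots> \<le> card ({..<k} - {i})"
    by (intro card_image_le) auto
  finally show False
    using assms by (simp add: dim_span)
qed

text \<open>The inverse in the recursion is smooth only where the new direction is nonzero, so the
  neighbourhood shrinks with each vector; hence the quantification over smaller sets
  \<open>V\<close>. The argument \<open>w\<close> may vary with the point because the induction step
  projects the moving vector \<open>F k\<close>.\<close>

lemma frame_proj_smooth:
  fixes F :: "nat \<Rightarrow> 'v::euclidean_space \<Rightarrow> 'v"
  assumes "open W" "q0 \<in> W"
  shows "(\<And>i n. i < k \<Longrightarrow> Ck_on n W (F i)) \<Longrightarrow> (\<And>i. i < k \<Longrightarrow> F i q0 \<notin> span ((\<lambda>i. F i q0) ` {..<i})) \<Longrightarrow>
    \<exists>W'. open W' \<and> q0 \<in> W' \<and> W' \<subseteq> W \<and> (\<forall>V w. V \<subseteq> W' \<longrightarrow> (\<forall>n. Ck_on n V w) \<longrightarrow>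
      (\<forall>n. Ck_on n V (\<lambda>q. frame_proj (\<lambda>i. F i q) k (w q))))"
proof (induction k)
  case 0
  then show ?case
    using assms by (auto intro!: exI[of _ W] Ck_on_const)
next
  case (Suc k)
  have "\<exists>W'. open W' \<and> q0 \<in> W' \<and> W' \<subseteq> W \<and> (\<forall>V w. V \<subseteq> W' \<longrightarrow> (\<forall>n. Ck_on n V w) \<longrightarrow>
      (\<forall>n. Ck_on n V (\<lambda>q. frame_proj (\<lambda>i. F i q) k (w q))))"
    by (rule Suc.IH) (simp_all add: Suc.prems)
  then obtain W' where W': "open W'" "q0 \<in> W'" "W' \<subseteq> W"
    and sm': "\<forall>V w. V \<subseteq> W' \<longrightarrow> (\<forall>n. Ck_on n V w) \<longrightarrow>
      (\<forall>n. Ck_on n V (\<lambda>q. frame_proj (\<lambda>i. F i q) k (w q)))"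
    by (elim exE conjE)
  have sm: "V \<subseteq> W' \<Longrightarrow> (\<And>n. Ck_on n V w) \<Longrightarrow> Ck_on n V (\<lambda>q. frame_proj (\<lambda>i. F i q) k (w q))" for V w n
    by (rule sm'[rule_format])
  define e where "e q = F k q - frame_proj (\<lambda>i. F i q) k (F k q)" for q
  have FW: "Ck_on n W' (F k)" for n
    by (rule Ck_on_subset[OF Suc.prems(1) W'(3)]) simp
  have e: "Ck_on n W' e" for n
    unfolding e_def by (intro Ck_on_diff FW sm) auto
  have "continuous_on W' e"
    using e[of 0] by simp
  then have opn: "open {q \<in> W'. e q \<noteq> 0}"
    using continuous_open_preimage[OF _ W'(1) open_Compl[OF closed_singleton[of 0]]]
    by (simp add: vimage_def Int_def)
  have "e q0 \<noteq> 0"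
    using Suc.prems(2)[of k] frame_proj_span[of "\<lambda>i. F i q0" k "F k q0"] by (auto simp: e_def)
  have step: "Ck_on n V (\<lambda>q. frame_proj (\<lambda>i. F i q) (Suc k) (w q))"
    if V: "V \<subseteq> {q \<in> W'. e q \<noteq> 0}" and w: "\<And>n. Ck_on n V w" for V w n
  proof -
    have "Ck_on m V e" for m
      by (rule Ck_on_subset[OF e]) (use V in auto)
    moreover have "Ck_on m V (\<lambda>q. frame_proj (\<lambda>i. F i q) k (w q))" for m
      using V by (intro sm w) auto
    moreover have "e q \<bullet> e q \<noteq> 0" if "q \<in> V" for q
      using that V by auto
    ultimately have "Ck_on n V (\<lambda>q. frame_proj (\<lambda>i. F i q) k (w q) + ((w q \<bullet> e q) * inverse (e q \<bullet> e q)) *\<^sub>R e q)"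
      by (intro Ck_on_add Ck_on_scaleR Ck_on_mult Ck_on_inner Ck_on_inverse w)
    then show ?thesis
      by (simp add: e_def)
  qed
  show ?case
    by (rule exI[of _ "{q \<in> W'. e q \<noteq> 0}"], intro conjI allI impI step)
      (use opn W' \<open>e q0 \<noteq> 0\<close> in auto)
qed

lemma orth_proj_eqI:
  assumes "subspace T" "t \<in> T" "w - t \<in> T\<^sup>\<bottom>"
  shows "orth_proj T w = t"
  unfolding orth_proj_def
proof (rule the_equality)
  fix s assume s: "s \<in> T \<and> w - s \<in> T\<^sup>\<bottom>"
  have "s - t \<in> T" "s - t \<in> T\<^sup>\<bottom>"
    using assms s subspace_diff[OF subspace_orthogonal_comp assms(3), of "w - s"]
    by (auto intro: subspace_diff)
  then have "(s - t) \<bullet> (s - t) = 0"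
    by (simp add: orthogonal_comp_def orthogonal_def)
  then show "s = t"
    by simp
qed (use assms in simp)

lemma orth_proj_exists:
  assumes "subspace T"
  shows "orth_proj T w \<in> T" "w - orth_proj T w \<in> T\<^sup>\<bottom>"
proof -
  obtain y z where yz: "y \<in> span T" "\<And>v. v \<in> span T \<Longrightarrow> orthogonal z v" "w = y + z"
    using orthogonal_subspace_decomp_exists[of T w] by metis
  moreover have span: "span T = T"
    using assms span_eq_iff by blast
  ultimately have y: "y \<in> T" "w - y \<in> T\<^sup>\<bottom>"
    by (auto simp: orthogonal_comp_def orthogonal_commute)
  then show "orth_proj T w \<in> T" "w - orth_proj T w \<in> T\<^sup>\<bottom>"
    using orth_proj_eqI[OF assms y] by simp_all
qed

text \<open>A frame on \<open>S\<close> is smooth through local extensions of its members.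
  Gram-Schmidt applied to the extensions is smooth on an open set, and on \<open>S\<close> it
  computes the projection, as the spans agree there. The lemma serves both for distributions and for
  tangent spaces.\<close>

lemma smooth_on_orth_proj:
  fixes D :: "'v::euclidean_space \<Rightarrow> 'v set"
  assumes dim: "\<And>p. p \<in> S \<Longrightarrow> dim (D p) = k"
    and frame: "\<And>p. p \<in> S \<Longrightarrow> \<exists>W Y. open W \<and> p \<in> W \<and> (\<forall>i<k. smooth_on (S \<inter> W) (Y i)) \<and>
        (\<forall>q\<in>S \<inter> W. D q = span ((\<lambda>i::nat. Y i q) ` {..<k}))"
  shows "smooth_on S (\<lambda>q. orth_proj (D q) w)"
  unfolding smooth_on_def
proof
  fix p assume p: "p \<in> S"
  then obtain W Y where W: "open W" "p \<in> W" and Y: "\<And>i. i < k \<Longrightarrow> smooth_on (S \<inter> W) (Y i)"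
    and D: "\<And>q. q \<in> S \<inter> W \<Longrightarrow> D q = span ((\<lambda>i::nat. Y i q) ` {..<k})"
    using frame by metis
  have "\<forall>i. i < k \<longrightarrow> (\<exists>U F. open U \<and> p \<in> U \<and> (\<forall>n. Ck_on n U F) \<and> (\<forall>y\<in>S \<inter> W \<inter> U. F y = Y i y))"
    using Y p W(2) unfolding smooth_on_def by blast
  then obtain U F where U: "\<And>i. i < k \<Longrightarrow> open (U i)" "\<And>i. i < k \<Longrightarrow> p \<in> U i"
    and F: "\<And>i n. i < k \<Longrightarrow> Ck_on n (U i) (F i)" "\<And>i y. i < k \<Longrightarrow> y \<in> S \<inter> W \<inter> U i \<Longrightarrow> F i y = Y i y"
    by metis
  define V where "V = W \<inter> (\<Inter>i<k. U i)"
  have V: "open V" "p \<in> V"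
    using W U by (auto simp: V_def)
  have Dq: "D q = span ((\<lambda>i. F i q) ` {..<k})" if "q \<in> S \<inter> V" for q
  proof -
    have "(\<lambda>i. F i q) ` {..<k} = (\<lambda>i. Y i q) ` {..<k}"
      using that F(2) by (intro image_cong) (auto simp: V_def)
    with D that show ?thesis
      by (auto simp: V_def)
  qed
  have FV: "Ck_on n V (F i)" if "i < k" for i n
    by (rule Ck_on_subset[OF F(1)[OF that]]) (use that in \<open>auto simp: V_def\<close>)
  have "dim (span ((\<lambda>i. F i p) ` {..<k})) = k"
    using dim[OF p] p V by (subst Dq[symmetric]) auto
  then have "\<exists>W'. open W' \<and> p \<in> W' \<and> W' \<subseteq> V \<and> (\<forall>U w. U \<subseteq> W' \<longrightarrow> (\<forall>n. Ck_on n U w) \<longrightarrow>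
      (\<forall>n. Ck_on n U (\<lambda>q. frame_proj (\<lambda>i. F i q) k (w q))))"
    by (intro frame_proj_smooth[OF V FV] independent_step)
  then obtain W'
    where W': "open W'" "p \<in> W'" "W' \<subseteq> V"
    and sm: "\<forall>U w. U \<subseteq> W' \<longrightarrow> (\<forall>n. Ck_on n U w) \<longrightarrow>
      (\<forall>n. Ck_on n U (\<lambda>q. frame_proj (\<lambda>i. F i q) k (w q)))"
    by (elim exE conjE)
  have sm: "Ck_on n W' (\<lambda>q. frame_proj (\<lambda>i. F i q) k w)" for n
    by (rule sm[rule_format]) (auto intro: Ck_on_const)
  have "frame_proj (\<lambda>i. F i q) k w = orth_proj (D q) w" if "q \<in> S \<inter> W'" for q
  proof (rule sym, rule orth_proj_eqI)
    have D': "D q = span ((\<lambda>i. F i q) ` {..<k})"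
      using that W' by (intro Dq) auto
    show "subspace (D q)" "frame_proj (\<lambda>i. F i q) k w \<in> D q"
      unfolding D' by (rule subspace_span, rule frame_proj_span)
    have "span ((\<lambda>i. F i q) ` {..<k}) \<subseteq> {z. (w - frame_proj (\<lambda>i. F i q) k w) \<bullet> z = 0}"
      using frame_proj_orthogonal[of _ k w "\<lambda>i. F i q"]
      by (intro span_minimal subspace_hyperplane) auto
    then show "w - frame_proj (\<lambda>i. F i q) k w \<in> (D q)\<^sup>\<bottom>"
      unfolding D' by (auto simp: orthogonal_comp_def orthogonal_def inner_commute)
  qed
  with W' sm show "\<exists>W F. open W \<and> p \<in> W \<and> (\<forall>n. Ck_on n W F) \<and> (\<forall>y\<in>S \<inter> W. F y = orth_proj (D y) w)"
    by blast
qed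

section \<open>Submanifolds of Euclidean space\<close>

lemma orth_proj_mem [simp]: "subspace T \<Longrightarrow> w \<in> T \<Longrightarrow> orth_proj T w = w"
  by (rule orth_proj_eqI) (auto simp: subspace_0 subspace_orthogonal_comp)

lemma orth_proj_orthogonal: "subspace T \<Longrightarrow> w \<in> T\<^sup>\<bottom> \<Longrightarrow> orth_proj T w = 0"
  by (rule orth_proj_eqI) (auto simp: subspace_0)

lemma linear_orth_proj:
  assumes "subspace T"
  shows "linear (orth_proj T)"
proof (rule linearI)
  note P = orth_proj_exists[OF assms]
  fix x y :: 'a and r :: real
  show "orth_proj T (x + y) = orth_proj T x + orth_proj T y"
  proof (rule orth_proj_eqI[OF assms])
    have "(x - orth_proj T x) + (y - orth_proj T y) \<in> T\<^sup>\<bottom>"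
      by (intro subspace_add subspace_orthogonal_comp P)
    then show "x + y - (orth_proj T x + orth_proj T y) \<in> T\<^sup>\<bottom>"
      by (simp add: algebra_simps)
  qed (intro subspace_add assms P)
  show "orth_proj T (r *\<^sub>R x) = r *\<^sub>R orth_proj T x"
  proof (rule orth_proj_eqI[OF assms])
    have "r *\<^sub>R (x - orth_proj T x) \<in> T\<^sup>\<bottom>"
      by (intro subspace_scale subspace_orthogonal_comp P)
    then show "r *\<^sub>R x - r *\<^sub>R orth_proj T x \<in> T\<^sup>\<bottom>"
      by (simp add: scaleR_diff_right)
  qed (intro subspace_scale assms P)
qed

lemma orth_proj_normal:
  assumes "subspace T"
  shows "orth_proj (T\<^sup>\<bottom>) w = w - orth_proj T w"
  using orth_proj_exists[OF assms, of w] orthogonal_comp_self[OF assms]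
  by (intro orth_proj_eqI) (auto simp: subspace_orthogonal_comp)

lemma has_vector_derivative_in_subspace:
  fixes T :: "'v::euclidean_space set"
  assumes T: "subspace T" and f: "(f has_vector_derivative w) (at x)"
    and mem: "\<forall>\<^sub>F t in at x. f t \<in> T" "f x \<in> T"
  shows "w \<in> T"
proof -
  have "((\<lambda>h. (f (x + h) - f x) /\<^sub>R h) \<longlongrightarrow> w) (at 0)"
    by (rule has_vector_derivative_quotient[OF f])
  moreover have "\<forall>\<^sub>F h in at 0. (f (x + h) - f x) /\<^sub>R h \<in> T"
  proof -
    have "\<forall>\<^sub>F h in at 0. f (x + h) \<in> T"
      using mem(1) eventually_at_to_0[of "\<lambda>t. f t \<in> T" x] by (simp add: add.commute)
    then show ?thesis
      by eventually_elim (intro subspace_scale subspace_diff T mem(2))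
  qed
  ultimately show ?thesis
    using Lim_in_closed_set[OF closed_subspace[OF T]] by (metis at_neq_bot)
qed

lemma curve_in_eventually:
  assumes "curve_in N p u c" "open W" "p \<in> W"
  shows "\<forall>\<^sub>F t in at 0. c t \<in> N \<inter> W"
proof -
  obtain e where e: "0 < e" "c ` {-e<..<e} \<subseteq> N" and c: "c 0 = p" "(c has_vector_derivative u) (at 0)"
    using assms(1) by (auto simp: curve_in_def)
  have "isCont c 0"
    using has_vector_derivative_continuous[OF c(2)] .
  then have "\<forall>\<^sub>F t in at 0. c t \<in> W"
    using assms(2,3) c(1) by (auto simp: isCont_def topological_tendstoD)
  moreover have "\<forall>\<^sub>F t in at 0. t \<in> {-e<..<e}"
    using e(1) by (intro eventually_at_in_open') auto
  ultimately show ?thesis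
    by (rule eventually_elim2) (use e(2) in auto)
qed

lemma vector_derivative_compose:
  assumes "(c has_vector_derivative u) (at t)" "(F has_derivative F') (at (c t))"
  shows "((\<lambda>s. F (c s)) has_vector_derivative F' u) (at t)"
proof -
  have "linear F'"
    using assms(2) has_derivative_linear by blast
  then have "(\<lambda>s. F' (s *\<^sub>R u)) = (\<lambda>s. s *\<^sub>R F' u)"
    by (simp add: linear_scale)
  then show ?thesis
    using has_derivative_compose[OF assms(1)[unfolded has_vector_derivative_def] assms(2)]
    by (simp add: has_vector_derivative_def)
qed

lemma has_vector_derivative_eventually:
  assumes "(f has_vector_derivative w) (at x)" "\<forall>\<^sub>F t in at x. f t = g t" "f x = g x"
  shows "(g has_vector_derivative w) (at x)"
  using has_derivative_transform_eventually[of f _ x UNIV g] assms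
  by (simp add: has_vector_derivative_def)

text \<open>The derivative at \<open>p\<close> of one local extension works for all curves, which
  makes the description in \<open>deriv_along\<close> well defined and its value linear in the
  velocity.\<close>

lemma smooth_on_derivative_along:
  assumes "smooth_on N Y" "p \<in> N"
  shows "\<exists>L. linear L \<and> (\<forall>u c. curve_in N p u c \<longrightarrow> ((\<lambda>t. Y (c t)) has_vector_derivative L u) (at 0))"
proof -
  obtain W F where W: "open W" "p \<in> W" "Ck_on (Suc 0) W F" "\<And>y. y \<in> N \<inter> W \<Longrightarrow> F y = Y y"
    using assms unfolding smooth_on_def by metis
  then obtain F' where F': "(F has_derivative F' p) (at p)"
    by auto
  have "((\<lambda>t. Y (c t)) has_vector_derivative F' p u) (at 0)" if c: "curve_in N p u c" for u c
  proof (rule has_vector_derivative_eventually)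
    have c0: "c 0 = p"
      using c by (simp add: curve_in_def)
    show "((\<lambda>t. F (c t)) has_vector_derivative F' p u) (at 0)"
      by (rule vector_derivative_compose) (use c F' in \<open>auto simp: curve_in_def\<close>)
    show "\<forall>\<^sub>F t in at 0. F (c t) = Y (c t)"
      using curve_in_eventually[OF c W(1,2)] by eventually_elim (rule W(4))
    show "F (c 0) = Y (c 0)"
      using W c0 assms(2) by simp
  qed
  then show ?thesis
    using has_derivative_linear[OF F'] by blast
qed

lemma deriv_along_eq:
  assumes "smooth_on N Y" "p \<in> N" "curve_in N p u c" "((\<lambda>t. Y (c t)) has_vector_derivative w) (at 0)"
  shows "deriv_along N Y p u = w"
proof -
  obtain L where L: "\<And>u c. curve_in N p u c \<Longrightarrow> ((\<lambda>t. Y (c t)) has_vector_derivative L u) (at 0)"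
    using smooth_on_derivative_along[OF assms(1,2)] by blast
  have "w = L u"
    using vector_derivative_unique_at[OF assms(4) L[OF assms(3)]] .
  show ?thesis
    unfolding deriv_along_def
  proof (rule the_equality)
    fix w' assume "\<forall>c. curve_in N p u c \<longrightarrow> ((\<lambda>t. Y (c t)) has_vector_derivative w') (at 0)"
    then show "w' = w"
      using vector_derivative_unique_at assms(3,4) by blast
  qed (use L \<open>w = L u\<close> in blast)
qed

lemma deriv_along_curve:
  assumes "smooth_on N Y" "p \<in> N" "curve_in N p u c"
  shows "((\<lambda>t. Y (c t)) has_vector_derivative deriv_along N Y p u) (at 0)"
  using smooth_on_derivative_along[OF assms(1,2)] deriv_along_eq[OF assms] assms(3) by metis

text \<open>The witness \<open>Y\<^sub>0\<close> prevents the universal description in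
  \<open>second_form\<close> from being vacuous, in which case it would not determine a
  value.\<close>

lemma second_form_eqI:
  assumes "tangent_field N Y\<^sub>0" "Y\<^sub>0 p = y"
    and "\<And>Y. tangent_field N Y \<Longrightarrow> Y p = y \<Longrightarrow> orth_proj (normal_space N p) (deriv_along N Y p x) = a"
  shows "second_form N p x y = a"
  unfolding second_form_def
proof (rule the_equality)
  fix b assume "\<forall>Y. tangent_field N Y \<and> Y p = y \<longrightarrow> b = orth_proj (normal_space N p) (deriv_along N Y p x)"
  with assms show "b = a"
    by metis
qed (use assms(3) in simp)

lemma subspace_normal_space: "subspace (normal_space N p)"
  by (simp add: normal_space_def subspace_orthogonal_comp)

section \<open>Linear subspaces as complete totally geodesic submanifolds\<close>

lemma smooth_on_line: "smooth_on S (\<lambda>t::real. p + t *\<^sub>R u)"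
  by (intro Ck_on_imp_smooth_on Ck_on_add Ck_on_const Ck_on_linear bounded_linear_scaleR_left)

lemma line_has_vector_derivative: "((\<lambda>t. p + t *\<^sub>R u) has_vector_derivative u) (at t)"
  by (auto intro!: derivative_eq_intros)

lemma line_curve_in:
  assumes "\<And>t. p + t *\<^sub>R u \<in> S"
  shows "curve_in S p u (\<lambda>t. p + t *\<^sub>R u)"
  unfolding curve_in_def using assms smooth_on_line line_has_vector_derivative
  by (auto intro!: exI[of _ "1::real"])

lemma tangent_space_subspace:
  assumes "subspace M" "p \<in> M"
  shows "tangent_space M p = M"
proof (intro equalityI subsetI)
  fix u assume "u \<in> tangent_space M p"
  then obtain c where c: "curve_in M p u c"
    by (auto simp: tangent_space_def)
  then have "\<forall>\<^sub>F t in at 0. c t \<in> M"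
    using curve_in_eventually[of M p u c UNIV] by simp
  with c assms show "u \<in> M"
    by (intro has_vector_derivative_in_subspace[of M c u 0]) (auto simp: curve_in_def)
next
  fix u assume "u \<in> M"
  then have "curve_in M p u (\<lambda>t. p + t *\<^sub>R u)"
    using assms by (intro line_curve_in subspace_add subspace_scale)
  then show "u \<in> tangent_space M p"
    by (auto simp: tangent_space_def)
qed

lemma submanifold_subspace: "subspace M \<Longrightarrow> submanifold (dim M) M"
  unfolding submanifold_def
  by (intro ballI exI[of _ UNIV] exI[of _ id] exI[of _ M])
    (auto simp: homeomorphism_def intro!: smooth_on_linear linear_id)

lemma geodesically_complete_subspace:
  assumes "subspace M"
  shows "geodesically_complete M"
  unfolding geodesically_complete_def
proof (intro ballI)
  fix p u assume p: "p \<in> M" and "u \<in> tangent_space M p"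
  then have mem: "p + t *\<^sub>R u \<in> M" for t
    using assms by (intro subspace_add subspace_scale) (auto simp: tangent_space_subspace)
  have "(\<lambda>s. vector_derivative (\<lambda>t. p + t *\<^sub>R u) (at s)) = (\<lambda>s. u)"
    by (rule ext) (rule vector_derivative_at[OF line_has_vector_derivative])
  then have "geodesic_line M (\<lambda>t. p + t *\<^sub>R u)"
    unfolding geodesic_line_def using mem
    by (auto simp: smooth_on_line subspace_0[OF subspace_normal_space])
  with line_curve_in[OF mem] show "\<exists>c. geodesic_line M c \<and> curve_in M p u c"
    by blast
qed

lemma totally_geodesic_subspace:
  assumes "subspace M"
  shows "totally_geodesic M"
  unfolding totally_geodesic_def
proof (intro ballI)
  fix p x y assume p: "p \<in> M" and x: "x \<in> tangent_space M p" and y: "y \<in> tangent_space M p"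
  show "second_form M p x y = 0"
  proof (rule second_form_eqI[where Y\<^sub>0 = "\<lambda>_. y"])
    show "tangent_field M (\<lambda>_. y)"
      using y p by (auto simp: tangent_field_def smooth_on_const tangent_space_subspace[OF assms])
    fix Y assume Y: "tangent_field M Y"
    obtain c where c: "curve_in M p x c"
      using x by (auto simp: tangent_space_def)
    have YM: "Y q \<in> M" if "q \<in> M" for q
      using Y that by (auto simp: tangent_field_def tangent_space_subspace[OF assms])
    have "\<forall>\<^sub>F t in at 0. c t \<in> M"
      using curve_in_eventually[OF c, of UNIV] by simp
    then have "\<forall>\<^sub>F t in at 0. Y (c t) \<in> M"
      by eventually_elim (rule YM)
    moreover have "Y (c 0) \<in> M"
      using c p YM by (simp add: curve_in_def)
    ultimately have "deriv_along M Y p x \<in> M"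
      using has_vector_derivative_in_subspace[OF assms deriv_along_curve[OF _ p c]] Y
      by (auto simp: tangent_field_def)
    then show "orth_proj (normal_space M p) (deriv_along M Y p x) = 0"
      using assms p by (simp add: normal_space_def tangent_space_subspace orth_proj_normal)
  qed simp
qed

text \<open>The product rule: the derivative of the varying projection is multiplied by
  \<open>h 0 = 0\<close> and drops out, so nothing about how the spaces turn enters the
  result.\<close>

lemma orth_proj_along_curve:
  fixes S :: "'v::euclidean_space set" and T :: "'v \<Rightarrow> 'v set"
  assumes T: "\<And>q. q \<in> S \<Longrightarrow> subspace (T q)"
    and smooth: "\<And>w. smooth_on S (\<lambda>q. orth_proj (T q) w)"
    and p: "p \<in> S" and c: "curve_in S p u c"
    and h: "(h has_vector_derivative a) (at 0)" "h 0 = 0"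
  shows "((\<lambda>s. orth_proj (T (c s)) (h s)) has_vector_derivative orth_proj (T p) a) (at 0)"
proof (rule has_vector_derivative_eventually)
  have c0: "c 0 = p"
    using c by (simp add: curve_in_def)
  have expand: "orth_proj (T q) w = (\<Sum>b\<in>Basis. (w \<bullet> b) *\<^sub>R orth_proj (T q) b)" if "q \<in> S" for q w
  proof -
    have "orth_proj (T q) (\<Sum>b\<in>Basis. (w \<bullet> b) *\<^sub>R b) = (\<Sum>b\<in>Basis. (w \<bullet> b) *\<^sub>R orth_proj (T q) b)"
      using linear_orth_proj[OF T[OF that]] by (simp add: linear_sum linear_scale o_def)
    then show ?thesis
      by (simp add: euclidean_representation)
  qed
  have "((\<lambda>s. (h s \<bullet> b) *\<^sub>R orth_proj (T (c s)) b) has_vector_derivative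
      (a \<bullet> b) *\<^sub>R orth_proj (T p) b) (at 0)" for b
  proof -
    obtain L where L: "((\<lambda>s. orth_proj (T (c s)) b) has_vector_derivative L) (at 0)"
      using deriv_along_curve[OF smooth p c] by blast
    have "((\<lambda>s. h s \<bullet> b) has_vector_derivative a \<bullet> b) (at 0)"
      using bounded_linear.has_vector_derivative[OF bounded_linear_inner_left h(1)] .
    from bounded_bilinear.has_vector_derivative[OF bounded_bilinear_scaleR this L] show ?thesis
      by (simp add: h(2) c0)
  qed
  then have "((\<lambda>s. \<Sum>b\<in>Basis. (h s \<bullet> b) *\<^sub>R orth_proj (T (c s)) b) has_vector_derivative
      (\<Sum>b\<in>Basis. (a \<bullet> b) *\<^sub>R orth_proj (T p) b)) (at 0)"
    by (intro has_vector_derivative_sum)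
  then show "((\<lambda>s. \<Sum>b\<in>Basis. (h s \<bullet> b) *\<^sub>R orth_proj (T (c s)) b) has_vector_derivative
      orth_proj (T p) a) (at 0)"
    by (simp only: expand[OF p, of a])
  have "\<forall>\<^sub>F s in at 0. c s \<in> S"
    using curve_in_eventually[OF c, of UNIV] by simp
  then show "\<forall>\<^sub>F s in at 0. (\<Sum>b\<in>Basis. (h s \<bullet> b) *\<^sub>R orth_proj (T (c s)) b) = orth_proj (T (c s)) (h s)"
    by eventually_elim (rule expand[symmetric])
  show "(\<Sum>b\<in>Basis. (h 0 \<bullet> b) *\<^sub>R orth_proj (T (c 0)) b) = orth_proj (T (c 0)) (h 0)"
    unfolding c0 by (rule expand[OF p, symmetric])
qed

text \<open>Tensoriality. The difference of two tangent fields with the same value at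
  \<open>p\<close> vanishes there and equals its own tangential projection along the curve; by
  \<open>orth_proj_along_curve\<close> its derivative is then tangent, so the normal parts
  agree.\<close>

lemma second_form_eq:
  fixes S :: "'v::euclidean_space set"
  assumes T: "\<And>q. q \<in> S \<Longrightarrow> subspace (tangent_space S q)"
    and smooth: "\<And>w. smooth_on S (\<lambda>q. orth_proj (tangent_space S q) w)"
    and p: "p \<in> S" and x: "x \<in> tangent_space S p" and Y: "tangent_field S Y"
  shows "second_form S p x (Y p) = orth_proj (normal_space S p) (deriv_along S Y p x)"
proof (rule second_form_eqI[OF Y refl])
  fix Z assume Z: "tangent_field S Z" "Z p = Y p"
  obtain c where c: "curve_in S p x c"
    using x by (auto simp: tangent_space_def)
  have c0: "c 0 = p"
    using c by (simp add: curve_in_def)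
  define h where "h s = Z (c s) - Y (c s)" for s
  define a where "a = deriv_along S Z p x - deriv_along S Y p x"
  have h: "(h has_vector_derivative a) (at 0)" "h 0 = 0"
    unfolding h_def a_def using Y Z
    by (auto intro!: has_vector_derivative_diff deriv_along_curve[OF _ p c] simp: tangent_field_def c0)
  have "a = orth_proj (tangent_space S p) a"
  proof (rule vector_derivative_unique_at[OF h(1)])
    have eq: "orth_proj (tangent_space S q) (Z q - Y q) = Z q - Y q" if "q \<in> S" for q
      using that Y Z by (intro orth_proj_mem subspace_diff T) (auto simp: tangent_field_def)
    have "\<forall>\<^sub>F s in at 0. c s \<in> S"
      using curve_in_eventually[OF c, of UNIV] by simp
    then have "\<forall>\<^sub>F s in at 0. orth_proj (tangent_space S (c s)) (h s) = h s"
      unfolding h_def by eventually_elim (rule eq)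
    moreover have "orth_proj (tangent_space S (c 0)) (h 0) = h 0"
      unfolding h_def using c0 p by (intro eq) simp
    ultimately show "(h has_vector_derivative orth_proj (tangent_space S p) a) (at 0)"
      using has_vector_derivative_eventually[OF orth_proj_along_curve[OF T smooth p c h]] by blast
  qed
  then have "orth_proj (normal_space S p) a = 0"
    unfolding normal_space_def using orth_proj_normal[OF T[OF p], of a] by simp
  then show "orth_proj (normal_space S p) (deriv_along S Z p x) = orth_proj (normal_space S p) (deriv_along S Y p x)"
    unfolding a_def by (simp add: linear_diff[OF linear_orth_proj[OF subspace_normal_space]])
qed

lemma smooth_curve_derivatives:
  fixes c :: "real \<Rightarrow> 'v::euclidean_space"
  assumes "smooth_on UNIV c"
  obtains c' c'' where "\<And>t. (c has_vector_derivative c' t) (at t)"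
    "\<And>t. (c' has_vector_derivative c'' t) (at t)"
proof -
  have "Ck_on (Suc (Suc 0)) UNIV c"
    using assms smooth_on_open_iff[OF open_UNIV] by blast
  then obtain f where f: "\<And>t. (c has_derivative f t) (at t)" "\<And>v. Ck_on (Suc 0) UNIV (\<lambda>t. f t v)"
    unfolding Ck_on.simps(2)[of "Suc 0"] by blast
  obtain g where g: "\<And>t. ((\<lambda>t. f t 1) has_derivative g t) (at t)"
    using f(2)[of 1] by auto
  have conv: "(F has_vector_derivative F' 1) (at t)" if F: "(F has_derivative F') (at t)"
    for F :: "real \<Rightarrow> 'v" and F' t
  proof -
    have eq: "(\<lambda>h. h *\<^sub>R F' 1) = F'"
    proof
      fix h :: real
      have "F' (h *\<^sub>R 1) = h *\<^sub>R F' 1"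
        by (rule linear_scale[OF has_derivative_linear[OF F]])
      then show "h *\<^sub>R F' 1 = F' h"
        by simp
    qed
    show ?thesis
      unfolding has_vector_derivative_def eq by (rule F)
  qed
  show ?thesis
    using conv[OF f(1)] conv[OF g] by (rule that)
qed

lemma shift_has_vector_derivative:
  assumes "(c has_vector_derivative u) (at t)"
  shows "((\<lambda>s. c (t + s)) has_vector_derivative u) (at 0)"
proof -
  have "((\<lambda>s. t + s) has_vector_derivative 1) (at 0)"
    by (auto intro!: derivative_eq_intros)
  then show ?thesis
    using vector_derivative_compose[of "\<lambda>s. t + s" 1 0 c "\<lambda>h. h *\<^sub>R u"] assms
    by (simp add: has_vector_derivative_def[of c])
qed

lemma curve_in_shift:
  fixes c :: "real \<Rightarrow> 'v::euclidean_space"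
  assumes "smooth_on UNIV c" "range c \<subseteq> S" "(c has_vector_derivative u) (at t)"
  shows "curve_in S (c t) u (\<lambda>s. c (t + s))"
proof -
  have "Ck_on n UNIV (\<lambda>s. c (t + s))" for n
  proof (rule Ck_on_compose[where T = UNIV and f = "\<lambda>s. t + s"])
    show "Ck_on n UNIV (\<lambda>s. t + s)"
      by (intro Ck_on_add Ck_on_const Ck_on_linear bounded_linear_ident)
    show "Ck_on n UNIV c"
      using assms(1) smooth_on_open_iff[OF open_UNIV] by blast
  qed simp
  then have "smooth_on {-1<..<1} (\<lambda>s. c (t + s))"
    by (rule Ck_on_imp_smooth_on)
  moreover have "((\<lambda>s. c (t + s)) has_vector_derivative u) (at 0)"
    by (rule shift_has_vector_derivative[OF assms(3)])
  ultimately show ?thesis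
    using assms(2) by (auto simp: curve_in_def intro!: exI[of _ "1::real"])
qed

text \<open>The velocity of a geodesic is compared with the projection of its value at the
  point in question, which extends to a tangent field.\<close>

lemma geodesic_line_straight:
  fixes S :: "'v::euclidean_space set"
  assumes T: "\<And>q. q \<in> S \<Longrightarrow> subspace (tangent_space S q)"
    and smooth: "\<And>w. smooth_on S (\<lambda>q. orth_proj (tangent_space S q) w)"
    and tg: "totally_geodesic S" and geo: "geodesic_line S c" and c0: "curve_in S p u c"
  shows "c t = p + t *\<^sub>R u"
proof -
  have sm: "smooth_on UNIV c" and ran: "range c \<subseteq> S"
    using geo by (auto simp: geodesic_line_def)
  obtain c' c'' where c': "\<And>t. (c has_vector_derivative c' t) (at t)"
    and c'': "\<And>t. (c' has_vector_derivative c'' t) (at t)"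
    using smooth_curve_derivatives[OF sm] by metis
  have "(\<lambda>s. vector_derivative c (at s)) = c'"
    using vector_derivative_at[OF c'] by auto
  then have nor: "c'' t \<in> normal_space S (c t)" for t
    using geo vector_derivative_at[OF c''] by (auto simp: geodesic_line_def)
  have mem: "c t \<in> S" for t
    using ran by auto
  have curve: "curve_in S (c t) (c' t) (\<lambda>s. c (t + s))" for t
    by (rule curve_in_shift[OF sm ran c'])
  have tan: "c' t \<in> tangent_space S (c t)" for t
    using curve by (auto simp: tangent_space_def)
  have "c'' t = 0" for t
  proof -
    define P where "P q = orth_proj (tangent_space S q)" for q
    define Y where "Y q = P q (c' t)" for q
    have Y: "tangent_field S Y"
      unfolding tangent_field_def Y_def[abs_def] P_def
      using smooth orth_proj_exists(1)[OF T] by blast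
    have Yt: "Y (c t) = c' t"
      unfolding Y_def P_def by (rule orth_proj_mem[OF T[OF mem] tan])
    define h where "h s = c' (t + s) - c' t" for s
    have shift: "((\<lambda>s. c' (t + s)) has_vector_derivative c'' t) (at 0)"
      by (rule shift_has_vector_derivative[OF c''])
    then have h: "(h has_vector_derivative c'' t) (at 0)" "h 0 = 0"
      unfolding h_def by (auto intro!: derivative_eq_intros)
    have "((\<lambda>s. P (c (t + s)) (h s)) has_vector_derivative P (c t) (c'' t)) (at 0)"
      unfolding P_def by (rule orth_proj_along_curve[OF T smooth mem curve h])
    moreover have "P (c t) (c'' t) = 0"
      unfolding P_def using nor by (intro orth_proj_orthogonal T mem) (simp add: normal_space_def)
    ultimately have "((\<lambda>s. c' (t + s) - P (c (t + s)) (h s)) has_vector_derivative c'' t - 0) (at 0)"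
      using shift by (intro has_vector_derivative_diff) simp_all
    moreover have "c' (t + s) - P (c (t + s)) (h s) = Y (c (t + s))" for s
      unfolding h_def Y_def P_def
      using linear_diff[OF linear_orth_proj[OF T[OF mem]]] orth_proj_mem[OF T[OF mem] tan] by simp
    ultimately have "((\<lambda>s. Y (c (t + s))) has_vector_derivative c'' t) (at 0)"
      by simp
    then have "deriv_along S Y (c t) (c' t) = c'' t"
      using Y by (intro deriv_along_eq[OF _ mem curve]) (auto simp: tangent_field_def)
    then have "second_form S (c t) (c' t) (Y (c t)) = c'' t"
      using second_form_eq[OF T smooth mem tan Y] nor by (simp add: subspace_normal_space)
    then show "c'' t = 0"
      using tg mem tan Yt by (auto simp: totally_geodesic_def)
  qed
  then have "(c' has_vector_derivative 0) (at t within UNIV)" for t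
    using c''[of t] by simp
  then obtain w where w: "\<And>t. c' t = w"
    using has_vector_derivative_zero_constant[of UNIV c'] by auto
  have "((\<lambda>t. c t - t *\<^sub>R w) has_vector_derivative 0) (at t within UNIV)" for t
    using c'[of t] by (auto simp: w intro!: derivative_eq_intros)
  then obtain z where z: "\<And>t. c t - t *\<^sub>R w = z"
    using has_vector_derivative_zero_constant[of UNIV "\<lambda>t. c t - t *\<^sub>R w"] by auto
  have "c 0 = p" "(c has_vector_derivative u) (at 0)"
    using c0 by (auto simp: curve_in_def)
  then have "z = p" "w = u"
    using z[of 0] vector_derivative_unique_at[OF c'[of 0]] w by auto
  with z[of t] show ?thesis
    by (simp add: algebra_simps)
qed

lemma obtain_indexed_basis:
  fixes E :: "'v::euclidean_space set"
  assumes "subspace E"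
  obtains b :: "nat \<Rightarrow> 'v" where "span (b ` {..<dim E}) = E"
proof -
  obtain B where B: "B \<subseteq> E" "independent B" "span B = E" "card B = dim E"
    using basis_exists[of E] assms by (metis span_subspace)
  have "finite B"
    using independent_imp_finite[OF B(2)] .
  then obtain b where "bij_betw b {..<dim E} B"
    using ex_bij_betw_nat_finite[of B] by (auto simp: B(4) atLeast0LessThan)
  with B(3) show thesis
    by (intro that[of b]) (simp add: bij_betw_def)
qed

text \<open>The straightening map and its inverse carry curves in \<open>S\<close> to curves in the
  fixed space \<open>E\<close> and back. Hence the derivative of the inverse maps \<open>E\<close>
  onto each nearby tangent space, and a basis of \<open>E\<close> becomes a smooth frame.\<close>

lemma submanifold_chart:
  fixes S :: "'v::euclidean_space set"
  assumes "submanifold d S" "p \<in> S"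
  obtains W F where "open W" "p \<in> W" "\<And>i. i < d \<Longrightarrow> smooth_on W (F i)"
    "\<And>q. q \<in> S \<inter> W \<Longrightarrow> tangent_space S q = span ((\<lambda>i::nat. F i q) ` {..<d})"
    "\<And>q. q \<in> S \<inter> W \<Longrightarrow> dim (tangent_space S q) = d"
proof -
  obtain W W' and \<Phi> \<Psi> :: "'v \<Rightarrow> 'v" and E where W: "open W" "p \<in> W" "open W'"
    and hom: "homeomorphism W W' \<Phi> \<Psi>" and sm: "smooth_on W \<Phi>" "smooth_on W' \<Psi>"
    and E: "subspace E" "dim E = d" "\<Phi> ` (W \<inter> S) = W' \<inter> E"
    using assms unfolding submanifold_def by metis
  have inv: "\<And>x. x \<in> W \<Longrightarrow> \<Psi> (\<Phi> x) = x" "\<And>y. y \<in> W' \<Longrightarrow> \<Phi> (\<Psi> y) = y"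
    and img: "\<And>x. x \<in> W \<Longrightarrow> \<Phi> x \<in> W'" "\<And>y. y \<in> W' \<Longrightarrow> \<Psi> y \<in> W"
    using hom by (auto simp: homeomorphism_def)
  have Ck: "Ck_on n W \<Phi>" "Ck_on n W' \<Psi>" for n
    using sm W smooth_on_open_iff by blast+
  define D where "D y = frechet_derivative \<Psi> (at y)" for y
  have D: "(\<Psi> has_derivative D y) (at y)" if "y \<in> W'" for y
    using smooth_on_imp_differentiable[OF W(3) sm(2) that] unfolding D_def
    by (metis frechet_derivative_at)
  have DCk: "Ck_on n W' (\<lambda>y. D y v)" for n v
  proof -
    obtain g where g: "\<And>x. x \<in> W' \<Longrightarrow> (\<Psi> has_derivative g x) (at x)" "\<And>v. Ck_on n W' (\<lambda>x. g x v)"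
      using Ck(2)[of "Suc n"] by auto
    show ?thesis
    proof (rule Ck_on_cong[OF W(3) g(2)])
      fix x assume "x \<in> W'"
      then show "g x v = D x v"
        using frechet_derivative_at[OF g(1)] by (simp add: D_def)
    qed
  qed
  obtain b :: "nat \<Rightarrow> 'v" where b: "span (b ` {..<d}) = E"
    using obtain_indexed_basis[OF E(1)] E(2) by auto
  have tangent: "tangent_space S q = D (\<Phi> q) ` E" and inj: "inj (D (\<Phi> q))" if q: "q \<in> S \<inter> W" for q
  proof -
    have qW: "\<Phi> q \<in> W'" "\<Phi> q \<in> E" "\<Psi> (\<Phi> q) = q"
      using q img inv E(3) by auto
    note Dq = D[OF qW(1)]
    obtain D' where D': "(\<Phi> has_derivative D') (at q)"
      using smooth_on_imp_differentiable[OF W(1) sm(1)] q by blast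
    have "((\<lambda>y. \<Phi> (\<Psi> y)) has_derivative (\<lambda>v. D' (D (\<Phi> q) v))) (at (\<Phi> q))"
      using has_derivative_compose[OF Dq] D' qW(3) by simp
    moreover have "((\<lambda>y. \<Phi> (\<Psi> y)) has_derivative (\<lambda>v. v)) (at (\<Phi> q))"
      by (rule has_derivative_transform_within_open[OF has_derivative_ident W(3) qW(1)]) (simp add: inv)
    ultimately have "(\<lambda>v. D' (D (\<Phi> q) v)) = (\<lambda>v. v)"
      by (rule has_derivative_unique)
    then show "inj (D (\<Phi> q))"
      by (metis injI)
    show "tangent_space S q = D (\<Phi> q) ` E"
    proof (intro equalityI subsetI)
      fix u assume "u \<in> tangent_space S q"
      then obtain c where c: "curve_in S q u c"
        by (auto simp: tangent_space_def)
      then have c0: "c 0 = q" "(c has_vector_derivative u) (at 0)"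
        by (auto simp: curve_in_def)
      have ev: "\<forall>\<^sub>F t in at 0. c t \<in> S \<inter> W"
        using curve_in_eventually[OF c W(1)] q by blast
      have \<Phi>c: "((\<lambda>t. \<Phi> (c t)) has_vector_derivative D' u) (at 0)"
        by (rule vector_derivative_compose[OF c0(2)]) (simp add: c0 D')
      have "\<forall>\<^sub>F t in at 0. \<Phi> (c t) \<in> E"
        using ev by eventually_elim (use E(3) in blast)
      then have "D' u \<in> E"
        by (rule has_vector_derivative_in_subspace[OF E(1) \<Phi>c]) (simp add: c0 qW)
      moreover have "D (\<Phi> q) (D' u) = u"
      proof (rule vector_derivative_unique_at)
        show "((\<lambda>t. \<Psi> (\<Phi> (c t))) has_vector_derivative D (\<Phi> q) (D' u)) (at 0)"
          by (rule vector_derivative_compose[OF \<Phi>c]) (simp add: c0 Dq)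
        have "\<forall>\<^sub>F t in at 0. c t = \<Psi> (\<Phi> (c t))"
          using ev by eventually_elim (simp add: inv)
        then show "((\<lambda>t. \<Psi> (\<Phi> (c t))) has_vector_derivative u) (at 0)"
          by (rule has_vector_derivative_eventually[OF c0(2)]) (simp add: c0 qW)
      qed
      ultimately show "u \<in> D (\<Phi> q) ` E"
        by force
    next
      fix u assume "u \<in> D (\<Phi> q) ` E"
      then obtain e where e: "e \<in> E" "u = D (\<Phi> q) e"
        by blast
      define l where "l t = \<Phi> q + t *\<^sub>R e" for t :: real
      have "open (l -` W')"
        unfolding l_def by (intro open_vimage W(3) continuous_intros)
      moreover have "0 \<in> l -` W'"
        using qW by (simp add: l_def)
      ultimately obtain r where r: "0 < r" "ball 0 r \<subseteq> l -` W'"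
        using open_contains_ball by blast
      have sub: "{-r<..<r} \<subseteq> l -` W'"
        using r(2) by (auto simp: subset_iff dist_real_def)
      have "Ck_on n {-r<..<r} (\<lambda>t. \<Psi> (l t))" for n
      proof (rule Ck_on_compose[OF _ Ck(2)])
        show "Ck_on n {-r<..<r} l"
          unfolding l_def by (intro Ck_on_add Ck_on_const Ck_on_linear bounded_linear_scaleR_left)
      qed (use sub in blast)
      then have "smooth_on {-r<..<r} (\<lambda>t. \<Psi> (l t))"
        by (simp add: smooth_on_open_iff)
      moreover have "\<Psi> (l t) \<in> S" if "t \<in> {-r<..<r}" for t
      proof -
        have "l t \<in> W'"
          using that sub by auto
        moreover have "l t \<in> E"
          unfolding l_def by (intro subspace_add subspace_scale E(1) qW(2) e(1))
        ultimately obtain x where "x \<in> W \<inter> S" "l t = \<Phi> x"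
          using E(3) by blast
        then show ?thesis
          by (simp add: inv)
      qed
      moreover have "((\<lambda>t. \<Psi> (l t)) has_vector_derivative u) (at 0)"
        unfolding e(2) l_def
        by (rule vector_derivative_compose[OF line_has_vector_derivative]) (simp add: Dq)
      ultimately have "curve_in S q u (\<lambda>t. \<Psi> (l t))"
        using r(1) qW by (auto simp: curve_in_def l_def)
      then show "u \<in> tangent_space S q"
        by (auto simp: tangent_space_def)
    qed
  qed
  show thesis
  proof (rule that[of W "\<lambda>i q. D (\<Phi> q) (b i)"])
    show "smooth_on W (\<lambda>q. D (\<Phi> q) (b i))" for i
      unfolding smooth_on_open_iff[OF W(1)] using img(1)
      by (intro allI Ck_on_compose[OF Ck(1) DCk]) auto
    fix q assume q: "q \<in> S \<inter> W"
    then have lin: "linear (D (\<Phi> q))"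
      using D img has_derivative_linear by blast
    show "tangent_space S q = span ((\<lambda>i. D (\<Phi> q) (b i)) ` {..<d})"
      unfolding tangent[OF q] b[symmetric] using linear_span_image[OF lin, of "b ` {..<d}"]
      by (simp add: image_image)
    show "dim (tangent_space S q) = d"
      unfolding tangent[OF q] using dim_image_eq[OF lin, of E] inj[OF q] E
      by (metis inj_on_subset subset_UNIV)
  qed (use W in auto)
qed

lemma smooth_on_subset: "smooth_on T f \<Longrightarrow> S \<subseteq> T \<Longrightarrow> smooth_on S f"
  unfolding smooth_on_def
proof
  fix x
  assume f: "\<forall>x\<in>T. \<exists>W F. open W \<and> x \<in> W \<and> (\<forall>n. Ck_on n W F) \<and> (\<forall>y\<in>T \<inter> W. F y = f y)"
    and x: "S \<subseteq> T" "x \<in> S"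
  then obtain W F where "open W" "x \<in> W" "\<forall>n. Ck_on n W F" "\<forall>y\<in>T \<inter> W. F y = f y"
    by (meson subsetD)
  with x(1) show "\<exists>W F. open W \<and> x \<in> W \<and> (\<forall>n. Ck_on n W F) \<and> (\<forall>y\<in>S \<inter> W. F y = f y)"
    by (intro exI[of _ W] exI[of _ F]) auto
qed

lemma submanifold_tangent:
  fixes S :: "'v::euclidean_space set"
  assumes "submanifold d S"
  shows "q \<in> S \<Longrightarrow> subspace (tangent_space S q)" "smooth_on S (\<lambda>q. orth_proj (tangent_space S q) w)"
proof -
  show "subspace (tangent_space S q)" if "q \<in> S" for q
    using submanifold_chart[OF assms that] that by (metis IntI subspace_span)
  show "smooth_on S (\<lambda>q. orth_proj (tangent_space S q) w)"
  proof (rule smooth_on_orth_proj[where k = d])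
    fix p assume p: "p \<in> S"
    obtain W F where W: "open W" "p \<in> W" "\<And>i. i < d \<Longrightarrow> smooth_on W (F i)"
      "\<And>q. q \<in> S \<inter> W \<Longrightarrow> tangent_space S q = span ((\<lambda>i::nat. F i q) ` {..<d})"
      "\<And>q. q \<in> S \<inter> W \<Longrightarrow> dim (tangent_space S q) = d"
      using submanifold_chart[OF assms p] by blast
    then show "dim (tangent_space S p) = d"
      using p by blast
    have "smooth_on (S \<inter> W) (F i)" if "i < d" for i
      by (rule smooth_on_subset[OF W(3)[OF that]]) simp
    with W(1,2,4) show "\<exists>W Y. open W \<and> p \<in> W \<and> (\<forall>i<d. smooth_on (S \<inter> W) (Y i)) \<and>
        (\<forall>q\<in>S \<inter> W. tangent_space S q = span ((\<lambda>i::nat. Y i q) ` {..<d}))"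
      by (intro exI[of _ W] exI[of _ F] conjI ballI allI impI)
  qed
qed

lemma totally_geodesic_contains_lines:
  fixes S :: "'v::euclidean_space set"
  assumes "submanifold d S" "totally_geodesic S" "geodesically_complete S"
    and "p \<in> S" "u \<in> tangent_space S p"
  shows "p + u \<in> S"
proof -
  obtain c where c: "geodesic_line S c" "curve_in S p u c"
    using assms(3-5) by (auto simp: geodesically_complete_def)
  have "c 1 = p + 1 *\<^sub>R u"
    by (rule geodesic_line_straight[OF submanifold_tangent[OF assms(1)] assms(2) c])
  moreover have "c 1 \<in> S"
    using c(1) by (auto simp: geodesic_line_def)
  ultimately show ?thesis
    by simp
qed

section \<open>Orbits of compact linear groups\<close>

lemma dim_orthogonal_comp:
  fixes T :: "'v::euclidean_space set"
  assumes "subspace T"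
  shows "dim (T\<^sup>\<bottom>) + dim T = DIM('v)"
proof -
  have "T\<^sup>\<bottom> = {y \<in> UNIV. \<forall>x\<in>T. orthogonal x y}"
    by (auto simp: orthogonal_comp_def)
  then show ?thesis
    using dim_subspace_orthogonal_to_vectors[OF assms subspace_UNIV] by (simp add: dim_UNIV)
qed

lemma orthogonal_compI: "(\<And>y. y \<in> T \<Longrightarrow> y \<bullet> x = 0) \<Longrightarrow> x \<in> T\<^sup>\<bottom>"
  by (simp add: orthogonal_comp_def orthogonal_def)

lemma orthogonal_compD: "x \<in> T\<^sup>\<bottom> \<Longrightarrow> y \<in> T \<Longrightarrow> y \<bullet> x = 0"
  by (simp add: orthogonal_comp_def orthogonal_def)

context orthogonal_group
begin

definition orb :: "'v \<Rightarrow> 'v set" where "orb p = (\<lambda>h. h \<star> p) ` H"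

definition orbit_tangent :: "'v \<Rightarrow> 'v set" where "orbit_tangent p = (\<lambda>X. X \<star> p) ` lie"

definition orbit_normal :: "'v \<Rightarrow> 'v set" where "orbit_normal p = (orbit_tangent p)\<^sup>\<bottom>"

text \<open>The tangent space at \<open>w\<close> to the orbit of the isotropy group of
  \<open>r\<close>; for \<open>w\<close> normal at \<open>r\<close> it belongs to the slice
  representation.\<close>

definition slice :: "'v \<Rightarrow> 'v \<Rightarrow> 'v set" where "slice r w = (\<lambda>X. X \<star> w) ` {X \<in> lie. X \<star> r = 0}"

lemma linear_app_left: "linear (\<lambda>X :: 'v endo. X \<star> p)"
  by (simp add: app.bounded_linear_left bounded_linear.linear)

lemma subspace_orbit_tangent: "subspace (orbit_tangent p)"
  unfolding orbit_tangent_def by (rule linear_subspace_image[OF linear_app_left subspace_lie])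

lemma subspace_orbit_normal: "subspace (orbit_normal p)"
  unfolding orbit_normal_def by (rule subspace_orthogonal_comp)

lemma subspace_slice: "subspace (slice r w)"
proof -
  have "subspace {X \<in> lie. X \<star> r = 0}"
    using subspace_lie by (auto simp: subspace_def app.add_left app.scaleR_left)
  then show ?thesis
    unfolding slice_def by (rule linear_subspace_image[OF linear_app_left])
qed

lemma orbit_tangentI: "X \<in> lie \<Longrightarrow> X \<star> p \<in> orbit_tangent p"
  by (simp add: orbit_tangent_def)

lemma orbit_normalI: "(\<And>X. X \<in> lie \<Longrightarrow> (X \<star> p) \<bullet> v = 0) \<Longrightarrow> v \<in> orbit_normal p"
  by (auto simp: orbit_normal_def orbit_tangent_def intro!: orthogonal_compI)

lemma orbit_normalD: "v \<in> orbit_normal p \<Longrightarrow> X \<in> lie \<Longrightarrow> (X \<star> p) \<bullet> v = 0"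
  by (auto simp: orbit_normal_def orbit_tangent_def dest!: orthogonal_compD)

lemma orbit_normal_comp: "(orbit_normal p)\<^sup>\<bottom> = orbit_tangent p"
  by (simp add: orbit_normal_def orthogonal_comp_self[OF subspace_orbit_tangent])

lemma dim_orbit_normal: "dim (orbit_normal p) + dim (orbit_tangent p) = DIM('v)"
  unfolding orbit_normal_def by (rule dim_orthogonal_comp[OF subspace_orbit_tangent])

lemma orb_refl: "p \<in> orb p"
  using one_mem by (force simp: orb_def)

lemma orb_eq:
  assumes "q \<in> orb p"
  shows "orb q = orb p"
proof -
  obtain h where h: "h \<in> H" "q = h \<star> p"
    using assms by (auto simp: orb_def)
  obtain h' where h': "h' \<in> H" "h' \<star> q = p"
    using inverse_app[OF h(1)] h(2) by auto
  have "g \<star> p \<in> orb q" if "g \<in> H" for g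
    using mult_mem[OF that h'(1)] h'(2) by (force simp: orb_def)
  moreover have "g \<star> q \<in> orb p" if "g \<in> H" for g
    using mult_mem[OF that h(1)] h(2) by (force simp: orb_def)
  ultimately show ?thesis
    by (auto simp: orb_def)
qed

lemma Ck_on_exp_app: "Ck_on n UNIV (\<lambda>t. exp (t *\<^sub>R X) \<star> (x :: 'v))"
proof (induction n arbitrary: x)
  case 0
  then show ?case
    using has_vector_derivative_continuous[OF exp_app_has_vector_derivative]
    by (auto simp: continuous_on_eq_continuous_within)
next
  case (Suc n)
  have "Ck_on n UNIV (\<lambda>t. v *\<^sub>R (exp (t *\<^sub>R X) \<star> X \<star> x))" for v
    by (rule Ck_on_scaleR[OF Ck_on_const Suc])
  then show ?case
    using exp_app_has_vector_derivative[of X x]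
    unfolding Ck_on.simps has_vector_derivative_def
    by (intro exI[of _ "\<lambda>t v. v *\<^sub>R (exp (t *\<^sub>R X) \<star> X \<star> x)"]) blast
qed

lemma curve_in_exp:
  assumes "X \<in> lie"
  shows "curve_in (orb p) p (X \<star> p) (\<lambda>t. exp (t *\<^sub>R X) \<star> p)"
  unfolding curve_in_def
proof (intro conjI exI[of _ "1::real"])
  show "smooth_on {-1<..<1} (\<lambda>t. exp (t *\<^sub>R X) \<star> p)"
    by (intro Ck_on_imp_smooth_on Ck_on_exp_app)
  show "((\<lambda>t. exp (t *\<^sub>R X) \<star> p) has_vector_derivative X \<star> p) (at 0)"
    using exp_app_has_vector_derivative[of X p 0] by simp
qed (auto simp: orb_def exp_mem[OF assms])

lemma tangent_space_orb: "tangent_space (orb p) p = orbit_tangent p"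
proof (intro equalityI subsetI)
  fix u assume "u \<in> tangent_space (orb p) p"
  then obtain c e where c: "0 < e" "c ` {-e<..<e} \<subseteq> orb p" "c 0 = p" "(c has_vector_derivative u) (at 0)"
    by (auto simp: tangent_space_def curve_in_def)
  then have "\<exists>X\<in>lie. X \<star> p = u"
    by (intro orbit_curve_derivative[of e c]) (auto simp: orb_def)
  then show "u \<in> orbit_tangent p"
    by (auto simp: orbit_tangent_def)
next
  fix u assume "u \<in> orbit_tangent p"
  then show "u \<in> tangent_space (orb p) p"
    using curve_in_exp by (auto simp: orbit_tangent_def tangent_space_def)
qed

lemma tangent_space_orb': "q \<in> orb p \<Longrightarrow> tangent_space (orb p) q = orbit_tangent q"
  using tangent_space_orb[of q] by (simp add: orb_eq)

lemma normal_space_orb: "q \<in> orb p \<Longrightarrow> normal_space (orb p) q = orbit_normal q"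
  by (simp add: normal_space_def tangent_space_orb' orbit_normal_def)

lemma orbit_tangent_app:
  assumes "g \<in> H"
  shows "orbit_tangent (g \<star> p) = (\<star>) g ` orbit_tangent p"
proof -
  obtain h where h: "h \<in> H" "g * h = 1" "h * g = 1"
    using inverse_mem[OF assms] by blast
  have hg: "h \<star> g \<star> x = x" "g \<star> h \<star> x = x" for x
    using h by (metis app_one app_times)+
  show ?thesis
  proof (intro equalityI subsetI)
    fix u assume "u \<in> orbit_tangent (g \<star> p)"
    then obtain X where X: "X \<in> lie" "u = X \<star> g \<star> p"
      by (auto simp: orbit_tangent_def)
    then have "u = g \<star> (h * X * g) \<star> p"
      by (simp add: hg)
    then show "u \<in> (\<star>) g ` orbit_tangent p"
      using orbit_tangentI[OF lie_conj[OF X(1) h(1) assms h(3)]] by blast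
  next
    fix u assume "u \<in> (\<star>) g ` orbit_tangent p"
    then obtain X where X: "X \<in> lie" "u = g \<star> X \<star> p"
      by (auto simp: orbit_tangent_def)
    then have "u = (g * X * h) \<star> g \<star> p"
      by (simp add: hg)
    then show "u \<in> orbit_tangent (g \<star> p)"
      using orbit_tangentI[OF lie_conj[OF X(1) assms h(1) h(2)]] by metis
  qed
qed

lemma orthogonal_comp_app:
  assumes "g \<in> H"
  shows "((\<star>) g ` T)\<^sup>\<bottom> = (\<star>) g ` (T\<^sup>\<bottom>)"
proof -
  obtain h where h: "h \<in> H" "\<And>x. g \<star> h \<star> x = x" "\<And>x. h \<star> g \<star> x = x"
    using inverse_app[OF assms] by blast
  show ?thesis
  proof (intro equalityI subsetI)
    fix v assume v: "v \<in> ((\<star>) g ` T)\<^sup>\<bottom>"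
    have "h \<star> v \<in> T\<^sup>\<bottom>"
    proof (rule orthogonal_compI)
      fix y assume "y \<in> T"
      then have "(g \<star> y) \<bullet> (g \<star> h \<star> v) = 0"
        using v by (simp add: h orthogonal_compD)
      then show "y \<bullet> (h \<star> v) = 0"
        by (simp only: inner_app[OF assms])
    qed
    then show "v \<in> (\<star>) g ` (T\<^sup>\<bottom>)"
      using h(2) by (metis image_eqI)
  qed (auto intro!: orthogonal_compI dest!: orthogonal_compD simp: inner_app[OF assms])
qed

lemma orbit_normal_app: "g \<in> H \<Longrightarrow> orbit_normal (g \<star> p) = (\<star>) g ` orbit_normal p"
  by (simp add: orbit_normal_def orbit_tangent_app orthogonal_comp_app)

lemma app_inj: "g \<in> H \<Longrightarrow> inj ((\<star>) g)"
  using inverse_app by (metis injI)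

lemma dim_app: "g \<in> H \<Longrightarrow> dim ((\<star>) g ` T) = dim T"
  by (intro dim_image_eq linear_app) (metis app_inj inj_on_subset subset_UNIV)

lemma dim_orbit_tangent_app: "g \<in> H \<Longrightarrow> dim (orbit_tangent (g \<star> p)) = dim (orbit_tangent p)"
  by (simp add: orbit_tangent_app dim_app)

text \<open>Orbits lie in spheres about the origin.\<close>

lemma self_mem_orbit_normal: "p \<in> orbit_normal p"
proof (rule orbit_normalI)
  fix X assume "X \<in> lie"
  from lie_skew[OF this, of p p] show "(X \<star> p) \<bullet> p = 0"
    by (simp add: inner_commute)
qed

lemma orbit_normal_sym: "v \<in> orbit_normal p \<Longrightarrow> p \<in> orbit_normal v"
  by (rule orbit_normalI) (metis inner_commute lie_skew orbit_normalD neg_equal_0_iff_equal)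

text \<open>This is the symmetry of the shape operator in the direction \<open>v\<close>.\<close>

lemma normal_symmetric:
  assumes "v \<in> orbit_normal p" "X \<in> lie" "Y \<in> lie"
  shows "(X \<star> v) \<bullet> (Y \<star> p) = (Y \<star> v) \<bullet> (X \<star> p)"
proof -
  have "((\<lambda>t. (exp (t *\<^sub>R Y) \<star> v) \<bullet> (X \<star> exp (t *\<^sub>R Y) \<star> p)) has_vector_derivative
      v \<bullet> (X \<star> Y \<star> p) + (Y \<star> v) \<bullet> (X \<star> p)) (at 0)"
    using bounded_bilinear.has_vector_derivative[OF bounded_bilinear_inner
        exp_app_has_vector_derivative[of Y v 0]
        bounded_linear.has_vector_derivative[OF app.bounded_linear_right
          exp_app_has_vector_derivative[of Y p 0], of X]]
    by simp
  moreover have "(exp (t *\<^sub>R Y) \<star> v) \<bullet> (X \<star> exp (t *\<^sub>R Y) \<star> p) = 0" for t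
    using orbit_normalD[OF _ assms(2), of _ "exp (t *\<^sub>R Y) \<star> p"] orbit_normal_app[OF exp_mem[OF assms(3)], of t p] assms(1)
    by (simp add: inner_commute)
  ultimately have "((\<lambda>t. 0) has_vector_derivative v \<bullet> (X \<star> Y \<star> p) + (Y \<star> v) \<bullet> (X \<star> p)) (at 0)"
    by simp
  then have "v \<bullet> (X \<star> Y \<star> p) + (Y \<star> v) \<bullet> (X \<star> p) = 0"
    by (rule vector_derivative_unique_at) simp
  then show ?thesis
    using lie_skew[OF assms(2), of v "Y \<star> p"] by simp
qed

text \<open>A generator \<open>Z\<close> with \<open>Z \<star> p = y\<close> is itself a smooth
  tangent field, which provides the witness. For an arbitrary field \<open>Y\<close> the derivative
  is tested against a normal vector moved by \<open>exp (t *\<^sub>R X)\<close>: it stays normal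
  along the orbit, so its inner product with \<open>Y\<close> is constantly 0.\<close>

lemma second_form_orb:
  assumes "X \<in> lie" "y \<in> orbit_tangent p"
  shows "second_form (orb p) p (X \<star> p) y = orth_proj (orbit_normal p) (X \<star> y)"
proof -
  obtain Z where Z: "Z \<in> lie" "y = Z \<star> p"
    using assms(2) by (auto simp: orbit_tangent_def)
  show ?thesis
  proof (rule second_form_eqI)
    show "tangent_field (orb p) ((\<star>) Z)"
      by (auto simp: tangent_field_def tangent_space_orb' orbit_tangentI[OF Z(1)] intro!: smooth_on_linear)
    show "Z \<star> p = y"
      by (simp add: Z)
    fix Y assume Y: "tangent_field (orb p) Y" "Y p = y"
    define w where "w = deriv_along (orb p) Y p (X \<star> p)"
    have w: "((\<lambda>t. Y (exp (t *\<^sub>R X) \<star> p)) has_vector_derivative w) (at 0)"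
      unfolding w_def using Y
      by (intro deriv_along_curve curve_in_exp assms orb_refl) (auto simp: tangent_field_def)
    have "v \<bullet> (w - X \<star> y) = 0" if v: "v \<in> orbit_normal p" for v
    proof -
      have "((\<lambda>t. Y (exp (t *\<^sub>R X) \<star> p) \<bullet> (exp (t *\<^sub>R X) \<star> v)) has_vector_derivative
          y \<bullet> (X \<star> v) + w \<bullet> v) (at 0)"
        using bounded_bilinear.has_vector_derivative[OF bounded_bilinear_inner w
            exp_app_has_vector_derivative[of X v 0]] by (simp add: Y)
      moreover have "Y (exp (t *\<^sub>R X) \<star> p) \<bullet> (exp (t *\<^sub>R X) \<star> v) = 0" for t
      proof -
        have E: "exp (t *\<^sub>R X) \<in> H"
          by (rule exp_mem[OF assms(1)])
        then have "exp (t *\<^sub>R X) \<star> p \<in> orb p"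
          by (simp add: orb_def)
        then have "Y (exp (t *\<^sub>R X) \<star> p) \<in> orbit_tangent (exp (t *\<^sub>R X) \<star> p)"
          using Y(1) by (metis tangent_field_def tangent_space_orb')
        moreover have "exp (t *\<^sub>R X) \<star> v \<in> orbit_normal (exp (t *\<^sub>R X) \<star> p)"
          using v by (simp add: orbit_normal_app[OF E])
        ultimately show ?thesis
          by (auto simp: orbit_normal_def dest: orthogonal_compD)
      qed
      ultimately have "((\<lambda>t. 0) has_vector_derivative y \<bullet> (X \<star> v) + w \<bullet> v) (at 0)"
        by simp
      then have "y \<bullet> (X \<star> v) + w \<bullet> v = 0"
        by (rule vector_derivative_unique_at) simp
      then show ?thesis
        using lie_skew[OF assms(1), of y v] by (simp add: inner_diff_right inner_commute)
    qed
    then have "w - X \<star> y \<in> (orbit_normal p)\<^sup>\<bottom>"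
      by (intro orthogonal_compI)
    then have "orth_proj (orbit_normal p) (w - X \<star> y) = 0"
      by (intro orth_proj_orthogonal subspace_orbit_normal)
    then show "orth_proj (normal_space (orb p) p) (deriv_along (orb p) Y p (X \<star> p)) = orth_proj (orbit_normal p) (X \<star> y)"
      by (simp add: normal_space_orb[OF orb_refl] linear_diff[OF linear_orth_proj[OF subspace_orbit_normal]] flip: w_def)
  qed
qed

lemma orth_proj_inner:
  assumes "subspace T" "v \<in> T"
  shows "orth_proj T w \<bullet> v = w \<bullet> v"
  using orthogonal_compD[OF orth_proj_exists(2)[OF assms(1), of w] assms(2)]
  by (simp add: inner_diff_right inner_commute)

text \<open>The sign comes from skewness: the second fundamental form pairs to
  \<open>(X \<star> y) \<bullet> v\<close>, which is
  \<open>- (X \<star> v) \<bullet> y\<close>.\<close>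

lemma shape_operator_orb:
  assumes "X \<in> lie" "v \<in> orbit_normal p"
  shows "shape_operator (orb p) p v (X \<star> p) = - orth_proj (orbit_tangent p) (X \<star> v)"
  unfolding shape_operator_def tangent_space_orb
proof (rule the_equality)
  have eq: "second_form (orb p) p (X \<star> p) y \<bullet> v = - orth_proj (orbit_tangent p) (X \<star> v) \<bullet> y" if "y \<in> orbit_tangent p" for y
  proof -
    have "orth_proj (orbit_tangent p) (X \<star> v) \<bullet> y = (X \<star> v) \<bullet> y"
      by (rule orth_proj_inner[OF subspace_orbit_tangent that])
    moreover have "orth_proj (orbit_normal p) (X \<star> y) \<bullet> v = (X \<star> y) \<bullet> v"
      by (rule orth_proj_inner[OF subspace_orbit_normal assms(2)])
    ultimately show ?thesis
      using lie_skew[OF assms(1), of y v]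
      by (simp add: second_form_orb[OF assms(1) that] inner_commute[of y])
  qed
  show "- orth_proj (orbit_tangent p) (X \<star> v) \<in> orbit_tangent p \<and>
      (\<forall>y\<in>orbit_tangent p. - orth_proj (orbit_tangent p) (X \<star> v) \<bullet> y = second_form (orb p) p (X \<star> p) y \<bullet> v)"
    using eq orth_proj_exists(1)[OF subspace_orbit_tangent] subspace_neg[OF subspace_orbit_tangent] by simp
  fix a assume a: "a \<in> orbit_tangent p \<and> (\<forall>y\<in>orbit_tangent p. a \<bullet> y = second_form (orb p) p (X \<star> p) y \<bullet> v)"
  define b where "b = a - (- orth_proj (orbit_tangent p) (X \<star> v))"
  have "b \<in> orbit_tangent p"
    unfolding b_def using a by (intro subspace_diff subspace_neg subspace_orbit_tangent orth_proj_exists) auto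
  moreover have "b \<bullet> y = 0" if "y \<in> orbit_tangent p" for y
    using a eq[OF that] that unfolding b_def by (simp add: inner_add_left)
  ultimately have "b = 0"
    by (metis inner_eq_zero_iff)
  then show "a = - orth_proj (orbit_tangent p) (X \<star> v)"
    by (simp add: b_def eq_neg_iff_add_eq_0)
qed

text \<open>A tangent vector has many generators. Choosing them on a basis and extending makes the
  choice linear, so that expressions such as the tangential part of \<open>s y \<star> v\<close>
  become linear maps in \<open>y\<close>.\<close>

lemma lie_section:
  obtains s where "linear s" "\<And>y. y \<in> orbit_tangent q \<Longrightarrow> s y \<in> lie" "\<And>y. y \<in> orbit_tangent q \<Longrightarrow> s y \<star> q = y"
proof -
  obtain B where B: "B \<subseteq> orbit_tangent q" "independent B" "orbit_tangent q \<subseteq> span B"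
    using basis_exists[of "orbit_tangent q"] by metis
  define f where "f b = (SOME X. X \<in> lie \<and> X \<star> q = b)" for b
  have f: "f b \<in> lie \<and> f b \<star> q = b" if "b \<in> orbit_tangent q" for b
    unfolding f_def by (rule someI_ex) (use that in \<open>auto simp: orbit_tangent_def\<close>)
  obtain s where s: "linear s" "\<And>b. b \<in> B \<Longrightarrow> s b = f b"
    using linear_independent_extend[OF B(2), of f] by blast
  have "s y \<in> lie" if "y \<in> span B" for y
  proof -
    have "s y \<in> span (s ` B)"
      using that linear_span_image[OF s(1)] by blast
    moreover have "span (s ` B) \<subseteq> lie"
      using f s(2) B(1) by (intro span_minimal subspace_lie) auto
    ultimately show ?thesis
      by blast
  qed
  moreover have "s y \<star> q = y" if "y \<in> span B" for y
  proof (rule linear_eq_on_span[of "\<lambda>y. s y \<star> q" "\<lambda>y. y", OF _ _ _ that])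
    show "linear (\<lambda>y. s y \<star> q)"
      using linear_compose[OF s(1) linear_app_left, of q] by (simp add: o_def)
  qed (use f s(2) B(1) linear_id in \<open>auto simp: id_def\<close>)
  ultimately show thesis
    using that[OF s(1)] B(3) by blast
qed

text \<open>Exceptional orbits are included. Unlike regularity, this condition can be verified by
  dimension estimates alone, as for the points approaching \<open>r\<close> in
  \<open>normal_slice_limit\<close>.\<close>

definition max_orbit_dim :: "'v \<Rightarrow> bool" where "max_orbit_dim q \<longleftrightarrow> (\<forall>r. dim (orbit_tangent r) \<le> dim (orbit_tangent q))"

text \<open>The conjugation in \<open>regular_point\<close> amounts to this: the isotropy group of
  \<open>p\<close> fixes a point of every orbit.\<close>

definition regular :: "'v \<Rightarrow> bool" where
  "regular p \<longleftrightarrow> (\<forall>q. \<exists>h\<in>H. \<forall>k\<in>H. k \<star> p = p \<longrightarrow> k \<star> h \<star> q = h \<star> q)"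

lemma max_orbit_dim_app: "g \<in> H \<Longrightarrow> max_orbit_dim (g \<star> q) \<longleftrightarrow> max_orbit_dim q"
  by (simp add: max_orbit_dim_def dim_orbit_tangent_app)

lemma max_orbit_dim_dim_orbit_normal: "max_orbit_dim p \<Longrightarrow> max_orbit_dim q \<Longrightarrow> dim (orbit_normal p) = dim (orbit_normal q)"
  using dim_orbit_normal[of p] dim_orbit_normal[of q] unfolding max_orbit_dim_def by (metis add_right_cancel le_antisym)

lemma regular_app:
  assumes "g \<in> H" "regular p"
  shows "regular (g \<star> p)"
  unfolding regular_def
proof
  fix q
  obtain h where h: "h \<in> H" "\<And>k. k \<in> H \<Longrightarrow> k \<star> p = p \<Longrightarrow> k \<star> h \<star> q = h \<star> q"
    using assms(2) unfolding regular_def by meson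
  obtain g' where g': "g' \<in> H" "\<And>x. g \<star> g' \<star> x = x" "\<And>x. g' \<star> g \<star> x = x"
    using inverse_app[OF assms(1)] by blast
  have "k \<star> (g * h) \<star> q = (g * h) \<star> q" if "k \<in> H" "k \<star> g \<star> p = g \<star> p" for k
  proof -
    have "(g' * k * g) \<star> h \<star> q = h \<star> q"
      by (rule h(2)) (auto intro!: mult_mem that g' assms simp: that(2) g'(3))
    then have "g \<star> g' \<star> k \<star> g \<star> h \<star> q = g \<star> h \<star> q"
      by simp
    then show ?thesis
      by (simp add: g'(2))
  qed
  then show "\<exists>h\<in>H. \<forall>k\<in>H. k \<star> g \<star> p = g \<star> p \<longrightarrow> k \<star> h \<star> q = h \<star> q"
    using mult_mem[OF assms(1) h(1)] by blast
qed

text \<open>Generators that kill \<open>p\<close> also kill some point \<open>q'\<close> on the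
  orbit of \<open>q\<close>, so \<open>X \<star> q'\<close> depends on \<open>X \<star> p\<close>
  only, and linearly.\<close>

lemma regular_max_orbit_dim:
  assumes "regular p"
  shows "max_orbit_dim p"
  unfolding max_orbit_dim_def
proof
  fix q
  obtain h where h: "h \<in> H" "\<And>k. k \<in> H \<Longrightarrow> k \<star> p = p \<Longrightarrow> k \<star> h \<star> q = h \<star> q"
    using assms unfolding regular_def by meson
  define q' where "q' = h \<star> q"
  have iso: "X \<star> q' = 0" if "X \<in> lie" "X \<star> p = 0" for X
  proof -
    have "exp (t *\<^sub>R X) \<star> q' = q'" for t
      unfolding q'_def by (intro h(2) exp_mem that exp_app_eq_self)
    then have "((\<lambda>t. q') has_vector_derivative X \<star> q') (at 0)"
      using exp_app_has_vector_derivative[of X q' 0] by simp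
    then show ?thesis
      by (rule vector_derivative_unique_at) simp
  qed
  obtain s where s: "linear s" "\<And>y. y \<in> orbit_tangent p \<Longrightarrow> s y \<in> lie" "\<And>y. y \<in> orbit_tangent p \<Longrightarrow> s y \<star> p = y"
    using lie_section[of p] by blast
  have "X \<star> q' = s (X \<star> p) \<star> q'" if X: "X \<in> lie" for X
  proof -
    have "(X - s (X \<star> p)) \<star> q' = 0"
      using X s(2,3)[OF orbit_tangentI[OF X]] by (intro iso subspace_diff subspace_lie) (auto simp: app.diff_left)
    then show ?thesis
      by (simp add: app.diff_left)
  qed
  then have "orbit_tangent q' \<subseteq> (\<lambda>y. s y \<star> q') ` orbit_tangent p"
    by (auto simp: orbit_tangent_def)
  then have "dim (orbit_tangent q') \<le> dim ((\<lambda>y. s y \<star> q') ` orbit_tangent p)"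
    by (rule dim_subset)
  also have "\<dots> \<le> dim (orbit_tangent p)"
    using linear_compose[OF s(1) linear_app_left, of q'] by (intro dim_image_le) (simp add: o_def)
  finally show "dim (orbit_tangent q) \<le> dim (orbit_tangent p)"
    by (simp add: q'_def dim_orbit_tangent_app h(1))
qed

end

section \<open>Perturbation of normal spaces\<close>

text \<open>A maximizer of the quadratic form of \<open>a\<close> on the unit sphere of
  \<open>E\<close> is an eigenvector. Working inside \<open>E\<close> allows \<open>a\<close> to be
  nonsymmetric elsewhere.\<close>

lemma symmetric_eigenvector:
  fixes a :: "'v::euclidean_space \<Rightarrow> 'v"
  assumes "linear a" "subspace E" and inv: "\<And>x. x \<in> E \<Longrightarrow> a x \<in> E"
    and sym: "\<And>x y. x \<in> E \<Longrightarrow> y \<in> E \<Longrightarrow> a x \<bullet> y = x \<bullet> a y" and "E \<noteq> {0}"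
  shows "\<exists>u\<in>E. u \<noteq> 0 \<and> (\<exists>l. a u = l *\<^sub>R u)"
proof -
  obtain x0 where x0: "x0 \<in> E" "x0 \<noteq> 0"
    using assms(2,5) subspace_0 by blast
  define S where "S = E \<inter> sphere 0 1"
  have "(1 / norm x0) *\<^sub>R x0 \<in> S"
    using x0 assms(2) by (simp add: S_def subspace_scale)
  moreover have "compact S"
    unfolding S_def using closed_Int_compact[OF closed_subspace[OF assms(2)] compact_sphere] .
  moreover have cont: "continuous_on S (\<lambda>x. a x \<bullet> x)"
    by (intro continuous_intros linear_continuous_on) (use assms(1) linear_conv_bounded_linear in blast)
  ultimately obtain u where u: "u \<in> S" and max: "\<And>x. x \<in> S \<Longrightarrow> a x \<bullet> x \<le> a u \<bullet> u"
    using continuous_attains_sup[of S "\<lambda>x. a x \<bullet> x"] by blast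
  have uE: "u \<in> E" "norm u = 1"
    using u by (auto simp: S_def)
  define l where "l = a u \<bullet> u"
  have le: "a z \<bullet> z \<le> l * (z \<bullet> z)" if "z \<in> E" for z
  proof (cases "z = 0")
    case False
    define x where "x = (1 / norm z) *\<^sub>R z"
    have z: "z = norm z *\<^sub>R x"
      using False by (simp add: x_def)
    have "x \<in> S"
      using that assms(2) False by (simp add: S_def x_def subspace_scale)
    then have "a x \<bullet> x \<le> l" "x \<bullet> x = 1"
      using max by (auto simp: l_def S_def norm_eq_1)
    moreover have "a z \<bullet> z = (norm z)\<^sup>2 * (a x \<bullet> x)" "z \<bullet> z = (norm z)\<^sup>2 * (x \<bullet> x)"
      by (subst (1 2) z, simp add: linear_scale[OF assms(1)] power2_eq_square)+
    ultimately show ?thesis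
      using mult_right_mono[of "a x \<bullet> x" l "(norm z)\<^sup>2"] by (simp add: mult.commute)
  qed (simp add: linear_0[OF assms(1)])
  have "(a u - l *\<^sub>R u) \<bullet> y = 0" if y: "y \<in> E" for y
  proof -
    define b where "b = l * (u \<bullet> y) - a u \<bullet> y"
    define c where "c = l * (y \<bullet> y) - a y \<bullet> y"
    have nonneg: "0 \<le> 2 * t * b + t\<^sup>2 * c" for t
    proof -
      have "a (u + t *\<^sub>R y) \<bullet> (u + t *\<^sub>R y) \<le> l * ((u + t *\<^sub>R y) \<bullet> (u + t *\<^sub>R y))"
        using y uE assms(2) by (intro le subspace_add subspace_scale)
      moreover have "a y \<bullet> u = a u \<bullet> y"
        using sym[OF y uE(1)] by (simp add: inner_commute)
      moreover have "u \<bullet> u = 1"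
        using uE(2) by (simp add: norm_eq_1)
      ultimately show ?thesis
        by (simp add: linear_add[OF assms(1)] linear_scale[OF assms(1)] b_def c_def l_def
            inner_add_left inner_add_right inner_commute[of y u] algebra_simps power2_eq_square)
    qed
    have "b = 0"
    proof (rule ccontr)
      assume "b \<noteq> 0"
      \<comment> \<open>With \<open>d\<close> positive and at least \<open>c\<close>, the choice
        \<open>t = - b / d\<close> turns the quadratic into \<open>b\<^sup>2 / d\<^sup>2\<close>
        times \<open>c - 2 * d\<close>, which is negative.\<close>
      define d where "d = 1 + \<bar>c\<bar>"
      define t where "t = - b / d"
      have "0 < d" "c \<le> d"
        unfolding d_def using abs_ge_self[of c] by (simp_all add: add_pos_nonneg)
      then have "c - 2 * d < 0"
        by simp
      from \<open>0 < d\<close> have "2 * t * b + t\<^sup>2 * c = (b\<^sup>2 / d\<^sup>2) * (c - 2 * d)"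
        by (simp add: t_def field_simps power2_eq_square)
      moreover have "0 < b\<^sup>2 / d\<^sup>2"
        using \<open>b \<noteq> 0\<close> \<open>0 < d\<close> by simp
      moreover note \<open>c - 2 * d < 0\<close>
      ultimately show False
        using nonneg[of t] mult_pos_neg by (metis not_le)
    qed
    then show ?thesis
      by (simp add: b_def inner_diff_left)
  qed
  moreover have "a u - l *\<^sub>R u \<in> E"
    by (intro subspace_diff subspace_scale assms inv uE)
  ultimately have "a u - l *\<^sub>R u = 0"
    by (metis inner_eq_zero_iff)
  then show ?thesis
    using uE by (intro bexI[of _ u]) auto
qed

text \<open>By symmetry the part of \<open>E\<close> orthogonal to all eigenvectors is invariant
  under \<open>a\<close>; were it nonzero, it would contain a further eigenvector.\<close>

lemma symmetric_span_eigenvectors: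
  fixes a :: "'v::euclidean_space \<Rightarrow> 'v"
  assumes "linear a" "subspace E" and inv: "\<And>x. x \<in> E \<Longrightarrow> a x \<in> E"
    and sym: "\<And>x y. x \<in> E \<Longrightarrow> y \<in> E \<Longrightarrow> a x \<bullet> y = x \<bullet> a y"
  shows "E \<subseteq> span {u \<in> E. \<exists>l. a u = l *\<^sub>R u}"
proof -
  define F where "F = span {u \<in> E. \<exists>l. a u = l *\<^sub>R u}"
  define G where "G = E \<inter> F\<^sup>\<bottom>"
  have FE: "F \<subseteq> E"
    unfolding F_def by (intro span_minimal assms) auto
  have subG: "subspace G"
    unfolding G_def by (intro subspace_inter subspace_orthogonal_comp assms)
  have "G = {0}"
  proof (rule ccontr)
    assume "G \<noteq> {0}"
    have "a x \<in> G" if "x \<in> G" for x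
    proof -
      have "{u \<in> E. \<exists>l. a u = l *\<^sub>R u} \<subseteq> {y. a x \<bullet> y = 0}"
      proof safe
        fix u l assume u: "u \<in> E" "a u = l *\<^sub>R u"
        then have "u \<in> F"
          unfolding F_def by (intro span_base) auto
        then have "u \<bullet> x = 0"
          using that by (auto simp: G_def dest: orthogonal_compD)
        then show "a x \<bullet> u = 0"
          using sym[of x u] u that by (simp add: G_def inner_commute)
      qed
      then have "F \<subseteq> {y. a x \<bullet> y = 0}"
        unfolding F_def by (intro span_minimal subspace_hyperplane)
      then show ?thesis
        using that inv by (auto simp: G_def inner_commute intro!: orthogonal_compI)
    qed
    then obtain u l where u: "u \<in> G" "u \<noteq> 0" "a u = l *\<^sub>R u"
      using symmetric_eigenvector[OF assms(1) subG _ _ \<open>G \<noteq> {0}\<close>] sym unfolding G_def by blast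
    then have "u \<in> F"
      unfolding F_def by (intro span_base) (auto simp: G_def)
    then show False
      using u(1,2) by (auto simp: G_def dest: orthogonal_compD)
  qed
  have subF: "subspace F"
    by (simp add: F_def subspace_span)
  have "x \<in> F" if "x \<in> E" for x
  proof -
    have "x - orth_proj F x \<in> G"
      using that FE orth_proj_exists[OF subF, of x] assms(2) by (auto simp: G_def intro!: subspace_diff)
    then show ?thesis
      using orth_proj_exists(1)[OF subF, of x] \<open>G = {0}\<close> by simp
  qed
  then show ?thesis
    unfolding F_def by blast
qed

context orthogonal_group
begin

lemma slice_subset_orbit_normal: "w \<in> orbit_normal r \<Longrightarrow> slice r w \<subseteq> orbit_normal r"
proof safe
  fix x assume w: "w \<in> orbit_normal r" and "x \<in> slice r w"
  then obtain Y where Y: "Y \<in> lie" "Y \<star> r = 0" "x = Y \<star> w"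
    by (auto simp: slice_def)
  show "x \<in> orbit_normal r"
  proof (rule orbit_normalI)
    fix X assume "X \<in> lie"
    from normal_symmetric[OF w Y(1) this] show "(X \<star> r) \<bullet> x = 0"
      by (simp add: Y inner_commute)
  qed
qed

text \<open>For small \<open>e\<close>, the tangent space at \<open>r + e *\<^sub>R w\<close> almost contains the tangent space at \<open>r\<close>
  and that of the slice representation at \<open>w\<close>; for \<open>e = 1\<close> the same maps give an upper bound.\<close>

lemma slice_perturbation:
  assumes w: "w \<in> orbit_normal r"
  defines "F \<equiv> {y + x | y x. y \<in> orbit_tangent r \<and> x \<in> slice r w}"
  obtains L K where "0 \<le> K" "\<And>e. linear (L e)"
    "\<And>e f. e \<noteq> 0 \<Longrightarrow> f \<in> F \<Longrightarrow> L e f \<in> orbit_tangent (r + e *\<^sub>R w)"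
    "\<And>e f. norm (L e f - f) \<le> \<bar>e\<bar> * K * norm f" "orbit_tangent (r + w) \<subseteq> L 1 ` F"
proof -
  obtain s where s: "linear s" "\<And>y. y \<in> orbit_tangent r \<Longrightarrow> s y \<in> lie" "\<And>y. y \<in> orbit_tangent r \<Longrightarrow> s y \<star> r = y"
    using lie_section[of r] by blast
  define P where "P = orth_proj (orbit_tangent r)"
  have linP: "linear P"
    unfolding P_def by (rule linear_orth_proj[OF subspace_orbit_tangent])
  have P: "P (y + x) = y" if "y \<in> orbit_tangent r" "x \<in> slice r w" for x y
    unfolding P_def using that slice_subset_orbit_normal[OF w]
    by (intro orth_proj_eqI subspace_orbit_tangent) (auto simp: orbit_normal_def)
  \<comment> \<open>The tangential component of \<open>f\<close> is lifted to a generator, which is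
    then applied to \<open>w\<close>; this is the first-order change of the tangent vector when
    \<open>r\<close> moves towards \<open>w\<close>.\<close>
  define M where "M f = s (P f) \<star> w" for f
  have linM: "linear M"
    using linear_compose[OF linear_compose[OF linP s(1)] linear_app_left, of w]
    by (simp add: o_def M_def[abs_def])
  obtain K where K: "0 < K" "\<And>f. norm (M f) \<le> K * norm f"
    using linear_bounded_pos[OF linM] by blast
  define L where "L e f = f + e *\<^sub>R M f" for e f
  show thesis
  proof (rule that[of K L])
    show "linear (L e)" for e
      unfolding L_def by (intro linear_compose_add linear_compose_scale_right linM linear_ident)
    show "norm (L e f - f) \<le> \<bar>e\<bar> * K * norm f" for e f
      using mult_left_mono[OF K(2)[of f], of "\<bar>e\<bar>"] by (simp add: L_def mult.assoc)
    fix e :: real and f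
    assume e: "e \<noteq> 0" and "f \<in> F"
    then obtain y X where f: "f = y + X \<star> w" "y \<in> orbit_tangent r" "X \<in> lie" "X \<star> r = 0"
      by (auto simp: F_def slice_def)
    then have "X \<star> w \<in> slice r w"
      by (auto simp: slice_def)
    then have "M f = s y \<star> w"
      using f by (simp add: M_def P)
    \<comment> \<open>Since \<open>X\<close> kills \<open>r\<close>, it may be divided by
      \<open>e\<close>; the factor \<open>e\<close> of \<open>w\<close> then restores
      \<open>X \<star> w\<close> at full size.\<close>
    then have "L e f = (s y + (1 / e) *\<^sub>R X) \<star> (r + e *\<^sub>R w)"
      using e f s(3)[OF f(2)]
      by (simp add: L_def app.add_left app.add_right app.scaleR_left app.scaleR_right scaleR_add_right)
    also have "\<dots> \<in> orbit_tangent (r + e *\<^sub>R w)"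
      by (intro orbit_tangentI lie_add lie_scaleR s f)
    finally show "L e f \<in> orbit_tangent (r + e *\<^sub>R w)" .
  next
    show "orbit_tangent (r + w) \<subseteq> L 1 ` F"
    proof
      fix z assume "z \<in> orbit_tangent (r + w)"
      then obtain X where X: "X \<in> lie" "z = X \<star> (r + w)"
        by (auto simp: orbit_tangent_def)
      define y where "y = X \<star> r"
      define X' where "X' = X - s y"
      have y: "y \<in> orbit_tangent r"
        unfolding y_def by (rule orbit_tangentI[OF X(1)])
      have "X' \<in> lie" "X' \<star> r = 0"
        using subspace_diff[OF subspace_lie X(1) s(2)[OF y]] s(3)[OF y]
        by (auto simp: X'_def app.diff_left y_def)
      then have x: "X' \<star> w \<in> slice r w"
        by (auto simp: slice_def)
      have "M (y + X' \<star> w) = s y \<star> w"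
        by (simp add: M_def P[OF y x])
      then have "L 1 (y + X' \<star> w) = y + X' \<star> w + s y \<star> w"
        by (simp add: L_def)
      also have "\<dots> = z"
        by (simp add: X(2) X'_def app.diff_left app.add_right y_def)
      finally have "L 1 (y + X' \<star> w) = z" .
      moreover have "y + X' \<star> w \<in> F"
        using x y by (auto simp: F_def)
      ultimately show "z \<in> L 1 ` F"
        by blast
    qed
  qed (use K in auto)
qed

lemma subspace_slice_sum: "subspace {y + x | y x. y \<in> orbit_tangent r \<and> x \<in> slice r w}"
  by (rule subspace_sums[OF subspace_orbit_tangent subspace_slice])

lemma perturbation_injective:
  fixes L :: "'v \<Rightarrow> 'v"
  assumes "linear L" "subspace F" "\<And>f. norm (L f - f) \<le> (1 / 2) * norm f"
  shows "dim (L ` F) = dim F" "norm f \<le> 2 * norm (L f)"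
proof -
  show le: "norm f \<le> 2 * norm (L f)" for f
    using assms(3)[of f] norm_triangle_sub[of f "L f"] by (simp add: norm_minus_commute)
  have "inj L"
    unfolding linear_injective_0[OF assms(1)] using le by (metis norm_zero mult_zero_right norm_le_zero_iff)
  then show "dim (L ` F) = dim F"
    by (intro dim_image_eq assms) (metis inj_on_subset subset_UNIV)
qed

text \<open>Otherwise the tangent space at \<open>q + e *\<^sub>R p\<close>, for small
  \<open>e\<close>, would have room for the tangent space at \<open>q\<close> together with a
  nonzero slice direction, exceeding the maximal orbit dimension.\<close>

lemma max_orbit_dim_isotropy_normal:
  assumes "max_orbit_dim q" "p \<in> orbit_normal q" "X \<in> lie" "X \<star> q = 0"
  shows "X \<star> p = 0"
proof -
  define F where "F = {y + x | y x. y \<in> orbit_tangent q \<and> x \<in> slice q p}"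
  obtain L K where L: "0 \<le> K" "\<And>e. linear (L e)"
    "\<And>e f. e \<noteq> 0 \<Longrightarrow> f \<in> F \<Longrightarrow> L e f \<in> orbit_tangent (q + e *\<^sub>R p)"
    "\<And>e f. norm (L e f - f) \<le> \<bar>e\<bar> * K * norm f"
    using slice_perturbation[OF assms(2), folded F_def] by metis
  \<comment> \<open>Small enough for \<open>L e\<close> to differ from the identity by at most half
    the norm; \<open>1 + K\<close> avoids a division by 0.\<close>
  define e where "e = 1 / (2 * (1 + K))"
  have e: "0 < e" "e * K \<le> 1 / 2"
    using L(1) by (auto simp: e_def field_simps)
  have subF: "subspace F"
    unfolding F_def by (rule subspace_slice_sum)
  have "norm (L e f - f) \<le> (1 / 2) * norm f" for f
    using L(4)[of e f] e mult_right_mono[OF e(2), of "norm f"] by simp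
  from perturbation_injective(1)[OF L(2) subF this] have "dim F \<le> dim (orbit_tangent (q + e *\<^sub>R p))"
    using L(3)[of e] e(1) by (metis dim_subset image_subsetI less_irrefl)
  also have "\<dots> \<le> dim (orbit_tangent q)"
    using assms(1) by (simp add: max_orbit_dim_def)
  finally have "dim F \<le> dim (orbit_tangent q)" .
  moreover have "orbit_tangent q \<subseteq> F"
    using subspace_0[OF subspace_slice] by (force simp: F_def)
  ultimately have "F = orbit_tangent q"
    using subspace_dim_equal[OF subspace_orbit_tangent subF] by blast
  moreover have slice: "X \<star> p \<in> slice q p"
    using assms by (auto simp: slice_def)
  then have "X \<star> p \<in> F"
    using subspace_0[OF subspace_orbit_tangent] by (force simp: F_def)
  ultimately have "X \<star> p \<in> orbit_tangent q" "X \<star> p \<in> orbit_normal q"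
    using slice_subset_orbit_normal[OF assms(2)] slice by auto
  then show ?thesis
    by (auto simp: orbit_normal_def dest: orthogonal_compD)
qed

text \<open>As \<open>e\<close> tends to 0, the tangent spaces at \<open>r + e *\<^sub>R w\<close>
  converge to \<open>F\<close>, which is orthogonal to \<open>z\<close>. Thus \<open>z\<close> is
  the limit of its normal components at these points, all of which lie in the closed set
  \<open>S\<close>.\<close>

lemma normal_slice_limit:
  assumes S: "subspace S" "\<And>q. q \<in> S \<Longrightarrow> max_orbit_dim q \<Longrightarrow> orbit_normal q \<subseteq> S"
    and r: "r \<in> S" "w \<in> S" and w: "w \<in> orbit_normal r" "max_orbit_dim (r + w)"
    and z: "z \<in> orbit_normal r" "\<And>x. x \<in> slice r w \<Longrightarrow> x \<bullet> z = 0"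
  shows "z \<in> S"
proof -
  define F where "F = {y + x | y x. y \<in> orbit_tangent r \<and> x \<in> slice r w}"
  obtain L K where L: "0 \<le> K" "\<And>e. linear (L e)"
    "\<And>e f. e \<noteq> 0 \<Longrightarrow> f \<in> F \<Longrightarrow> L e f \<in> orbit_tangent (r + e *\<^sub>R w)"
    "\<And>e f. norm (L e f - f) \<le> \<bar>e\<bar> * K * norm f" "orbit_tangent (r + w) \<subseteq> L 1 ` F"
    using slice_perturbation[OF w(1), folded F_def] by metis
  have subF: "subspace F"
    unfolding F_def by (rule subspace_slice_sum)
  have zF: "f \<bullet> z = 0" if "f \<in> F" for f
    using that z orbit_normalD by (auto simp: F_def orbit_tangent_def inner_add_left)
  \<comment> \<open>The point \<open>r + w\<close> has maximal orbit dimension and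
    \<open>L 1\<close> maps \<open>F\<close> onto a set containing its tangent space, so
    \<open>F\<close> has at least that dimension. Injectivity of \<open>L (e n)\<close> then forces
    maximal orbit dimension at each \<open>q n\<close>.\<close>
  have "dim (orbit_tangent (r + w)) \<le> dim (L 1 ` F)"
    by (rule dim_subset[OF L(5)])
  also have "\<dots> \<le> dim F"
    by (rule dim_image_le[OF L(2)])
  finally have dimF: "dim (orbit_tangent (r + w)) \<le> dim F" .
  define e where "e n = 1 / (2 * (1 + K) * (1 + real n))" for n
  have e: "0 < e n" "e n * K \<le> 1 / 2" for n
  proof -
    show "0 < e n"
      using L(1) by (simp add: e_def)
    have "e n * K = (K / (1 + K)) * (1 / (1 + real n)) * (1 / 2)"
      by (simp add: e_def)
    also have "\<dots> \<le> 1 * 1 * (1 / 2)"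
      using L(1) by (intro mult_right_mono mult_mono) auto
    finally show "e n * K \<le> 1 / 2"
      by simp
  qed
  have half: "norm (L (e n) f - f) \<le> (1 / 2) * norm f" for n f
    using L(4)[of "e n" f] e(1)[of n] mult_right_mono[OF e(2)[of n], of "norm f"] by simp
  define q where "q n = r + e n *\<^sub>R w" for n
  define t where "t n = orth_proj (orbit_tangent (q n)) z" for n
  have bound: "norm (t n) \<le> e n * (2 * K * norm z)" and mem: "z - t n \<in> S" for n
  proof -
    have sub: "L (e n) ` F \<subseteq> orbit_tangent (q n)"
      using L(3)[of "e n"] e(1)[of n] by (auto simp: q_def)
    have inj: "dim (L (e n) ` F) = dim F" "norm f \<le> 2 * norm (L (e n) f)" for f
      by (rule perturbation_injective[OF L(2) subF half])+
    have "dim (orbit_tangent x) \<le> dim (orbit_tangent (q n))" for x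
      using dim_subset[OF sub] inj(1) dimF w(2) unfolding max_orbit_dim_def by (metis le_trans)
    then have "max_orbit_dim (q n)"
      by (simp add: max_orbit_dim_def)
    moreover have "q n \<in> S"
      unfolding q_def by (intro subspace_add subspace_scale S(1) r)
    ultimately have "orbit_normal (q n) \<subseteq> S"
      using S(2) by blast
    then show "z - t n \<in> S"
      using orth_proj_exists(2)[OF subspace_orbit_tangent, of z "q n"] by (auto simp: t_def orbit_normal_def)
    have "dim (orbit_tangent (q n)) \<le> dim (L (e n) ` F)"
      using dimF w(2) inj(1) unfolding max_orbit_dim_def by (metis le_trans)
    then have "L (e n) ` F = orbit_tangent (q n)"
      using subspace_dim_equal[OF linear_subspace_image[OF L(2) subF] subspace_orbit_tangent sub] by blast
    moreover have tmem: "t n \<in> orbit_tangent (q n)"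
      unfolding t_def by (rule orth_proj_exists(1)[OF subspace_orbit_tangent])
    ultimately obtain f where f: "f \<in> F" "t n = L (e n) f"
      by auto
    \<comment> \<open>Because \<open>z\<close> is orthogonal to \<open>f\<close>, only the small
      error \<open>L (e n) f - f\<close> contributes; dividing by the norm of \<open>t n\<close>
      leaves a bound proportional to \<open>e n\<close>.\<close>
    have "t n \<bullet> t n = z \<bullet> t n"
      using orth_proj_inner[OF subspace_orbit_tangent tmem, of z] by (simp add: t_def)
    also have "\<dots> = z \<bullet> (L (e n) f - f)"
      using zF[OF f(1)] by (simp add: f(2) inner_diff_right inner_commute)
    also have "\<dots> \<le> norm z * (e n * K * norm f)"
      using L(4)[of "e n" f] e(1)[of n]
      by (intro order_trans[OF norm_cauchy_schwarz] mult_left_mono) auto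
    also have "\<dots> \<le> norm z * (e n * K * (2 * norm (t n)))"
      using inj(2)[of f] e(1)[of n] L(1) by (intro mult_left_mono) (auto simp: f(2))
    finally have "norm (t n) * norm (t n) \<le> (e n * (2 * K * norm z)) * norm (t n)"
      by (simp add: power2_norm_eq_inner[symmetric] power2_eq_square mult_ac)
    then show "norm (t n) \<le> e n * (2 * K * norm z)"
      using e(1)[of n] L(1) by (cases "t n = 0") (auto simp: mult_nonneg_nonneg)
  qed
  have "(\<lambda>n. (1 / (2 * (1 + K))) * (1 / real (Suc n))) \<longlonglongrightarrow> 0"
    using tendsto_mult_right_zero[OF inverse_Suc_tendsto] .
  moreover have "e n = (1 / (2 * (1 + K))) * (1 / real (Suc n))" for n
    by (simp add: e_def)
  ultimately have "e \<longlonglongrightarrow> 0"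
    by (simp add: e_def[abs_def])
  then have "(\<lambda>n. e n * (2 * K * norm z)) \<longlonglongrightarrow> 0"
    by (rule tendsto_mult_left_zero)
  then have "t \<longlonglongrightarrow> 0"
    by (rule Lim_null_comparison[OF always_eventually[OF allI[OF bound]]])
  then have "(\<lambda>n. z - t n) \<longlonglongrightarrow> z - 0"
    by (intro tendsto_intros)
  then show ?thesis
    using closed_sequentially[OF closed_subspace[OF S(1)] mem] by simp
qed

section \<open>Moving points into normal spaces by maximization\<close>

lemma exp_preserves_subspace:
  assumes "subspace S" "\<And>x. x \<in> S \<Longrightarrow> X \<star> x \<in> S" "x \<in> S"
  shows "exp X \<star> x \<in> S"
proof -
  have pow: "X ^ n \<star> x \<in> S" for n
    by (induction n) (use assms in auto)
  have "(\<lambda>n. (X ^ n /\<^sub>R fact n) \<star> x) sums (exp X \<star> x)"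
    by (rule bounded_linear.sums[OF app.bounded_linear_left exp_converges])
  then have lim: "(\<lambda>n. \<Sum>i<n. (X ^ i /\<^sub>R fact i) \<star> x) \<longlonglongrightarrow> exp X \<star> x"
    by (simp add: sums_def)
  have "(\<Sum>i<n. (X ^ i /\<^sub>R fact i) \<star> x) \<in> S" for n
    by (intro subspace_sum assms) (simp add: app.scaleR_left subspace_scale assms pow)
  then show ?thesis
    by (rule closed_sequentially[OF closed_subspace[OF assms(1)] _ lim])
qed

lemma exp_maximum:
  assumes "X \<in> lie" "\<And>t. (exp (t *\<^sub>R X) \<star> x) \<bullet> y \<le> x \<bullet> y"
  shows "(X \<star> y) \<bullet> x = 0"
proof -
  have "(X \<star> x) \<bullet> y = 0"
    using DERIV_local_max[OF inner_exp_has_real_derivative[of X x y], of 1] assms(2) by simp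
  then show ?thesis
    using lie_skew[OF assms(1), of x y] by (simp add: inner_commute)
qed

text \<open>All points of an orbit have the same norm, so the point with the largest inner product
  with \<open>p\<close> is a nearest point to \<open>p\<close>; vanishing of the first variation
  makes it normal.\<close>

lemma orbit_meets_normal_space: "\<exists>h\<in>H. h \<star> q \<in> orbit_normal p"
proof -
  have "continuous_on H (\<lambda>h. (h \<star> q) \<bullet> p)"
    by (intro continuous_intros app.continuous_on)
  then obtain h where h: "h \<in> H" "\<And>k. k \<in> H \<Longrightarrow> (k \<star> q) \<bullet> p \<le> (h \<star> q) \<bullet> p"
    using continuous_attains_sup[OF compact] one_mem by blast
  have "h \<star> q \<in> orbit_normal p"
  proof (rule orbit_normalI)
    fix X assume X: "X \<in> lie"
    show "(X \<star> p) \<bullet> (h \<star> q) = 0"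
    proof (rule exp_maximum[OF X])
      show "(exp (t *\<^sub>R X) \<star> h \<star> q) \<bullet> p \<le> (h \<star> q) \<bullet> p" for t
        using h(2)[OF mult_mem[OF exp_mem[OF X] h(1)]] by simp
    qed
  qed
  with h(1) show ?thesis
    by blast
qed

end

section \<open>The subspace spanned by the distribution and the normal space\<close>

text \<open>By \<open>shape_operator_orb\<close>, \<open>orth_proj (orbit_tangent p) (X \<star> v)\<close> is \<open>- A\<^sub>v (X \<star> p)\<close>, so that the assumption
  \<open>focal\<close> is property \<open>(P\<^sub>E\<^sub>u\<^sub>c)\<close> at \<open>p\<close>.\<close>

locale section_data = orthogonal_group H for H :: "'v::euclidean_space endo set" +
  fixes p :: 'v and D :: "'v set"
  assumes D: "subspace D" "D \<subseteq> orbit_tangent p"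
    and focal: "X \<in> lie \<Longrightarrow> v \<in> orbit_normal p \<Longrightarrow> X \<star> p \<in> D\<^sup>\<bottom> \<Longrightarrow> l \<noteq> 0 \<Longrightarrow>
      orth_proj (orbit_tangent p) (X \<star> v) = - l *\<^sub>R (X \<star> p) \<Longrightarrow>
      \<exists>Y\<in>lie. Y \<star> p = X \<star> p \<and> Y \<star> v = - l *\<^sub>R (X \<star> p)"
    and second_invariant: "X \<in> lie \<Longrightarrow> X \<star> p \<in> D \<Longrightarrow> v \<in> orbit_normal p \<Longrightarrow>
      y \<in> orbit_tangent p \<inter> D\<^sup>\<bottom> \<Longrightarrow> (X \<star> v) \<bullet> y = 0"
    and autoparallel: "X \<in> lie \<Longrightarrow> X \<star> p \<in> D \<Longrightarrow> y \<in> D \<Longrightarrow>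
      z \<in> orbit_tangent p \<inter> D\<^sup>\<bottom> \<Longrightarrow> (X \<star> y) \<bullet> z = 0"
begin

definition E :: "'v set" where "E = orbit_tangent p \<inter> D\<^sup>\<bottom>"

definition \<Sigma> :: "'v set" where "\<Sigma> = E\<^sup>\<bottom>"

lemma subspace_E: "subspace E"
  unfolding E_def by (intro subspace_inter subspace_orbit_tangent subspace_orthogonal_comp)

lemma subspace_\<Sigma>: "subspace \<Sigma>"
  unfolding \<Sigma>_def by (rule subspace_orthogonal_comp)

lemma orbit_normal_subset_\<Sigma>: "orbit_normal p \<subseteq> \<Sigma>"
  by (auto simp: \<Sigma>_def E_def orbit_normal_def intro!: orthogonal_compI dest: orthogonal_compD)

lemma mem_\<Sigma>: "p \<in> \<Sigma>"
  using orbit_normal_subset_\<Sigma> self_mem_orbit_normal by blast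

lemma D_subset_\<Sigma>: "D \<subseteq> \<Sigma>"
  by (auto simp: \<Sigma>_def E_def inner_commute intro!: orthogonal_compI dest: orthogonal_compD)

lemma dim_\<Sigma>: "dim \<Sigma> = dim (orbit_normal p) + dim D"
proof -
  have "E = {y \<in> orbit_tangent p. \<forall>x\<in>D. orthogonal x y}"
    by (auto simp: E_def orthogonal_comp_def)
  then have "dim E + dim D = dim (orbit_tangent p)"
    using dim_subspace_orthogonal_to_vectors[OF D(1) subspace_orbit_tangent D(2)] by simp
  moreover have "dim \<Sigma> + dim E = DIM('v)"
    unfolding \<Sigma>_def by (rule dim_orthogonal_comp[OF subspace_E])
  ultimately show ?thesis
    using dim_orbit_normal[of p] by linarith
qed

lemma orbit_tangent_\<Sigma>: "orbit_tangent p \<inter> \<Sigma> = D"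
proof (intro equalityI subsetI)
  fix x assume x: "x \<in> orbit_tangent p \<inter> \<Sigma>"
  define y where "y = x - orth_proj D x"
  have D': "orth_proj D x \<in> D" "y \<in> D\<^sup>\<bottom>"
    unfolding y_def by (rule orth_proj_exists[OF D(1)])+
  then have "y \<in> E"
    using x D(2) by (auto simp: E_def y_def intro!: subspace_diff subspace_orbit_tangent)
  then have "y \<bullet> x = 0" "y \<bullet> orth_proj D x = 0"
    using x D' by (auto simp: \<Sigma>_def inner_commute dest: orthogonal_compD)
  then have "y \<bullet> y = 0"
    unfolding y_def by (simp add: inner_diff_right)
  then show "x \<in> D"
    using D'(1) by (simp add: y_def)
qed (use D D_subset_\<Sigma> in auto)

lemma \<Sigma>_decomp:
  assumes "x \<in> \<Sigma>"
  shows "orth_proj (orbit_tangent p) x \<in> D" "x - orth_proj (orbit_tangent p) x \<in> orbit_normal p"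
proof -
  show n: "x - orth_proj (orbit_tangent p) x \<in> orbit_normal p"
    unfolding orbit_normal_def by (rule orth_proj_exists(2)[OF subspace_orbit_tangent])
  then have "x - orth_proj (orbit_tangent p) x \<in> \<Sigma>"
    using orbit_normal_subset_\<Sigma> by blast
  then have "x - (x - orth_proj (orbit_tangent p) x) \<in> \<Sigma>"
    by (rule subspace_diff[OF subspace_\<Sigma> assms])
  then show "orth_proj (orbit_tangent p) x \<in> D"
    using orth_proj_exists(1)[OF subspace_orbit_tangent, of p x] orbit_tangent_\<Sigma> by auto
qed

lemma lie_preserves_\<Sigma>:
  assumes "X \<in> lie" "X \<star> p \<in> D" "x \<in> \<Sigma>"
  shows "X \<star> x \<in> \<Sigma>"
  unfolding \<Sigma>_def
proof (rule orthogonal_compI)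
  fix z assume z: "z \<in> E"
  have "X \<star> x = X \<star> orth_proj (orbit_tangent p) x + X \<star> (x - orth_proj (orbit_tangent p) x)"
    by (simp flip: app.add_right)
  then show "z \<bullet> (X \<star> x) = 0"
    using autoparallel[OF assms(1,2) \<Sigma>_decomp(1)[OF assms(3)]]
      second_invariant[OF assms(1,2) \<Sigma>_decomp(2)[OF assms(3)]] z
    by (simp add: E_def inner_add_right inner_commute[of z])
qed

text \<open>Here \<open>a\<close> is minus the shape operator in direction \<open>v\<close> on
  \<open>E\<close>. A lift of \<open>u\<close> normally gives \<open>a u\<close> only after
  tangential projection; \<open>focal\<close> supplies lifts for which the equation is exact, first
  on eigenvectors and then, by linearity, on all of \<open>E\<close>.\<close>

lemma focal_lift:
  assumes v: "v \<in> orbit_normal p"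
  obtains a where "linear a" "\<And>u. u \<in> E \<Longrightarrow> a u \<in> E"
    "\<And>u. u \<in> E \<Longrightarrow> \<exists>Y\<in>lie. Y \<star> p = u \<and> Y \<star> v = a u"
proof -
  obtain s where s: "linear s" "\<And>y. y \<in> orbit_tangent p \<Longrightarrow> s y \<in> lie" "\<And>y. y \<in> orbit_tangent p \<Longrightarrow> s y \<star> p = y"
    using lie_section[of p] by blast
  define a where "a x = orth_proj (orbit_tangent p) (s x \<star> v)" for x
  have lin: "linear a"
    using linear_compose[OF linear_compose[OF s(1) linear_app_left] linear_orth_proj[OF subspace_orbit_tangent], of p v]
    by (simp add: o_def a_def[abs_def])
  have inner_a: "a x \<bullet> y = (s x \<star> v) \<bullet> y" if "y \<in> orbit_tangent p" for x y
    unfolding a_def by (rule orth_proj_inner[OF subspace_orbit_tangent that])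
  have sym: "a x \<bullet> y = x \<bullet> a y" if "x \<in> orbit_tangent p" "y \<in> orbit_tangent p" for x y
    using normal_symmetric[OF v s(2)[OF that(1)] s(2)[OF that(2)]]
    by (simp add: that s inner_a inner_commute[of x])
  have inv: "a x \<in> E" if "x \<in> E" for x
  proof -
    have x: "x \<in> orbit_tangent p"
      using that by (simp add: E_def)
    have "a x \<in> orbit_tangent p"
      unfolding a_def by (rule orth_proj_exists(1)[OF subspace_orbit_tangent])
    moreover have "a x \<in> D\<^sup>\<bottom>"
    proof (rule orthogonal_compI)
      fix y assume y: "y \<in> D"
      then have "y \<in> orbit_tangent p"
        using D by blast
      then show "y \<bullet> a x = 0"
        using sym[OF _ x, of y] inner_a[OF x, of y] second_invariant[OF s(2) _ v, of y x] s(3)[of y] y that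
        by (simp add: E_def)
    qed
    ultimately show ?thesis
      by (simp add: E_def)
  qed
  \<comment> \<open>This set does not refer to eigenvectors and is a subspace, so it is enough that
    it contains an eigenbasis.\<close>
  define L where "L = {u \<in> E. \<exists>Y\<in>lie. Y \<star> p = u \<and> Y \<star> v = a u}"
  have "subspace L"
    unfolding subspace_def
  proof (intro conjI ballI allI)
    show "0 \<in> L"
      using subspace_0[OF subspace_lie] subspace_0[OF subspace_E]
      by (auto simp: L_def linear_0[OF lin] intro!: bexI[of _ 0])
    fix x y :: 'v and r :: real
    assume "x \<in> L"
    then obtain X where X: "x \<in> E" "X \<in> lie" "X \<star> p = x" "X \<star> v = a x"
      by (auto simp: L_def)
    then show "r *\<^sub>R x \<in> L"
      by (auto simp: L_def linear_scale[OF lin] app.scaleR_left subspace_scale[OF subspace_E]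
          intro!: bexI[of _ "r *\<^sub>R X"] lie_scaleR)
    assume "y \<in> L"
    then obtain Y where "y \<in> E" "Y \<in> lie" "Y \<star> p = y" "Y \<star> v = a y"
      by (auto simp: L_def)
    with X show "x + y \<in> L"
      by (auto simp: L_def linear_add[OF lin] app.add_left subspace_add[OF subspace_E]
          intro!: bexI[of _ "X + Y"] lie_add)
  qed
  moreover have "{u \<in> E. \<exists>l. a u = l *\<^sub>R u} \<subseteq> L"
  proof safe
    fix u l assume u: "u \<in> E" "a u = l *\<^sub>R u"
    then have uT: "u \<in> orbit_tangent p" "u \<in> D\<^sup>\<bottom>"
      by (auto simp: E_def)
    note su = s(2)[OF uT(1)] s(3)[OF uT(1)]
    have "\<exists>Y\<in>lie. Y \<star> p = u \<and> Y \<star> v = l *\<^sub>R u"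
    proof (cases "l = 0")
      case False
      \<comment> \<open>\<open>focal\<close> uses the eigenvalue of the shape operator, whose sign
        is opposite to that of \<open>a\<close>.\<close>
      then show ?thesis
        using focal[OF su(1) v, of "- l"] u(2) uT(2) su(2) by (simp add: a_def)
    next
      case True
      \<comment> \<open>The position vector is normal with \<open>A\<^sub>p = - id\<close>, so subtracting it from \<open>v\<close> moves the
        eigenvalue away from 0.\<close>
      have "orth_proj (orbit_tangent p) (s u \<star> (v - p)) = a u - u"
        using su uT by (simp add: app.diff_right linear_diff[OF linear_orth_proj[OF subspace_orbit_tangent]]
            a_def orth_proj_mem subspace_orbit_tangent)
      then have "\<exists>Y\<in>lie. Y \<star> p = u \<and> Y \<star> (v - p) = - u"
        using focal[OF su(1) subspace_diff[OF subspace_orbit_normal v self_mem_orbit_normal], of 1] u(2) uT(2) su(2) True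
        by simp
      then show ?thesis
        using True by (auto simp: app.diff_right)
    qed
    then show "u \<in> L"
      using u by (simp add: L_def)
  qed
  ultimately have "span {u \<in> E. \<exists>l. a u = l *\<^sub>R u} \<subseteq> L"
    by (intro span_minimal)
  moreover have "E \<subseteq> span {u \<in> E. \<exists>l. a u = l *\<^sub>R u}"
    by (rule symmetric_span_eigenvectors[OF lin subspace_E inv]) (auto simp: E_def sym)
  ultimately have "E \<subseteq> L"
    by blast
  then show thesis
    by (intro that[OF lin inv]) (auto simp: L_def)
qed

text \<open>If \<open>a u = 0\<close>, the lift \<open>Y\<close> kills \<open>q\<close>; as
  \<open>p\<close> is normal at \<open>q\<close>, maximal orbit dimension gives
  \<open>u = Y \<star> p = 0\<close>. Hence \<open>a\<close> is onto \<open>E\<close>, and every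
  \<open>a u\<close> is of the form \<open>Y \<star> q\<close>.\<close>

lemma orbit_normal_subset_\<Sigma>_normal:
  assumes "max_orbit_dim q" "q \<in> orbit_normal p"
  shows "orbit_normal q \<subseteq> \<Sigma>"
proof -
  obtain a where a: "linear a" "\<And>u. u \<in> E \<Longrightarrow> a u \<in> E"
    "\<And>u. u \<in> E \<Longrightarrow> \<exists>Y\<in>lie. Y \<star> p = u \<and> Y \<star> q = a u"
    using focal_lift[OF assms(2)] by blast
  have ker: "u = 0" if "u \<in> E" "a u = 0" for u
    using a(3)[OF that(1)] that(2) max_orbit_dim_isotropy_normal[OF assms(1) orbit_normal_sym[OF assms(2)]] by auto
  have "inj_on a (span E)"
    using ker linear_injective_on_subspace_0[OF a(1) subspace_E]
    by (simp add: span_eq_iff[THEN iffD2, OF subspace_E])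
  then have "dim (a ` E) = dim E"
    by (rule dim_image_eq[OF a(1)])
  then have "a ` E = E"
    using subspace_dim_equal[OF linear_subspace_image[OF a(1) subspace_E] subspace_E] a(2) by auto
  moreover have "a ` E \<subseteq> orbit_tangent q"
  proof safe
    fix u assume "u \<in> E"
    then obtain Y where "Y \<in> lie" "Y \<star> q = a u"
      using a(3) by blast
    then show "a u \<in> orbit_tangent q"
      using orbit_tangentI[of Y q] by simp
  qed
  ultimately have "E \<subseteq> orbit_tangent q"
    by simp
  then show ?thesis
    unfolding \<Sigma>_def orbit_normal_def by (rule orthogonal_comp_anti_mono)
qed

text \<open>Reduction to a point normal at \<open>p\<close>. Maximizing over elements that preserve
  \<Sigma> yields orthogonality to \<open>D\<close> only, but the tangential part of a vector in
  \<Sigma> already lies in \<open>D\<close>.\<close>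

lemma orbit_normal_subset_\<Sigma>_max_orbit_dim:
  assumes "max_orbit_dim q" "q \<in> \<Sigma>"
  shows "orbit_normal q \<subseteq> \<Sigma>"
proof -
  \<comment> \<open>Unlike the subgroup generated by the exponentials of those \<open>X\<close>,
    this set is visibly closed; it still contains what the variation uses.\<close>
  define K where "K = {h \<in> H. \<forall>x\<in>\<Sigma>. h \<star> x \<in> \<Sigma>}"
  have "closed {h. h \<star> x \<in> \<Sigma>}" for x
    using closed_vimage[OF closed_subspace[OF subspace_\<Sigma>], of "\<lambda>h. h \<star> x"]
    by (simp add: vimage_def continuous_intros app.continuous_on)
  then have "compact (H \<inter> (\<Inter>x\<in>\<Sigma>. {h. h \<star> x \<in> \<Sigma>}))"
    by (intro compact_Int_closed compact closed_INT) auto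
  moreover have "H \<inter> (\<Inter>x\<in>\<Sigma>. {h. h \<star> x \<in> \<Sigma>}) = K"
    by (auto simp: K_def)
  ultimately have "compact K"
    by simp
  moreover have "1 \<in> K"
    by (simp add: K_def one_mem)
  moreover have "continuous_on K (\<lambda>h. (h \<star> q) \<bullet> p)"
    by (intro continuous_intros app.continuous_on)
  ultimately obtain k where k: "k \<in> K" "\<And>h. h \<in> K \<Longrightarrow> (h \<star> q) \<bullet> p \<le> (k \<star> q) \<bullet> p"
    using continuous_attains_sup[of K] by blast
  have kS: "k \<star> x \<in> \<Sigma>" if "x \<in> \<Sigma>" for x
    using k(1) that by (auto simp: K_def)
  have kH: "k \<in> H"
    using k(1) by (simp add: K_def)
  have orthD: "(X \<star> p) \<bullet> (k \<star> q) = 0" if X: "X \<in> lie" "X \<star> p \<in> D" for X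
  proof (rule exp_maximum[OF X(1)])
    fix t
    have tX: "t *\<^sub>R X \<in> lie" "(t *\<^sub>R X) \<star> p \<in> D"
      using X D(1) by (auto simp: lie_scaleR app.scaleR_left subspace_scale)
    have "exp (t *\<^sub>R X) \<star> x \<in> \<Sigma>" if "x \<in> \<Sigma>" for x
      using exp_preserves_subspace[OF subspace_\<Sigma> lie_preserves_\<Sigma>[OF tX] that] .
    then have "exp (t *\<^sub>R X) * k \<in> K"
      using kS kH exp_mem[OF X(1)] by (auto simp: K_def mult_mem)
    from k(2)[OF this] show "(exp (t *\<^sub>R X) \<star> k \<star> q) \<bullet> p \<le> (k \<star> q) \<bullet> p"
      by simp
  qed
  have kq: "k \<star> q \<in> \<Sigma>"
    by (rule kS[OF assms(2)])
  have "orth_proj (orbit_tangent p) (k \<star> q) = 0"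
  proof -
    define d where "d = orth_proj (orbit_tangent p) (k \<star> q)"
    have d: "d \<in> D"
      unfolding d_def by (rule \<Sigma>_decomp[OF kq])
    then obtain X where X: "X \<in> lie" "X \<star> p = d"
      using D(2) by (auto simp: orbit_tangent_def)
    have "(k \<star> q) \<bullet> d = 0"
      using orthD[OF X(1)] X d by (simp add: inner_commute)
    then have "d \<bullet> d = 0"
      using orth_proj_inner[OF subspace_orbit_tangent, of d p "k \<star> q"] d D(2) by (auto simp: d_def)
    then show ?thesis
      by (simp add: d_def)
  qed
  then have "k \<star> q \<in> orbit_normal p"
    using \<Sigma>_decomp(2)[OF kq] by simp
  then have sub: "orbit_normal (k \<star> q) \<subseteq> \<Sigma>"
    using orbit_normal_subset_\<Sigma>_normal assms(1) kH by (simp add: max_orbit_dim_app)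
  \<comment> \<open>The inclusion obtained at \<open>k \<star> q\<close> has to be pulled back to
    \<open>q\<close>, for which \<open>k\<close> must map \<Sigma> onto itself.\<close>
  have "(\<star>) k ` \<Sigma> = \<Sigma>"
    using kS by (intro subspace_dim_equal linear_subspace_image linear_app subspace_\<Sigma>) (auto simp: dim_app kH)
  show ?thesis
  proof
    fix x assume "x \<in> orbit_normal q"
    then have "k \<star> x \<in> \<Sigma>"
      using sub by (auto simp: orbit_normal_app kH)
    then obtain y where "y \<in> \<Sigma>" "k \<star> x = k \<star> y"
      using \<open>(\<star>) k ` \<Sigma> = \<Sigma>\<close> by blast
    then show "x \<in> \<Sigma>"
      using app_inj[OF kH] by (auto simp: inj_def)
  qed
qed

end

context orthogonal_group
begin

text \<open>The hypothesis \<open>eig\<close> says that the Jacobi field with initial value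
  \<open>Z \<star> q\<close> and initial derivative the tangential part of
  \<open>Z \<star> v\<close> vanishes at \<open>t\<close>. The conclusion replaces \<open>Z\<close>
  by a generator whose full action vanishes at the focal point.\<close>

lemma max_orbit_dim_focal:
  assumes S: "subspace S" "\<And>q. q \<in> S \<Longrightarrow> max_orbit_dim q \<Longrightarrow> orbit_normal q \<subseteq> S"
    and q: "q \<in> S" "max_orbit_dim q" and v: "v \<in> orbit_normal q" and Z: "Z \<in> lie" "Z \<star> q \<in> S\<^sup>\<bottom>"
    and eig: "t *\<^sub>R orth_proj (orbit_tangent q) (Z \<star> v) = - (Z \<star> q)"
  shows "\<exists>X\<in>lie. X \<star> q = Z \<star> q \<and> X \<star> (q + t *\<^sub>R v) = 0"
proof -
  define r where "r = q + t *\<^sub>R v"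
  define w where "w = - t *\<^sub>R v"
  define u where "u = Z \<star> q"
  have rw: "r + w = q"
    by (simp add: r_def w_def)
  have mem: "r \<in> S" "w \<in> S"
    using S q v by (auto simp: r_def w_def intro!: subspace_add subspace_scale subspace_neg)
  have "v \<in> orbit_normal r"
  proof (rule orbit_normalI)
    fix X assume X: "X \<in> lie"
    have "(X \<star> v) \<bullet> v = 0"
      using orbit_normalD[OF self_mem_orbit_normal X] .
    then show "(X \<star> r) \<bullet> v = 0"
      using orbit_normalD[OF v X] by (simp add: r_def app.add_right app.scaleR_right inner_add_left)
  qed
  then have w: "w \<in> orbit_normal r"
    unfolding w_def by (intro subspace_scale subspace_orbit_normal)
  have u: "u \<in> orbit_normal r"
  proof (rule orbit_normalI)
    fix X assume X: "X \<in> lie"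
    \<comment> \<open>The symmetry of the shape operator exchanges \<open>X\<close> and
      \<open>Z\<close>, after which \<open>eig\<close> cancels the term from
      \<open>X \<star> q\<close>.\<close>
    have "t * ((X \<star> v) \<bullet> u) = t * ((Z \<star> v) \<bullet> (X \<star> q))"
      using normal_symmetric[OF v X Z(1)] by (simp add: u_def)
    also have "\<dots> = (t *\<^sub>R orth_proj (orbit_tangent q) (Z \<star> v)) \<bullet> (X \<star> q)"
      using orth_proj_inner[OF subspace_orbit_tangent orbit_tangentI[OF X]] by simp
    also have "\<dots> = - (X \<star> q) \<bullet> u"
      by (simp add: eig u_def inner_commute)
    finally show "(X \<star> r) \<bullet> u = 0"
      by (simp add: r_def app.add_right app.scaleR_right inner_add_left)
  qed
  define z where "z = u - orth_proj (slice r w) u"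
  have P: "orth_proj (slice r w) u \<in> slice r w" "u - orth_proj (slice r w) u \<in> (slice r w)\<^sup>\<bottom>"
    by (rule orth_proj_exists[OF subspace_slice])+
  have "z \<in> S"
  proof (rule normal_slice_limit[OF S mem w])
    show "max_orbit_dim (r + w)"
      by (simp add: rw q)
    show "z \<in> orbit_normal r"
      unfolding z_def using slice_subset_orbit_normal[OF w] P(1) by (intro subspace_diff subspace_orbit_normal u) auto
    show "x \<bullet> z = 0" if "x \<in> slice r w" for x
      using P(2) that by (auto simp: z_def dest: orthogonal_compD)
  qed
  \<comment> \<open>\<open>z\<close> lies in \<open>S\<close> and is orthogonal to \<open>u\<close>
    as well as to the slice part of \<open>u\<close>, hence to their difference, which is
    \<open>z\<close> itself.\<close>
  then have "z \<bullet> u = 0"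
    using Z(2) by (auto simp: u_def dest: orthogonal_compD)
  moreover have "z \<bullet> orth_proj (slice r w) u = 0"
    using orthogonal_compD[OF P(2) P(1)] by (simp add: z_def inner_commute)
  ultimately have "z \<bullet> z = 0"
    by (metis z_def inner_diff_right diff_zero)
  then have "u \<in> slice r w"
    using P(1) by (simp add: z_def)
  then obtain X where X: "X \<in> lie" "X \<star> r = 0" "u = X \<star> w"
    by (auto simp: slice_def)
  have "X \<star> q = u"
    using X by (simp add: app.add_right flip: rw)
  with X show ?thesis
    by (auto simp: u_def r_def)
qed

section \<open>The smallest subspace containing the normal spaces at its regular points\<close>

definition normal_closed :: "'v set \<Rightarrow> bool" where
  "normal_closed S \<longleftrightarrow> subspace S \<and> (\<forall>q\<in>S. regular q \<longrightarrow> orbit_normal q \<subseteq> S)"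

definition normal_hull :: "'v \<Rightarrow> 'v set" where
  "normal_hull p = \<Inter>{S. normal_closed S \<and> p \<in> S}"

lemma normal_closed_normal_hull: "normal_closed (normal_hull p)"
  unfolding normal_closed_def normal_hull_def by (intro conjI subspace_Inter) auto

lemma mem_normal_hull: "p \<in> normal_hull p"
  by (simp add: normal_hull_def)

lemma normal_hull_least: "normal_closed S \<Longrightarrow> p \<in> S \<Longrightarrow> normal_hull p \<subseteq> S"
  by (auto simp: normal_hull_def)

lemma subspace_normal_hull: "subspace (normal_hull p)"
  using normal_closed_normal_hull by (simp add: normal_closed_def)

lemma orbit_normal_subset_normal_hull: "regular q \<Longrightarrow> q \<in> normal_hull p \<Longrightarrow> orbit_normal q \<subseteq> normal_hull p"
  using normal_closed_normal_hull by (simp add: normal_closed_def)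

lemma normal_closed_app:
  assumes "g \<in> H" "normal_closed S"
  shows "normal_closed ((\<star>) g ` S)"
  unfolding normal_closed_def
proof (intro conjI ballI impI)
  show "subspace ((\<star>) g ` S)"
    using assms(2) by (simp add: normal_closed_def linear_subspace_image)
  fix q assume "q \<in> (\<star>) g ` S" and q: "regular q"
  then obtain x where x: "x \<in> S" "q = g \<star> x"
    by blast
  obtain h where h: "h \<in> H" "\<And>x. h \<star> g \<star> x = x"
    using inverse_app[OF assms(1)] by blast
  have "regular x"
    using regular_app[OF h(1) q] by (simp add: x h)
  with assms x show "orbit_normal q \<subseteq> (\<star>) g ` S"
    by (auto simp: normal_closed_def orbit_normal_app)
qed

lemma normal_hull_app:
  assumes "g \<in> H"
  shows "normal_hull (g \<star> p) = (\<star>) g ` normal_hull p"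
proof -
  obtain h where h: "h \<in> H" "\<And>x. h \<star> g \<star> x = x" "\<And>x. g \<star> h \<star> x = x"
    using inverse_app[OF assms] by blast
  have sub: "normal_hull (g \<star> p) \<subseteq> (\<star>) g ` normal_hull p" if "g \<in> H" for g p
    using that by (intro normal_hull_least normal_closed_app normal_closed_normal_hull imageI mem_normal_hull)
  have "(\<star>) g ` normal_hull p \<subseteq> normal_hull (g \<star> p)"
  proof safe
    fix x assume "x \<in> normal_hull p"
    then have "x \<in> (\<star>) h ` normal_hull (g \<star> p)"
      using sub[OF h(1), of "g \<star> p"] by (auto simp: h)
    then show "g \<star> x \<in> normal_hull (g \<star> p)"
      by (auto simp: h)
  qed
  with sub[OF assms] show ?thesis
    by blast
qed

text \<open>Some \<open>h\<close> moves \<open>p\<close> into the normal space at \<open>q\<close>,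
  so the hull of \<open>h \<star> p\<close> lies in that of \<open>q\<close>, which lies in that of
  \<open>p\<close>. By equivariance the two ends have equal dimension, and the chain
  collapses.\<close>

lemma normal_hull_eq:
  assumes "regular q" "q \<in> normal_hull p"
  shows "normal_hull q = normal_hull p"
proof -
  have 1: "normal_hull q \<subseteq> normal_hull p"
    by (rule normal_hull_least[OF normal_closed_normal_hull assms(2)])
  obtain h where h: "h \<in> H" "h \<star> p \<in> orbit_normal q"
    using orbit_meets_normal_space by blast
  then have 2: "normal_hull (h \<star> p) \<subseteq> normal_hull q"
    using orbit_normal_subset_normal_hull[OF assms(1) mem_normal_hull] by (intro normal_hull_least[OF normal_closed_normal_hull]) auto
  have "dim (normal_hull (h \<star> p)) = dim (normal_hull p)"
    by (simp add: normal_hull_app h dim_app)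
  then have "normal_hull (h \<star> p) = normal_hull p"
    using subspace_dim_equal[OF subspace_normal_hull subspace_normal_hull, of "h \<star> p" p] 1 2 by auto
  with 1 2 show ?thesis
    by blast
qed

text \<open>This is (C4): \<open>q\<close> and \<open>g \<star> q\<close> generate the same hull,
  and forming the hull is equivariant.\<close>

lemma normal_hull_conj:
  assumes "regular q" "q \<in> normal_hull p" "g \<in> H" "g \<star> q \<in> normal_hull p"
  shows "(\<star>) g ` normal_hull p = normal_hull p"
  using normal_hull_eq[OF assms(1,2)] normal_hull_eq[OF regular_app[OF assms(3,1)] assms(4)] normal_hull_app[OF assms(3)]
  by metis

end

section \<open>Representations of compact groups\<close>

locale compact_representation =
  fixes G :: "('g, 'm) monoid_scheme" and X :: "'g topology" and \<rho> :: "'g \<Rightarrow> 'v::euclidean_space \<Rightarrow> 'v"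
  assumes topspace: "topspace X = carrier G" and compact_space: "compact_space X"
    and rep: "orthogonal_representation G X \<rho>"
begin

definition H :: "'v endo set" where "H = (\<lambda>g. endo (\<rho> g)) ` carrier G"

lemma action: "group_action G UNIV \<rho>"
  using rep by (simp add: orthogonal_representation_def)

lemma group: "group G"
  using action group_action.group_hom group_hom.axioms(1) by blast

lemma orthogonal: "g \<in> carrier G \<Longrightarrow> orthogonal_transformation (\<rho> g)"
  using rep by (simp add: orthogonal_representation_def)

lemma app_rep [simp]: "g \<in> carrier G \<Longrightarrow> endo (\<rho> g) \<star> x = \<rho> g x"
  by (rule app_endo) (simp add: orthogonal orthogonal_transformation_linear)

lemma rep_one: "\<rho> \<one>\<^bsub>G\<^esub> x = x"
  using group_action.id_eq_one[OF action] by (metis UNIV_I restrict_apply')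

lemma rep_mult: "g \<in> carrier G \<Longrightarrow> h \<in> carrier G \<Longrightarrow> \<rho> (g \<otimes>\<^bsub>G\<^esub> h) x = \<rho> g (\<rho> h x)"
  by (rule group_action.composition_rule[OF action]) auto

lemma rep_inv: "g \<in> carrier G \<Longrightarrow> \<rho> (inv\<^bsub>G\<^esub> g) (\<rho> g x) = x" "g \<in> carrier G \<Longrightarrow> \<rho> g (\<rho> (inv\<^bsub>G\<^esub> g) x) = x"
  using rep_mult[of "inv\<^bsub>G\<^esub> g" g x] rep_mult[of g "inv\<^bsub>G\<^esub> g" x] group
  by (simp_all add: group.inv_closed group.l_inv group.r_inv rep_one)

lemma inv_closed: "g \<in> carrier G \<Longrightarrow> inv\<^bsub>G\<^esub> g \<in> carrier G"
  using group by (rule group.inv_closed)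

lemma compact_H: "compact H"
proof -
  \<comment> \<open>Rank-one maps: summing \<open>M b (\<rho> g b)\<close> over the basis recovers
    \<open>endo (\<rho> g)\<close>, which upgrades pointwise continuity of the representation to
    continuity in the operator norm.\<close>
  define M :: "'v \<Rightarrow> 'v \<Rightarrow> 'v endo" where "M b v = endo (\<lambda>x. (x \<bullet> b) *\<^sub>R v)" for b v
  have lin: "linear (\<lambda>x. (x \<bullet> b) *\<^sub>R v)" for b v :: 'v
    by (rule linearI) (simp_all add: inner_add_left scaleR_add_left)
  have M: "M b v \<star> x = (x \<bullet> b) *\<^sub>R v" for b v x
    unfolding M_def by (rule app_endo[OF lin])
  have "linear (M b)" for b
    by (rule linearI; rule endo_eqI; simp add: M app.add_left app.scaleR_left scaleR_add_right)
  then have contM: "continuous_on UNIV (M b)" for b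
    using linear_continuous_on linear_conv_bounded_linear by blast
  have eq: "(\<Sum>b\<in>Basis. M b (\<rho> g b)) = endo (\<rho> g)" if g: "g \<in> carrier G" for g
  proof (rule endo_eqI)
    fix x
    have "(\<Sum>b\<in>Basis. M b (\<rho> g b)) \<star> x = (\<Sum>b\<in>Basis. (x \<bullet> b) *\<^sub>R \<rho> g b)"
      by (simp add: app.sum_left M)
    also have "\<dots> = \<rho> g (\<Sum>b\<in>Basis. (x \<bullet> b) *\<^sub>R b)"
      using orthogonal_transformation_linear[OF orthogonal[OF g]] by (simp add: linear_sum linear_scale)
    finally show "(\<Sum>b\<in>Basis. M b (\<rho> g b)) \<star> x = endo (\<rho> g) \<star> x"
      using g by (simp add: euclidean_representation)
  qed
  have "continuous_map X euclidean (\<lambda>g. \<Sum>b\<in>Basis. M b (\<rho> g b))"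
  proof (intro continuous_map_sum finite_Basis)
    fix b :: 'v
    have "continuous_map X euclidean (\<lambda>g. \<rho> g b)"
      using rep by (simp add: orthogonal_representation_def)
    moreover have "continuous_map euclidean euclidean (M b)"
      using contM by simp
    ultimately have "continuous_map X euclidean (M b \<circ> (\<lambda>g. \<rho> g b))"
      by (rule continuous_map_compose)
    then show "continuous_map X euclidean (\<lambda>g. M b (\<rho> g b))"
      by (simp add: o_def)
  qed
  then have "continuous_map X euclidean (\<lambda>g. endo (\<rho> g))"
    by (rule continuous_map_eq) (simp add: topspace eq)
  then have "compactin euclidean ((\<lambda>g. endo (\<rho> g)) ` topspace X)"
    using compact_space image_compactin unfolding compact_space_def by blast
  then show ?thesis
    by (simp add: H_def topspace)
qed

sublocale orthogonal_group H
proof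
  show "compact H"
    by (rule compact_H)
  have "endo (\<rho> \<one>\<^bsub>G\<^esub>) = 1"
    by (rule endo_eqI) (simp add: rep_one group.is_monoid[OF group] monoid.one_closed)
  then show "1 \<in> H"
    unfolding H_def using group.is_monoid[OF group] monoid.one_closed by force
next
  fix g h assume "g \<in> H" "h \<in> H"
  then obtain a b where ab: "a \<in> carrier G" "b \<in> carrier G" "g = endo (\<rho> a)" "h = endo (\<rho> b)"
    by (auto simp: H_def)
  then have c: "a \<otimes>\<^bsub>G\<^esub> b \<in> carrier G"
    using group.is_monoid[OF group] by (simp add: monoid.m_closed)
  have "g * h = endo (\<rho> (a \<otimes>\<^bsub>G\<^esub> b))"
    by (rule endo_eqI) (simp add: ab c rep_mult)
  with c show "g * h \<in> H"
    by (auto simp: H_def)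
next
  fix g assume "g \<in> H"
  then obtain a where a: "a \<in> carrier G" "g = endo (\<rho> a)"
    by (auto simp: H_def)
  have "g * endo (\<rho> (inv\<^bsub>G\<^esub> a)) = 1" "endo (\<rho> (inv\<^bsub>G\<^esub> a)) * g = 1"
    by (rule endo_eqI; simp add: a inv_closed rep_inv)+
  with a show "\<exists>h\<in>H. g * h = 1 \<and> h * g = 1"
    unfolding H_def using inv_closed by blast
next
  fix g and x y :: 'v assume "g \<in> H"
  then show "(g \<star> x) \<bullet> (g \<star> y) = x \<bullet> y"
    using orthogonal by (auto simp: H_def orthogonal_transformation_def)
qed

lemma rep_mem: "g \<in> carrier G \<Longrightarrow> endo (\<rho> g) \<in> H"
  by (simp add: H_def)

lemma orbit_eq: "orbit G \<rho> p = orb p"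
  unfolding orbit_def orb_def unfolding H_def by force

lemma isotropy_orbit_eq: "isotropy_orbit G \<rho> q p = (\<lambda>h. h \<star> p) ` stab q"
  unfolding isotropy_orbit_def stabilizer_def stab_def unfolding H_def by force

lemma regular_point_iff: "regular_point G \<rho> p \<longleftrightarrow> regular p"
proof -
  have *: "\<rho> (inv\<^bsub>G\<^esub> h \<otimes>\<^bsub>G\<^esub> g \<otimes>\<^bsub>G\<^esub> h) q = q \<longleftrightarrow> \<rho> g (\<rho> h q) = \<rho> h q"
    if "g \<in> carrier G" "h \<in> carrier G" for g h q
  proof -
    have "\<rho> (inv\<^bsub>G\<^esub> h \<otimes>\<^bsub>G\<^esub> g \<otimes>\<^bsub>G\<^esub> h) q = \<rho> (inv\<^bsub>G\<^esub> h) (\<rho> g (\<rho> h q))"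
      using that group.is_monoid[OF group] by (simp add: rep_mult inv_closed monoid.m_closed)
    then show ?thesis
      using that rep_inv by metis
  qed
  have "(\<lambda>g. inv\<^bsub>G\<^esub> h \<otimes>\<^bsub>G\<^esub> g \<otimes>\<^bsub>G\<^esub> h) ` stabilizer G \<rho> p \<subseteq> stabilizer G \<rho> q \<longleftrightarrow>
      (\<forall>g\<in>carrier G. \<rho> g p = p \<longrightarrow> \<rho> g (\<rho> h q) = \<rho> h q)" if h: "h \<in> carrier G" for h q
    using * h group.is_monoid[OF group]
    by (auto simp: stabilizer_def inv_closed monoid.m_closed)
  then show ?thesis
    unfolding regular_point_def regular_def unfolding H_def by simp
qed

lemma induced_Killing_field_lie:
  assumes "Y \<in> lie"
  shows "induced_Killing_field G \<rho> ((\<star>) Y)"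
  unfolding induced_Killing_field_def
proof (intro exI[of _ "\<lambda>t x. exp (t *\<^sub>R Y) \<star> x"] conjI allI)
  fix s t :: real
  have "exp (t *\<^sub>R Y) \<in> H"
    by (rule exp_mem[OF assms])
  then obtain g where g: "g \<in> carrier G" "exp (t *\<^sub>R Y) = endo (\<rho> g)"
    by (auto simp: H_def)
  then have "(\<lambda>x. exp (t *\<^sub>R Y) \<star> x) = \<rho> g"
    by auto
  with g(1) show "(\<lambda>x. exp (t *\<^sub>R Y) \<star> x) \<in> \<rho> ` carrier G"
    by blast
  have "exp ((s + t) *\<^sub>R Y) = exp (s *\<^sub>R Y) * exp (t *\<^sub>R Y)"
    unfolding scaleR_add_left by (rule exp_add_commuting) simp
  then show "(\<lambda>x. exp ((s + t) *\<^sub>R Y) \<star> x) = (\<lambda>x. exp (s *\<^sub>R Y) \<star> x) \<circ> (\<lambda>x. exp (t *\<^sub>R Y) \<star> x)"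
    by (simp add: fun_eq_iff)
  show "((\<lambda>t. exp (t *\<^sub>R Y) \<star> q) has_vector_derivative Y \<star> q) (at 0)" for q
    using exp_app_has_vector_derivative[of Y q 0] by simp
qed (simp add: fun_eq_iff)

section \<open>Minimal sections and copolarity\<close>

lemma k_section_normal_hull:
  assumes p: "regular p" and k: "dim (normal_hull p) = dim (orbit_normal p) + k"
  shows "k_section G \<rho> k (normal_hull p)"
  unfolding k_section_def regular_point_iff orbit_eq
proof (intro conjI ballI impI allI)
  note sub = subspace_normal_hull[of p]
  show "connected (normal_hull p)"
    by (rule convex_connected[OF subspace_imp_convex[OF sub]])
  show "\<exists>d. submanifold d (normal_hull p)"
    using submanifold_subspace[OF sub] by blast
  show "geodesically_complete (normal_hull p)" "totally_geodesic (normal_hull p)"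
    by (rule geodesically_complete_subspace[OF sub], rule totally_geodesic_subspace[OF sub])
  show "orb q \<inter> normal_hull p \<noteq> {}" for q
    using orbit_meets_normal_space[of q p] orbit_normal_subset_normal_hull[OF p mem_normal_hull] by (auto simp: orb_def)
  fix q assume q: "q \<in> normal_hull p" "regular q"
  show "normal_space (orb q) q \<subseteq> tangent_space (normal_hull p) q"
    using orbit_normal_subset_normal_hull[OF q(2,1)] by (simp add: normal_space_orb orb_refl tangent_space_subspace sub q)
  show "dim (tangent_space (normal_hull p) q) = dim (normal_space (orb q) q) + k"
    using max_orbit_dim_dim_orbit_normal[OF regular_max_orbit_dim[OF p] regular_max_orbit_dim[OF q(2)]]
    by (simp add: normal_space_orb orb_refl tangent_space_subspace sub q k)
  fix g assume g: "g \<in> carrier G" "\<rho> g q \<in> normal_hull p"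
  have "(\<star>) (endo (\<rho> g)) ` normal_hull p = normal_hull p"
    using g by (intro normal_hull_conj[OF q(2,1)] rep_mem) auto
  then show "\<rho> g ` normal_hull p = normal_hull p"
    using g(1) by simp
qed

text \<open>Since \<open>p\<close> is normal at \<open>p\<close>, it lies in
  \<open>T = tangent_space S p\<close>, so the geodesics from \<open>p\<close> fill
  \<open>p + T = T\<close> inside \<open>S\<close>. At another regular point of \<open>T\<close> the
  tangent space of \<open>S\<close> contains \<open>T\<close> and has the same dimension by (C3), so
  \<open>T\<close> contains the normal space there as well.\<close>

lemma normal_hull_subset_k_section:
  assumes "k_section G \<rho> k S" "p \<in> S" and p: "regular p"
  shows "normal_hull p \<subseteq> S"
proof -
  obtain d where S: "submanifold d S" "geodesically_complete S" "totally_geodesic S"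
    and C3: "\<And>q. q \<in> S \<Longrightarrow> regular q \<Longrightarrow> orbit_normal q \<subseteq> tangent_space S q"
      "\<And>q. q \<in> S \<Longrightarrow> regular q \<Longrightarrow> dim (tangent_space S q) = dim (orbit_normal q) + k"
    using assms(1) unfolding k_section_def regular_point_iff orbit_eq normal_space_orb[OF orb_refl] by blast
  note subT = submanifold_tangent(1)[OF S(1)]
  define T where "T = tangent_space S p"
  have T: "subspace T" "p \<in> T"
    using subT[OF assms(2)] C3(1)[OF assms(2) p] self_mem_orbit_normal by (auto simp: T_def)
  have TS: "T \<subseteq> S"
  proof
    fix x assume "x \<in> T"
    then have "x - p \<in> T"
      by (intro subspace_diff T)
    from totally_geodesic_contains_lines[OF S(1,3,2) assms(2) this[unfolded T_def]] show "x \<in> S"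
      by simp
  qed
  have "orbit_normal q \<subseteq> T" if q: "q \<in> T" "regular q" for q
  proof -
    have qS: "q \<in> S"
      using q TS by blast
    have "T \<subseteq> tangent_space S q"
    proof
      fix u assume "u \<in> T"
      then have "q + t *\<^sub>R u \<in> S" for t
        using TS by (meson T(1) q(1) subsetD subspace_add subspace_scale)
      then show "u \<in> tangent_space S q"
        unfolding tangent_space_def using line_curve_in by blast
    qed
    moreover have "dim (tangent_space S q) = dim T"
      using C3(2)[OF qS q(2)] C3(2)[OF assms(2) p] max_orbit_dim_dim_orbit_normal[OF regular_max_orbit_dim[OF p] regular_max_orbit_dim[OF q(2)]]
      by (simp add: T_def)
    ultimately have "T = tangent_space S q"
      using subspace_dim_equal[OF T(1) subT[OF qS]] by simp
    then show ?thesis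
      using C3(1)[OF qS q(2)] by simp
  qed
  then have "normal_closed T"
    using T by (simp add: normal_closed_def)
  then have "normal_hull p \<subseteq> T"
    using T(2) by (rule normal_hull_least)
  with TS show ?thesis
    by blast
qed

lemma ex_dim_normal_hull:
  assumes "regular p"
  obtains k where "dim (normal_hull p) = dim (orbit_normal p) + k"
  using dim_subset[OF orbit_normal_subset_normal_hull[OF assms mem_normal_hull]] le_Suc_ex by metis

lemma minimal_section_eq:
  assumes p: "regular p"
  shows "minimal_section G \<rho> p = normal_hull p"
  unfolding minimal_section_def
proof (rule the_equality)
  have mem: "normal_hull p \<in> sections_through G \<rho> p"
    using ex_dim_normal_hull[OF p] k_section_normal_hull[OF p] mem_normal_hull by (metis (mono_tags, lifting) mem_Collect_eq sections_through_def)
  have least: "normal_hull p \<subseteq> S" if "S \<in> sections_through G \<rho> p" for S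
    using that normal_hull_subset_k_section[OF _ _ p] by (auto simp: sections_through_def)
  show "normal_hull p \<in> sections_through G \<rho> p \<and> (\<forall>S'\<in>sections_through G \<rho> p. S' \<subseteq> normal_hull p \<longrightarrow> S' = normal_hull p)"
    using mem least by blast
  fix S assume "S \<in> sections_through G \<rho> p \<and> (\<forall>S'\<in>sections_through G \<rho> p. S' \<subseteq> S \<longrightarrow> S' = S)"
  with mem least show "S = normal_hull p"
    by blast
qed

text \<open>The excess dimension is the same at every regular point \<open>q\<close>: some point of
  its orbit is normal at \<open>p\<close>, hence lies in the hull of \<open>p\<close> and generates
  it.\<close>

lemma copol_eq:
  assumes p: "regular p" and k: "dim (normal_hull p) = dim (orbit_normal p) + k"
  shows "copol G \<rho> = k"
  unfolding copol_def regular_point_iff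
proof (rule the_equality)
  have "k_section G \<rho> k (normal_hull q)" if q: "regular q" for q
  proof (rule k_section_normal_hull[OF q])
    obtain h where h: "h \<in> H" "h \<star> q \<in> orbit_normal p"
      using orbit_meets_normal_space by blast
    then have "normal_hull (h \<star> q) = normal_hull p"
      using orbit_normal_subset_normal_hull[OF p mem_normal_hull] by (intro normal_hull_eq regular_app q) auto
    then have "dim (normal_hull q) = dim (normal_hull p)"
      by (metis normal_hull_app[OF h(1)] dim_app[OF h(1)])
    then show "dim (normal_hull q) = dim (orbit_normal q) + k"
      using max_orbit_dim_dim_orbit_normal[OF regular_max_orbit_dim[OF p] regular_max_orbit_dim[OF q]] k by simp
  qed
  then show "\<forall>q. regular q \<longrightarrow> k_section G \<rho> k (minimal_section G \<rho> q)"
    by (simp add: minimal_section_eq)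
  fix k' assume "\<forall>q. regular q \<longrightarrow> k_section G \<rho> k' (minimal_section G \<rho> q)"
  then have "k_section G \<rho> k' (normal_hull p)"
    using p by (metis minimal_section_eq)
  then have "dim (normal_hull p) = dim (orbit_normal p) + k'"
    using p mem_normal_hull[of p] unfolding k_section_def regular_point_iff orbit_eq
    by (metis normal_space_orb orb_refl subspace_normal_hull tangent_space_subspace)
  with k show "k' = k"
    by simp
qed

lemma copol_le:
  assumes "regular p" "normal_closed S" "p \<in> S" "dim S = dim (orbit_normal p) + k"
  shows "copol G \<rho> \<le> k"
proof -
  obtain k' where k': "dim (normal_hull p) = dim (orbit_normal p) + k'"
    using ex_dim_normal_hull[OF assms(1)] by blast
  have "dim (normal_hull p) \<le> dim S"
    by (rule dim_subset[OF normal_hull_least[OF assms(2,3)]])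
  with k' assms(4) copol_eq[OF assms(1) k'] show ?thesis
    by simp
qed

section \<open>Jacobi fields and variational co-completeness\<close>

lemma Jacobi_field_affine:
  assumes "Jacobi_field J J'"
  shows "J t = J 0 + t *\<^sub>R J' 0" "J' t = J' 0"
proof -
  have "(J' has_vector_derivative 0) (at t within UNIV)" for t
    using assms by (simp add: Jacobi_field_def)
  then obtain w where w: "\<And>t. J' t = w"
    using has_vector_derivative_zero_constant[of UNIV J'] by auto
  then have J: "(J has_vector_derivative w) (at t)" for t
    using assms by (simp add: Jacobi_field_def)
  have "((\<lambda>t. J t - t *\<^sub>R w) has_vector_derivative 0) (at t within UNIV)" for t
    using J[of t] by (auto intro!: derivative_eq_intros)
  then obtain z where z: "\<And>t. J t - t *\<^sub>R w = z"
    using has_vector_derivative_zero_constant[of UNIV "\<lambda>t. J t - t *\<^sub>R w"] by auto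
  from z[of t] z[of 0] show "J t = J 0 + t *\<^sub>R J' 0"
    by (simp add: w algebra_simps)
  show "J' t = J' 0"
    by (simp add: w)
qed

text \<open>A zero at \<open>t0\<close> makes \<open>J' 0\<close> a multiple of \<open>J 0\<close>,
  hence tangent. The normal vector \<open>J' 0 + A\<^sub>v (J 0)\<close> is then tangent too, so it
  is 0, and orthogonality to \<open>U\<close> concerns \<open>J 0\<close> alone.\<close>

lemma property_P_section:
  assumes S: "subspace S" "\<And>q. q \<in> S \<Longrightarrow> max_orbit_dim q \<Longrightarrow> orbit_normal q \<subseteq> S" and p: "p \<in> S" "max_orbit_dim p"
  shows "property_P G \<rho> (orb p) p (S \<inter> orbit_tangent p)"
  unfolding property_P_def normal_space_orb[OF orb_refl]
proof (intro ballI allI impI)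
  fix v J J'
  assume v: "v \<in> orbit_normal p" and A: "N_Jacobi_field (orb p) p v J J' \<and> (\<exists>t0>0. J t0 = 0) \<and>
    J 0 + (J' 0 + shape_operator (orb p) p v (J 0)) \<in> (S \<inter> orbit_tangent p)\<^sup>\<bottom>"
  then obtain t0 where t0: "t0 > 0" "J t0 = 0"
    by blast
  have jac: "Jacobi_field J J'" and J0: "J 0 \<in> orbit_tangent p"
    and nor: "J' 0 + shape_operator (orb p) p v (J 0) \<in> orbit_normal p"
    using A by (auto simp: N_Jacobi_field_def tangent_space_orb normal_space_orb orb_refl)
  obtain Z where Z: "Z \<in> lie" "J 0 = Z \<star> p"
    using J0 by (auto simp: orbit_tangent_def)
  have J1: "J 0 = - t0 *\<^sub>R J' 0"
    using Jacobi_field_affine(1)[OF jac, of t0] t0(2) by (simp add: eq_neg_iff_add_eq_0)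
  have shape: "shape_operator (orb p) p v (J 0) = - orth_proj (orbit_tangent p) (Z \<star> v)"
    unfolding Z(2) by (rule shape_operator_orb[OF Z(1) v])
  have "J' 0 = (- 1 / t0) *\<^sub>R J 0"
    using t0 by (simp add: J1)
  then have "J' 0 \<in> orbit_tangent p"
    using J0 by (simp add: subspace_scale subspace_orbit_tangent subspace_neg)
  then have "J' 0 + shape_operator (orb p) p v (J 0) \<in> orbit_tangent p"
    unfolding shape by (intro subspace_add subspace_neg subspace_orbit_tangent orth_proj_exists)
  with nor have zero: "J' 0 + shape_operator (orb p) p v (J 0) = 0"
    using orthogonal_compD[of _ "orbit_tangent p"] unfolding orbit_normal_def by (metis inner_eq_zero_iff)
  then have J'0: "J' 0 = orth_proj (orbit_tangent p) (Z \<star> v)"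
    by (simp add: shape)
  \<comment> \<open>\<open>S\<close> contains the normal space, so it is the sum of that space and
    \<open>S \<inter> orbit_tangent p\<close>; the tangent vector \<open>Z \<star> p\<close> is
    orthogonal to both.\<close>
  have "Z \<star> p \<in> S\<^sup>\<bottom>"
  proof (rule orthogonal_compI)
    fix x assume x: "x \<in> S"
    define y where "y = orth_proj (orbit_tangent p) x"
    have xy: "y \<in> orbit_tangent p" "x - y \<in> orbit_normal p"
      unfolding y_def orbit_normal_def by (rule orth_proj_exists[OF subspace_orbit_tangent])+
    then have "x - y \<in> S"
      using S(2)[OF p] by blast
    then have "x - (x - y) \<in> S"
      by (rule subspace_diff[OF S(1) x])
    then have "y \<in> S \<inter> orbit_tangent p"
      using xy by simp
    moreover have "J 0 \<in> (S \<inter> orbit_tangent p)\<^sup>\<bottom>"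
      using A zero by simp
    ultimately have "y \<bullet> (Z \<star> p) = 0"
      using orthogonal_compD by (metis Z(2))
    moreover have "(x - y) \<bullet> (Z \<star> p) = 0"
      using orbit_normalD[OF xy(2) Z(1)] by (simp add: inner_commute)
    ultimately show "x \<bullet> (Z \<star> p) = 0"
      by (simp add: inner_diff_left)
  qed
  moreover have "t0 *\<^sub>R orth_proj (orbit_tangent p) (Z \<star> v) = - (Z \<star> p)"
    using J1 by (simp add: J'0 Z(2))
  ultimately obtain Y where Y: "Y \<in> lie" "Y \<star> p = Z \<star> p" "Y \<star> (p + t0 *\<^sub>R v) = 0"
    using max_orbit_dim_focal[OF S p v Z(1)] by blast
  have Yv: "Y \<star> v = J' 0"
  proof -
    have "t0 *\<^sub>R (Y \<star> v) = - (Z \<star> p)"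
      using Y(2,3) by (simp add: app.add_right app.scaleR_right add_eq_0_iff)
    also have "\<dots> = t0 *\<^sub>R J' 0"
      using J1 by (simp add: Z(2))
    finally show ?thesis
      using t0(1) by simp
  qed
  have "J t = Y \<star> (p + t *\<^sub>R v)" for t
    using Jacobi_field_affine(1)[OF jac, of t] by (simp add: app.add_right app.scaleR_right Y(2) Yv Z(2))
  then show "\<exists>K. induced_Killing_field G \<rho> K \<and> (\<forall>t. J t = K (p + t *\<^sub>R v))"
    using induced_Killing_field_lie[OF Y(1)] by blast
qed

text \<open>One subspace serves all principal orbits: any point \<open>q\<close> of such an orbit
  can be moved into the normal space at \<open>p\<close>, hence into \<open>S\<close>, and
  \<open>S\<close> is moved back by the inverse element.\<close>

lemma covar_le_section:
  assumes S: "subspace S" "\<And>q. q \<in> S \<Longrightarrow> max_orbit_dim q \<Longrightarrow> orbit_normal q \<subseteq> S"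
    and p: "p \<in> S" "max_orbit_dim p" and dimS: "dim S = dim (orbit_normal p) + k"
  shows "covar_le G \<rho> k"
  unfolding covar_le_def
proof (intro allI impI ballI)
  fix N q assume "principal_orbit G \<rho> N" and q: "q \<in> N"
  then obtain q0 where q0: "regular q0" "N = orb q0"
    by (auto simp: principal_orbit_def regular_point_iff orbit_eq)
  then have N: "N = orb q" and reg: "max_orbit_dim q"
    using q orb_eq regular_max_orbit_dim[OF q0(1)] by (auto simp: orb_def max_orbit_dim_app)
  obtain h where h: "h \<in> H" "h \<star> q \<in> orbit_normal p"
    using orbit_meets_normal_space by blast
  obtain g where g: "g \<in> H" "\<And>x. g \<star> h \<star> x = x" "\<And>x. h \<star> g \<star> x = x"
    using inverse_app[OF h(1)] by blast
  define S' where "S' = (\<star>) g ` S"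
  have S': "subspace S'"
    unfolding S'_def by (intro linear_subspace_image linear_app S)
  have nS': "orbit_normal x \<subseteq> S'" if x: "x \<in> S'" "max_orbit_dim x" for x
  proof -
    obtain y where y: "y \<in> S" "x = g \<star> y"
      using x by (auto simp: S'_def)
    then have "orbit_normal y \<subseteq> S"
      using x(2) by (intro S) (auto simp: max_orbit_dim_app g)
    then show ?thesis
      by (auto simp: y orbit_normal_app g S'_def)
  qed
  have "h \<star> q \<in> S"
    using h(2) S(2)[OF p] by blast
  then have qS': "q \<in> S'"
    unfolding S'_def using g(2) by (metis image_eqI)
  \<comment> \<open>The complement of the normal space inside \<open>S'\<close>, which explains the
    dimension \<open>k\<close>.\<close>
  have "S' \<inter> orbit_tangent q = {y \<in> S'. \<forall>x\<in>orbit_normal q. orthogonal x y}"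
    by (auto simp: orbit_normal_comp[symmetric] orthogonal_comp_def)
  then have "dim (S' \<inter> orbit_tangent q) + dim (orbit_normal q) = dim S'"
    using dim_subspace_orthogonal_to_vectors[OF subspace_orbit_normal S' nS'[OF qS' reg]] by simp
  also have "dim S' = dim (orbit_normal q) + k"
    using dimS max_orbit_dim_dim_orbit_normal[OF p(2) reg] by (simp add: S'_def dim_app g)
  finally have "dim (S' \<inter> orbit_tangent q) = k"
    by simp
  then show "\<exists>U. subspace U \<and> dim U \<le> k \<and> property_P G \<rho> N q U"
    using property_P_section[OF S' nS' qS' reg] subspace_inter[OF S' subspace_orbit_tangent]
    unfolding N by (intro exI[of _ "S' \<inter> orbit_tangent q"]) auto
qed

text \<open>Translates the geometric hypotheses on fields and forms along the orbit into the
  conditions of \<open>section_data\<close> on generators at \<open>p\<close>.\<close>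

lemma section_data_distribution:
  assumes D: "distribution_on (orb p) k D" and inv: "invariant_distribution G \<rho> (orb p) D"
    and auto: "autoparallel_on (orb p) D" and sec: "second_form_invariant (orb p) D"
    and P: "property_P_Euc G \<rho> (orb p) D"
  shows "section_data H p (D p)"
proof
  have Dp: "subspace (D q)" "D q \<subseteq> orbit_tangent q" "dim (D q) = k" if "q \<in> orb p" for q
    using D that by (auto simp: distribution_on_def tangent_space_orb')
  show "subspace (D p)" "D p \<subseteq> orbit_tangent p"
    using Dp orb_refl by blast+
  fix X v assume X: "X \<in> lie"
  show "\<exists>Y\<in>lie. Y \<star> p = X \<star> p \<and> Y \<star> v = - l *\<^sub>R (X \<star> p)"
    if v: "v \<in> orbit_normal p" and perp: "X \<star> p \<in> (D p)\<^sup>\<bottom>" and l: "l \<noteq> 0"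
      and eig: "orth_proj (orbit_tangent p) (X \<star> v) = - l *\<^sub>R (X \<star> p)" for l
  proof -
    define q where "q = p + (1 / l) *\<^sub>R v"
    have "shape_operator (orb p) p v (X \<star> p) = l *\<^sub>R (X \<star> p)"
      by (simp add: shape_operator_orb[OF X v] eig)
    then have "X \<star> p \<in> tangent_space (isotropy_orbit G \<rho> q p) p"
      using P v perp l orbit_tangentI[OF X, of p] unfolding property_P_Euc_def q_def
      by (simp add: orb_refl normal_space_orb tangent_space_orb)
    moreover interpret S: orthogonal_group "stab q"
      by (rule orthogonal_group_stab)
    have "isotropy_orbit G \<rho> q p = S.orb p"
      by (simp add: isotropy_orbit_eq S.orb_def)
    ultimately have "X \<star> p \<in> S.orbit_tangent p"
      by (simp add: S.tangent_space_orb)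
    \<comment> \<open>A tangent vector of the isotropy orbit comes from a generator killing
      \<open>q\<close>; expanding \<open>Y \<star> q = 0\<close> gives the exact value of
      \<open>Y \<star> v\<close>.\<close>
    then obtain Y where Y: "Y \<in> lie" "Y \<star> q = 0" "Y \<star> p = X \<star> p"
      by (auto simp: S.orbit_tangent_def lie_stab)
    then have "(1 / l) *\<^sub>R (Y \<star> v) = - (X \<star> p)"
      by (simp add: q_def app.add_right app.scaleR_right add_eq_0_iff)
    then have "l *\<^sub>R ((1 / l) *\<^sub>R (Y \<star> v)) = l *\<^sub>R (- (X \<star> p))"
      by simp
    then have "Y \<star> v = - l *\<^sub>R (X \<star> p)"
      using l by simp
    with Y show ?thesis
      by blast
  qed
  assume XD: "X \<star> p \<in> D p"
  show "(X \<star> v) \<bullet> y = 0" if v: "v \<in> orbit_normal p" and y: "y \<in> orbit_tangent p \<inter> (D p)\<^sup>\<bottom>" for y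
  proof -
    have "second_form (orb p) p (X \<star> p) y = 0"
      using sec XD y orb_refl[of p] unfolding second_form_invariant_def tangent_space_orb[of p, symmetric] by blast
    then have "(X \<star> y) \<bullet> v = 0"
      using second_form_orb[OF X, of y p] orth_proj_inner[OF subspace_orbit_normal v, of "X \<star> y"] y by simp
    then show ?thesis
      using lie_skew[OF X, of v y] by (simp add: inner_commute)
  qed
  show "(X \<star> y) \<bullet> z = 0" if y: "y \<in> D p" and z: "z \<in> orbit_tangent p \<inter> (D p)\<^sup>\<bottom>" for y z
  proof -
    \<comment> \<open>Projecting a constant field onto \<open>D\<close> extends each vector of
      \<open>D p\<close> to a global section, as \<open>autoparallel_on\<close> requires.\<close>
    define F where "F w q = orth_proj (D q) w" for w q
    have F: "section_of (orb p) D (F w)" for w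
      unfolding section_of_def F_def
    proof
      show "smooth_on (orb p) (\<lambda>q. orth_proj (D q) w)"
        using D Dp(3) unfolding distribution_on_def by (intro smooth_on_orth_proj[where k = k]) auto
      show "\<forall>q\<in>orb p. orth_proj (D q) w \<in> D q"
        using Dp(1) orth_proj_exists(1) by blast
    qed
    have Fp: "F w p = w" if "w \<in> D p" for w
      unfolding F_def using that Dp(1)[OF orb_refl] by simp
    define w where "w = deriv_along (orb p) (F y) p (X \<star> p)"
    have "levi_civita (orb p) (F (X \<star> p)) (F y) p \<in> D p"
      using auto F orb_refl unfolding autoparallel_on_def by blast
    then have "orth_proj (orbit_tangent p) w \<in> D p"
      by (simp add: levi_civita_def tangent_space_orb Fp XD w_def)
    then have wz: "w \<bullet> z = 0"
      using orth_proj_inner[OF subspace_orbit_tangent, of z p w] z by (auto dest: orthogonal_compD)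
    have "((\<lambda>t. F y (exp (t *\<^sub>R X) \<star> p)) has_vector_derivative w) (at 0)"
      unfolding w_def using F
      by (intro deriv_along_curve curve_in_exp X orb_refl) (auto simp: section_of_def)
    from bounded_bilinear.has_vector_derivative[OF bounded_bilinear_inner this
        exp_app_has_vector_derivative[of X z 0]]
    have "((\<lambda>t. F y (exp (t *\<^sub>R X) \<star> p) \<bullet> (exp (t *\<^sub>R X) \<star> z)) has_vector_derivative
        y \<bullet> (X \<star> z) + w \<bullet> z) (at 0)"
      by (simp add: Fp y)
    \<comment> \<open>By invariance the group carries \<open>D p\<close> to the distribution along
      the curve, so the moved \<open>z\<close> stays orthogonal to it. Differentiating this relates
      \<open>X \<star> z\<close> to the covariant derivative, which has no component along
      \<open>z\<close>.\<close>
    moreover have "F y (exp (t *\<^sub>R X) \<star> p) \<bullet> (exp (t *\<^sub>R X) \<star> z) = 0" for t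
    proof -
      have E: "exp (t *\<^sub>R X) \<in> H"
        by (rule exp_mem[OF X])
      then obtain g where g: "g \<in> carrier G" "exp (t *\<^sub>R X) = endo (\<rho> g)"
        by (auto simp: H_def)
      have "D (\<rho> g p) = \<rho> g ` D p"
        using inv g(1) orb_refl by (simp add: invariant_distribution_def)
      moreover have "\<rho> g p \<in> orb p"
        using E g by (force simp: orb_def)
      then have "F y (\<rho> g p) \<in> D (\<rho> g p)"
        using F by (auto simp: section_of_def)
      ultimately obtain d where d: "d \<in> D p" "F y (\<rho> g p) = \<rho> g d"
        by auto
      have "(exp (t *\<^sub>R X) \<star> d) \<bullet> (exp (t *\<^sub>R X) \<star> z) = 0"
        using d(1) z by (auto simp: inner_app[OF E] dest: orthogonal_compD)
      then show ?thesis
        using g d(2) by simp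
    qed
    ultimately have "((\<lambda>t. 0) has_vector_derivative y \<bullet> (X \<star> z) + w \<bullet> z) (at 0)"
      by simp
    then have "y \<bullet> (X \<star> z) + w \<bullet> z = 0"
      by (rule vector_derivative_unique_at) simp
    then show ?thesis
      using wz lie_skew[OF X, of y z] by simp
  qed
qed

end

theorem theorem8:
  fixes G :: "('g, 'm) monoid_scheme"
    and X :: "'g topology"
    and E :: "'e::euclidean_space set"
    and A :: "('g set \<times> ('g \<Rightarrow> 'e)) set"
    and \<rho> :: "'g \<Rightarrow> 'v::euclidean_space \<Rightarrow> 'v"
    and N :: "'v set"
    and D :: "'v \<Rightarrow> 'v set"
    and k :: nat
  assumes "lie_group G X E A"
    and "compact_space X"
    and "orthogonal_representation G X \<rho>"
    and "principal_orbit G \<rho> N"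
    and "distribution_on N k D"
    and "invariant_distribution G \<rho> N D"
    and "autoparallel_on N D"
    and "second_form_invariant N D"
    and "property_P_Euc G \<rho> N D"
  shows "copol G \<rho> \<le> k \<and> covar_le G \<rho> k"
proof -
  interpret compact_representation G X \<rho>
    using assms(1-3) by unfold_locales (auto simp: lie_group_def)
  obtain p where p: "regular p" and N: "N = orb p"
    using assms(4) by (auto simp: principal_orbit_def regular_point_iff orbit_eq)
  interpret section_data H p "D p"
    using assms(5-9) unfolding N by (rule section_data_distribution)
  have "dim (D p) = k"
    using assms(5) orb_refl unfolding N by (auto simp: distribution_on_def)
  then have dim: "dim \<Sigma> = dim (orbit_normal p) + k"
    by (simp add: dim_\<Sigma>)
  have "normal_closed \<Sigma>"
    unfolding normal_closed_def using subspace_\<Sigma> orbit_normal_subset_\<Sigma>_max_orbit_dim regular_max_orbit_dim by blast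
  then have "copol G \<rho> \<le> k"
    using copol_le[OF p _ mem_\<Sigma> dim] by blast
  moreover have "covar_le G \<rho> k"
    by (rule covar_le_section[OF subspace_\<Sigma> orbit_normal_subset_\<Sigma>_max_orbit_dim mem_\<Sigma> regular_max_orbit_dim[OF p] dim])
  ultimately show ?thesis
    by blast
qed

end
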